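(* Assume the Riemann hypothesis. There are absolute constants $C>0$ and $K>0$ such that for all $x\geq 2$ and all $T\geq 2$, $$ \mathbb{P}\big(\, |\langle J, \widetilde{\mathcal{Z}}_T(t)\rangle| \geq x\,\big) \leq K e^{-C x\log x}, $$ where $t$ is uniformly distributed on $[T,2T]$.
   Context: The non-trivial zeros of $\zeta$ are $1/2+i\gamma$, $\gamma\in\mathbb{R}$, with multiplicity. Let $\Omega(\xi):=\frac{1}{2}\frac{\Gamma'}{\Gamma}\big(\frac14+\frac{i\xi}{2}\big)+\frac{1}{2}\frac{\Gamma'}{\Gamma}\big(\frac14-\frac{i\xi}{2}\big)-\log\pi$. For a function $\eta$ define $$\langle \eta, \widetilde{\mathcal{Z}}_T(t)\rangle:=\lim_{V\to\infty}\Big[\sum_{|\gamma|<V}\eta\Big(\tfrac{\log T}{2\pi}(\gamma-t)\Big)-\int_{-V}^V\eta\Big(\tfrac{\log T}{2\pi}(\xi-t)\Big)\frac{\Omega(\xi)}{2\pi}\,d\xi\Big]$$ when the limit exists. Here $J(\xi):=\frac{2\pi\xi}{1+(2\pi\xi)^2}$, for which this limit exists for all $T,t$. *)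

theory Defs
  imports "HOL-Complex_Analysis.Complex_Analysis" "HOL-Probability.Probability"
begin

text \<open>
  The Riemann zeta function, as the analytic continuation of its Dirichlet series to the
  complex plane without 1. By the identity theorem the choice is unique except at the pole 1,
  where the value is unspecified; hence \<^term>\<open>s \<noteq> 1\<close> is required of zeros below.
\<close>
definition zeta :: "complex \<Rightarrow> complex" where
  "zeta = (SOME f. f holomorphic_on (- {1}) \<and>
                   (\<forall>s. Re s > 1 \<longrightarrow> f s = (\<Sum>n. 1 / of_nat (Suc n) powr s)))"

definition nontrivial_zeta_zero :: "complex \<Rightarrow> bool" where
  "nontrivial_zeta_zero s \<longleftrightarrow>
     s \<noteq> 1 \<and> zeta s = 0 \<and> \<not> (\<exists>n::nat. n \<ge> 1 \<and> s = - 2 * of_nat n)"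

definition Riemann_hypothesis :: bool where
  "Riemann_hypothesis \<longleftrightarrow> (\<forall>s. nontrivial_zeta_zero s \<longrightarrow> Re s = 1 / 2)"

text \<open>
  The two Digamma values are complex conjugates of each other, so the sum inside \<^const>\<open>Re\<close> is
  real and \<^const>\<open>Re\<close> only changes the type.
\<close>
definition Omega :: "real \<Rightarrow> real" where
  "Omega \<xi> = Re (1 / 2 * Digamma (1 / 4 + \<i> * of_real \<xi> / 2)
                + 1 / 2 * Digamma (1 / 4 - \<i> * of_real \<xi> / 2)) - ln pi"

text \<open>
  The sum runs over the distinct ordinates of the zeros on the critical line, each weighted by
  the multiplicity of the zero, and the pairing is meaningful when the limit exists.
\<close>
definition zeta_pairing :: "(real \<Rightarrow> real) \<Rightarrow> real \<Rightarrow> real \<Rightarrow> real" where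
  "zeta_pairing \<eta> T t =
     Lim at_top (\<lambda>V::real.
       (\<Sum>\<gamma> | \<bar>\<gamma>\<bar> < V \<and> nontrivial_zeta_zero (Complex (1 / 2) \<gamma>).
          of_int (zorder zeta (Complex (1 / 2) \<gamma>)) * \<eta> (ln T / (2 * pi) * (\<gamma> - t)))
       - integral {-V..V} (\<lambda>\<xi>. \<eta> (ln T / (2 * pi) * (\<xi> - t)) * (Omega \<xi> / (2 * pi))))"

definition J :: "real \<Rightarrow> real" where
  "J \<xi> = 2 * pi * \<xi> / (1 + (2 * pi * \<xi>)\<^sup>2)"

end

theory Submission
  imports Defs "HOL-Real_Asymp.Real_Asymp" "HOL-Number_Theory.Number_Theory"
begin

text \<open>
  Write \<open>L = ln T\<close>, \<open>a = 1 / L\<close> and \<open>E z = \<xi> (1 / 2 + z)\<close>. Since \<open>E\<close> is even and of order one with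
  purely imaginary zeros, \<open>E'/E\<close> is the symmetric sum of \<open>1 / (z - \<i> \<gamma>)\<close>, and the pairing
  with \<open>J\<close> equals \<open>a * Im (E'/E - \<psi>/2)\<close> at \<open>a + \<i> t\<close>, where \<open>\<psi>\<close> is the archimedean term.

  For \<open>Y \<ge> a / 2\<close>, comparing the partial fractions termwise bounds \<open>a * E'/E (a + \<i> t)\<close> by
  \<open>Y\<close> times the average of \<open>E'/E\<close> over the line \<open>Re z = Y\<close> against a nonnegative kernel whose Fourier
  transform has compact support: every term of \<open>Re (E'/E)\<close> is nonnegative and varies slowly on the
  scale \<open>Y\<close>. Moving this average to the half plane of absolute convergence turns it
  into a Dirichlet polynomial over prime powers \<open>n \<le> exp (2 / Y)\<close>, up to \<open>O (L)\<close>.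

  Taking \<open>Y = c x / L\<close>, the error contributes at most \<open>x / 2\<close>, and the prime polynomial has length
  \<open>T powr (2 / (c x))\<close>. Its moments of order \<open>2 k\<close> with \<open>k\<close> proportional to \<open>x\<close> are therefore governed by the
  diagonal and are at most \<open>3 * fact k * B ^ k / Y ^ (2 * k)\<close> on average. Markov's inequality then
  gives a bound of the shape \<open>(M / x) ^ k\<close>. For \<open>c x > L\<close> the choice \<open>Y = 1\<close> shows that the event is empty.
\<close>

section \<open>A band-limited kernel\<close>

text \<open>The scale \<open>Y\<close> must grow with \<open>x\<close>: on the line
  \<open>Re z = a\<close> itself the polynomial would have length \<open>T ^ 2\<close>, too long for
  the diagonal to govern its moments. The price of a larger \<open>Y\<close> is an archimedean term
  of size \<open>Y * L\<close>, which the small factor \<open>c\<close> keeps harmless. The Riemann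
  hypothesis acts in the passage from \<open>a\<close> to \<open>Y\<close>: with the zeros of
  \<open>E\<close> imaginary, every \<open>Re (1 / (z - \<i> * \<gamma>))\<close> is positive for
  \<open>Re z > 0\<close>, so a difference of two values of \<open>E'/E\<close> is bounded by one
  value of \<open>Re (E'/E)\<close>, whatever the spacing of the zeros. The kernel is a fourth power
  of a sinc because three properties are wanted at once: an even power is nonnegative, finite
  exponential type bounds the Fourier support, and decay of order four absorbs the quadratic loss of
  the comparison. Since \<open>zeta\<close> is introduced by a choice operator, its continuation has
  to be exhibited; this is done through the theta function, and the same integral gives the
  functional equation and the growth bound from which the symmetric sum over zeros is
  obtained.\<close>

lemma integrable_inverse_one_plus_sq: "integrable lborel (\<lambda>q::real. 1 / (1 + q\<^sup>2))"
proof -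
  have "set_integrable lborel (einterval (-\<infinity>) \<infinity>) (\<lambda>x. inverse (1 + x\<^sup>2))"
    by (rule integrable_inverse_1_plus_square)
  then show ?thesis by (simp add: set_integrable_def einterval_def inverse_eq_divide)
qed

lemma one_plus_sq_le: "1 + q\<^sup>2 \<le> (1 + \<bar>q\<bar>)\<^sup>2" for q :: real
  by (simp add: power2_eq_square algebra_simps)

lemma integrable_of_quadratic_decay:
  fixes g :: "real \<Rightarrow> 'b::{banach, second_countable_topology}"
  assumes "continuous_on UNIV g" "\<And>q. norm (g q) \<le> C / (1 + q\<^sup>2)"
  shows "integrable lborel g"
proof (rule Bochner_Integration.integrable_bound)
  show "integrable lborel (\<lambda>q::real. C / (1 + q\<^sup>2))"
    using integrable_mult_right[OF integrable_inverse_one_plus_sq, of C] by simp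
  show "g \<in> borel_measurable lborel" using borel_measurable_continuous_onI[OF assms(1)] by simp
  show "AE q in lborel. norm (g q) \<le> norm (C / (1 + q\<^sup>2))"
    by (intro AE_I2 order.trans[OF assms(2)]) (simp add: divide_right_mono)
qed

section \<open>Symmetric limits of integrals and horizontal contour shifts\<close>

lemma integral_symmetric_interval_tendsto:
  fixes g :: "real \<Rightarrow> 'b::euclidean_space"
  assumes "integrable lborel g"
  shows "((\<lambda>R. integral {-R..R} g) \<longlongrightarrow> (LINT q|lborel. g q)) at_top"
proof -
  have eq: "integral {-R..R} g = (LINT q|lborel. indicator {-R..R} q *\<^sub>R g q)" for R
  proof -
    have "set_integrable lborel {-R..R} g"
      unfolding set_integrable_def using assms by (intro integrable_mult_indicator) auto
    from set_borel_integral_eq_integral(2)[OF this] show ?thesis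
      by (simp add: set_lebesgue_integral_def)
  qed
  show ?thesis unfolding eq
  proof (rule integral_dominated_convergence_at_top[where w = "\<lambda>q. norm (g q)"])
    show "g \<in> borel_measurable lborel" using assms by auto
    show "(\<lambda>q. indicator {-R..R} q *\<^sub>R g q) \<in> borel_measurable lborel" for R
      using assms by measurable
    show "\<forall>\<^sub>F R in at_top. AE q in lborel. norm (indicator {-R..R} q *\<^sub>R g q) \<le> norm (g q)"
      by (intro always_eventually allI AE_I2) (auto simp: indicator_def)
    show "AE q in lborel. ((\<lambda>R. indicator {-R..R} q *\<^sub>R g q) \<longlongrightarrow> g q) at_top"
    proof (rule AE_I2)
      fix q :: real
      have "\<forall>\<^sub>F R in at_top. indicator {-R..R} q *\<^sub>R g q = g q"
        using eventually_ge_at_top[of "\<bar>q\<bar>"] by eventually_elim (auto simp: indicator_def)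
      then show "((\<lambda>R. indicator {-R..R} q *\<^sub>R g q) \<longlongrightarrow> g q) at_top"
        by (rule tendsto_eventually)
    qed
  qed (use assms in auto)
qed

text \<open>A primitive \<open>P\<close> on the convex half plane stands in for the rectangle
  contour: the horizontal sides are differences of \<open>P\<close> at the corners, and the vertical
  sides are at most \<open>C * (b2 - b1) / (1 + R^2)\<close>, which vanishes as \<open>R\<close>
  grows.\<close>

lemma integral_horizontal_shift:
  fixes G :: "complex \<Rightarrow> complex"
  assumes hol: "G holomorphic_on {\<zeta>. Im \<zeta> > b0}" and b: "b0 < b1" "b1 \<le> b2"
    and bound: "\<And>\<zeta>. b1 \<le> Im \<zeta> \<Longrightarrow> Im \<zeta> \<le> b2 \<Longrightarrow> norm (G \<zeta>) \<le> C / (1 + (Re \<zeta>)\<^sup>2)"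
  shows "integrable lborel (\<lambda>q. G (Complex q b1))" "integrable lborel (\<lambda>q. G (Complex q b2))"
    "(LINT q|lborel. G (Complex q b1)) = (LINT q|lborel. G (Complex q b2))"
proof -
  have contG: "continuous_on {\<zeta>. Im \<zeta> > b0} G"
    using hol by (rule holomorphic_on_imp_continuous_on)
  have cc: "continuous_on UNIV (\<lambda>q. Complex q y)" for y
    unfolding Complex_eq by (intro continuous_intros)
  have cont: "continuous_on UNIV (\<lambda>q. G (Complex q y))" if "y > b0" for y
    by (rule continuous_on_compose2[OF contG cc]) (use that in auto)
  have int: "integrable lborel (\<lambda>q. G (Complex q y))" if "b1 \<le> y" "y \<le> b2" for y
  proof (rule integrable_of_quadratic_decay[where C = C])
    show "norm (G (Complex q y)) \<le> C / (1 + q\<^sup>2)" for q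
      using bound[of "Complex q y"] that by simp
  qed (use b that in \<open>auto intro: cont\<close>)
  show "integrable lborel (\<lambda>q. G (Complex q b1))" "integrable lborel (\<lambda>q. G (Complex q b2))"
    using int[of b1] int[of b2] b by simp_all
  obtain P where P: "\<And>z. z \<in> {\<zeta>. Im \<zeta> > b0} \<Longrightarrow> (P has_field_derivative G z) (at z within {\<zeta>. Im \<zeta> > b0})"
    by (rule holomorphic_convex_primitive'[OF convex_halfspace_Im_gt open_halfspace_Im_gt hol]) (rule that)
  have P': "(P has_field_derivative G z) (at z)" if "Im z > b0" for z
    using P[of z] that by (simp add: at_within_open[OF _ open_halfspace_Im_gt])
  have ftc: "integral {-R..R} (\<lambda>q. G (Complex q y)) = P (Complex R y) - P (Complex (-R) y)"
    if "y > b0" "R > 0" for R y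
  proof (rule integral_unique, rule fundamental_theorem_of_calculus)
    fix q :: real
    have "((\<lambda>q. P (Complex q y)) has_vector_derivative G (Complex q y)) (at q)"
    proof -
      have "((\<lambda>q. Complex q y) has_vector_derivative 1) (at q)"
        unfolding Complex_eq by (auto intro!: derivative_eq_intros)
      from field_vector_diff_chain_at[OF this P'[of "Complex q y"]] that show ?thesis
        by (simp add: o_def)
    qed
    then show "((\<lambda>q. P (Complex q y)) has_vector_derivative G (Complex q y)) (at q within {-R..R})"
      by (rule has_vector_derivative_at_within)
  qed (use that in auto)
  have vert: "norm (P (Complex R b2) - P (Complex R b1)) \<le> C / (1 + R\<^sup>2) * (b2 - b1)" for R
  proof -
    let ?S = "{\<zeta>. Re \<zeta> = R} \<inter> {\<zeta>. b1 \<le> Im \<zeta>} \<inter> {\<zeta>. Im \<zeta> \<le> b2}"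
    have "norm (P (Complex R b2) - P (Complex R b1)) \<le> C / (1 + R\<^sup>2) * norm (Complex R b2 - Complex R b1)"
    proof (rule field_differentiable_bound[where S = ?S and f' = G])
      show "convex ?S" using convex_halfspace_Im_ge convex_halfspace_Im_le
        by (intro convex_Int) (auto simp: convex_alt algebra_simps)
      show "(P has_field_derivative G z) (at z within ?S)" if "z \<in> ?S" for z
        using that b by (intro has_field_derivative_at_within[OF P']) auto
      show "norm (G z) \<le> C / (1 + R\<^sup>2)" if "z \<in> ?S" for z
        using bound[of z] that by auto
    qed (use b in auto)
    also have "norm (Complex R b2 - Complex R b1) = b2 - b1"
      using b by (simp add: cmod_def)
    finally show ?thesis .
  qed
  have lim0: "((\<lambda>R::real. C / (1 + R\<^sup>2) * (b2 - b1)) \<longlongrightarrow> 0) at_top"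
  proof -
    have "filterlim (\<lambda>R::real. 1 + R\<^sup>2) at_top at_top"
      by (intro filterlim_tendsto_add_at_top[OF tendsto_const] filterlim_pow_at_top filterlim_ident) auto
    from tendsto_mult_right_zero[OF tendsto_mult_left_zero[OF tendsto_inverse_0_at_top[OF this], of C], of "b2 - b1"]
    show ?thesis by (simp add: divide_inverse mult_ac)
  qed
  have v0: "((\<lambda>R. P (Complex R b2) - P (Complex R b1)) \<longlongrightarrow> 0) at_top"
    by (rule Lim_null_comparison[OF always_eventually lim0]) (use vert in auto)
  have v1: "((\<lambda>R. P (Complex (-R) b2) - P (Complex (-R) b1)) \<longlongrightarrow> 0) at_top"
    by (rule Lim_null_comparison[OF always_eventually lim0]) (use vert[of "- R" for R] in auto)
  have "((\<lambda>R. integral {-R..R} (\<lambda>q. G (Complex q b2)) - integral {-R..R} (\<lambda>q. G (Complex q b1))) \<longlongrightarrow> 0 - 0) at_top"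
  proof (rule Lim_transform_eventually[OF tendsto_diff[OF v0 v1]])
    show "\<forall>\<^sub>F R in at_top. P (Complex R b2) - P (Complex R b1) - (P (Complex (-R) b2) - P (Complex (-R) b1))
        = integral {-R..R} (\<lambda>q. G (Complex q b2)) - integral {-R..R} (\<lambda>q. G (Complex q b1))"
      using eventually_gt_at_top[of 0] by eventually_elim (use b in \<open>simp add: ftc\<close>)
  qed
  moreover have "((\<lambda>R. integral {-R..R} (\<lambda>q. G (Complex q b2)) - integral {-R..R} (\<lambda>q. G (Complex q b1))) \<longlongrightarrow>
      (LINT q|lborel. G (Complex q b2)) - (LINT q|lborel. G (Complex q b1))) at_top"
    by (intro tendsto_diff integral_symmetric_interval_tendsto int) (use b in auto)
  ultimately show "(LINT q|lborel. G (Complex q b1)) = (LINT q|lborel. G (Complex q b2))"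
    using tendsto_unique[OF trivial_limit_at_top_linorder] by fastforce
qed

section \<open>The sinc kernel: decay on strips and Fourier support\<close>

definition csinc :: "complex \<Rightarrow> complex" where "csinc z = (if z = 0 then 1 else sin z / z)"

lemma holomorphic_csinc: "csinc holomorphic_on UNIV"
proof (rule no_isolated_singularity'[of "{0}"])
  show "(csinc \<longlongrightarrow> csinc z) (at z within UNIV)" if "z \<in> {0}" for z
  proof -
    have "((\<lambda>h. (sin (0 + h) - sin 0) / h) \<longlongrightarrow> cos 0) (at (0::complex))"
      using DERIV_sin[of "0::complex"] unfolding DERIV_def .
    then have "((\<lambda>h::complex. sin h / h) \<longlongrightarrow> 1) (at 0)" by simp
    then have "(csinc \<longlongrightarrow> 1) (at 0)"
      by (rule Lim_transform_eventually) (auto simp: csinc_def eventually_at_filter)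
    then show ?thesis using that by (simp add: csinc_def)
  qed
  show "csinc holomorphic_on UNIV - {0}"
    by (rule holomorphic_transform[of "\<lambda>z. sin z / z"]) (auto simp: csinc_def intro!: holomorphic_intros)
qed auto

lemma norm_exp_i_le: "norm (exp (\<i> * w)) \<le> exp \<bar>Im w\<bar>" "norm (exp (- (\<i> * w))) \<le> exp \<bar>Im w\<bar>"
  by simp_all

lemma norm_sin_le: "norm (sin w) \<le> exp \<bar>Im w\<bar>" for w :: complex
proof -
  have "norm (sin w) = norm (exp (\<i> * w) - exp (- (\<i> * w))) / 2"
    by (simp add: sin_exp_eq norm_divide norm_mult)
  also have "\<dots> \<le> (exp \<bar>Im w\<bar> + exp \<bar>Im w\<bar>) / 2"
    by (intro divide_right_mono order.trans[OF norm_triangle_ineq4] add_mono norm_exp_i_le) auto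
  finally show ?thesis by simp
qed

lemma norm_cos_le: "norm (cos w) \<le> exp \<bar>Im w\<bar>" for w :: complex
proof -
  have "norm (cos w) = norm (exp (\<i> * w) + exp (- (\<i> * w))) / 2"
    by (simp add: cos_exp_eq norm_divide norm_mult)
  also have "\<dots> \<le> (exp \<bar>Im w\<bar> + exp \<bar>Im w\<bar>) / 2"
    by (intro divide_right_mono order.trans[OF norm_triangle_ineq] add_mono norm_exp_i_le) auto
  finally show ?thesis by simp
qed

text \<open>Near 0 the mean value theorem with \<open>norm (cos z) \<le> exp 1 \<le> 3\<close>
  applies, away from 0 the denominator decays. The common denominator \<open>1 + norm w\<close>
  allows powers to be taken without a case split.\<close>

lemma norm_csinc_le: "norm (csinc w) \<le> 6 * exp \<bar>Im w\<bar> / (1 + norm w)"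
proof (cases "norm w \<le> 1")
  case True
  have e3: "exp (1::real) \<le> 3" by (rule exp_le)
  have "norm (sin w - sin 0) \<le> 3 * norm (w - 0)"
  proof (rule field_differentiable_bound[where S = "cball 0 1" and f' = cos])
    show "(sin has_field_derivative cos z) (at z within cball 0 1)" for z :: complex
      by (auto intro!: derivative_eq_intros)
    show "norm (cos z) \<le> 3" if "z \<in> cball 0 1" for z :: complex
    proof -
      have "norm (cos z) \<le> exp \<bar>Im z\<bar>" by (rule norm_cos_le)
      also have "\<dots> \<le> exp 1" using that abs_Im_le_cmod[of z] by simp
      finally show ?thesis using e3 by simp
    qed
  qed (use True in auto)
  then have "norm (csinc w) \<le> 3" by (auto simp: csinc_def norm_divide divide_le_eq)
  also have "3 = 6 * 1 / (1 + 1 :: real)" by simp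
  also have "\<dots> \<le> 6 * exp \<bar>Im w\<bar> / (1 + norm w)" using True by (intro frac_le) (auto intro: add_pos_nonneg)
  finally show ?thesis .
next
  case False
  then have "norm (csinc w) = norm (sin w) / norm w" by (auto simp: csinc_def norm_divide)
  also have "\<dots> \<le> exp \<bar>Im w\<bar> / norm w" by (intro divide_right_mono norm_sin_le) auto
  also have "\<dots> = 6 * exp \<bar>Im w\<bar> / (6 * norm w)" by simp
  also have "\<dots> \<le> 6 * exp \<bar>Im w\<bar> / (1 + norm w)"
    using False by (intro divide_left_mono) (auto intro!: mult_pos_pos add_pos_nonneg)
  finally show ?thesis .
qed

text \<open>Sinc of half the argument has exponential type 1/2, so its fourth power has type 2; this
  is the 2 in the cutoff \<open>exp (2 / Y)\<close>. As an even power it is nonnegative on the real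
  line (a Jackson-type kernel).\<close>

definition kern :: "complex \<Rightarrow> complex" where "kern \<zeta> = csinc (\<zeta> / 2) ^ 4"

definition kern_real :: "real \<Rightarrow> real" where "kern_real q = Re (kern (of_real q))"

lemma holomorphic_kern: "kern holomorphic_on S"
proof -
  have "(\<lambda>\<zeta>. csinc (\<zeta> / 2)) holomorphic_on S"
    by (rule holomorphic_on_compose_gen[OF _ holomorphic_csinc, unfolded o_def]) (auto intro!: holomorphic_intros)
  then show ?thesis unfolding kern_def by (intro holomorphic_intros)
qed

lemma norm_kern_le: "norm (kern \<zeta>) \<le> 20736 * exp (2 * \<bar>Im \<zeta>\<bar>) / (1 + norm \<zeta>) ^ 4"
proof -
  have "norm (csinc (\<zeta> / 2)) \<le> 6 * exp \<bar>Im (\<zeta> / 2)\<bar> / (1 + norm (\<zeta> / 2))" by (rule norm_csinc_le)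
  also have "\<dots> = 12 * exp (\<bar>Im \<zeta>\<bar> / 2) / (2 + norm \<zeta>)" by (simp add: norm_divide field_simps)
  also have "\<dots> \<le> 12 * exp (\<bar>Im \<zeta>\<bar> / 2) / (1 + norm \<zeta>)"
    by (intro divide_left_mono) (auto intro!: mult_pos_pos add_pos_nonneg)
  finally have "norm (csinc (\<zeta> / 2)) ^ 4 \<le> (12 * exp (\<bar>Im \<zeta>\<bar> / 2) / (1 + norm \<zeta>)) ^ 4"
    by (intro power_mono) auto
  also have "\<dots> = 20736 * exp (2 * \<bar>Im \<zeta>\<bar>) / (1 + norm \<zeta>) ^ 4"
    by (simp add: power_divide power_mult_distrib exp_of_nat_mult[symmetric])
  finally show ?thesis by (simp add: kern_def norm_power)
qed

lemma csinc_of_real: "csinc (of_real x) = of_real (if x = 0 then 1 else sin x / x)"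
  by (simp add: csinc_def sin_of_real)

lemma kern_of_real: "kern (of_real q) = of_real (kern_real q)"
  and kern_real_eq: "kern_real q = (if q = 0 then 1 else sin (q / 2) / (q / 2)) ^ 4"
proof -
  have "kern (of_real q) = of_real ((if q / 2 = 0 then 1 else sin (q / 2) / (q / 2)) ^ 4)"
    unfolding kern_def using csinc_of_real[of "q / 2"] by (simp only: of_real_power[symmetric] of_real_divide of_real_numeral)
  then show "kern (of_real q) = of_real (kern_real q)"
    "kern_real q = (if q = 0 then 1 else sin (q / 2) / (q / 2)) ^ 4"
    unfolding kern_real_def by auto
qed

lemma kern_real_nonneg: "kern_real q \<ge> 0"
  unfolding kern_real_eq by (simp add: zero_le_power_eq)

lemma kern_real_le: "kern_real q \<le> 20736 / (1 + \<bar>q\<bar>) ^ 4"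
  using norm_kern_le[of "of_real q"] kern_real_nonneg[of q] by (simp add: kern_of_real)

text \<open>A lower bound on a window around 0 turns an average of a nonnegative function into a
  pointwise bound. The value is \<open>(1 / 2) ^ 4\<close>.\<close>

lemma kern_real_ge: "\<bar>q\<bar> \<le> 1 \<Longrightarrow> kern_real q \<ge> 1 / 16"
proof -
  assume q: "\<bar>q\<bar> \<le> 1"
  have "(1 / 2 :: real) \<le> sin x / x" if "x \<noteq> 0" "\<bar>x\<bar> \<le> 1/2" for x :: real
  proof -
    have "\<bar>sin x - (\<Sum>m<3. sin_coeff m * x ^ m)\<bar> \<le> inverse (fact 3) * \<bar>x\<bar> ^ 3"
      by (rule Maclaurin_sin_bound)
    then have "\<bar>sin x - x\<bar> \<le> \<bar>x\<bar> ^ 3 / 6"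
      by (simp add: sin_coeff_def numeral_3_eq_3 fact_numeral inverse_eq_divide)
    also have "\<bar>x\<bar> ^ 3 \<le> \<bar>x\<bar> * 1"
      using that power_le_one[of "\<bar>x\<bar>" 2] by (simp only: power3_eq_cube mult.assoc power2_eq_square) (intro mult_left_mono, auto)
    finally have *: "\<bar>sin x - x\<bar> \<le> \<bar>x\<bar> / 6" by simp
    then have "\<bar>(sin x - x) / x\<bar> \<le> 1 / 6" using that by (simp add: divide_le_eq)
    moreover have "sin x / x = 1 + (sin x - x) / x" using that by (simp add: field_simps)
    ultimately show ?thesis by linarith
  qed
  from this[of "q / 2"] have "(if q = 0 then 1 else sin (q / 2) / (q / 2)) \<ge> 1 / 2" using q by auto
  then have "(if q = 0 then 1 else sin (q / 2) / (q / 2)) ^ 4 \<ge> (1 / 2) ^ 4" by (intro power_mono) auto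
  then show ?thesis by (simp add: kern_real_eq power_divide)
qed

lemma continuous_kern_real: "continuous_on UNIV kern_real"
  unfolding kern_real_def
  by (intro continuous_intros continuous_on_compose2[OF holomorphic_on_imp_continuous_on[OF holomorphic_kern[of UNIV]]]) auto

text \<open>The weight is the factor lost in \<open>ldf_compare\<close>: two of the four orders of
  decay pay for it, the other two keep the product integrable.\<close>

lemma kern_real_weight_le: "(1 + \<bar>q\<bar>)\<^sup>2 * kern_real q \<le> 20736 / (1 + q\<^sup>2)"
proof -
  have "(1 + \<bar>q\<bar>)\<^sup>2 * kern_real q \<le> (1 + \<bar>q\<bar>)\<^sup>2 * (20736 / (1 + \<bar>q\<bar>) ^ 4)"
    by (intro mult_left_mono kern_real_le) auto
  also have "\<dots> = 20736 / (1 + \<bar>q\<bar>)\<^sup>2"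
  proof -
    have "(1 + \<bar>q\<bar>) ^ 4 = (1 + \<bar>q\<bar>)\<^sup>2 * (1 + \<bar>q\<bar>)\<^sup>2" by (simp flip: power_add)
    moreover have "(1 + \<bar>q\<bar>)\<^sup>2 \<noteq> 0" by (simp add: add_nonneg_eq_0_iff)
    moreover have "a * (20736 / (a * a)) = 20736 / a" if "a \<noteq> 0" for a :: real using that by simp
    ultimately show ?thesis by metis
  qed
  also have "\<dots> \<le> 20736 / (1 + q\<^sup>2)"
    using one_plus_sq_le[of q] by (intro divide_left_mono) (auto intro!: mult_pos_pos add_pos_nonneg zero_less_power)
  finally show ?thesis .
qed

lemma integrable_mult_kern_real:
  fixes g :: "real \<Rightarrow> complex"
  assumes "continuous_on UNIV g" "\<And>q. norm (g q) \<le> C * (1 + \<bar>q\<bar>)\<^sup>2"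
  shows "integrable lborel (\<lambda>q. g q * of_real (kern_real q))"
proof (rule integrable_of_quadratic_decay)
  show "continuous_on UNIV (\<lambda>q. g q * of_real (kern_real q))"
    by (intro continuous_intros assms continuous_kern_real)
  fix q
  have C: "C \<ge> 0" using order.trans[OF norm_ge_zero assms(2)[of 0]] by simp
  have "norm (g q * of_real (kern_real q)) \<le> C * ((1 + \<bar>q\<bar>)\<^sup>2 * kern_real q)"
    using mult_right_mono[OF assms(2)[of q] kern_real_nonneg[of q]]
    by (simp add: norm_mult kern_real_nonneg mult_ac)
  also have "\<dots> \<le> C * (20736 / (1 + q\<^sup>2))" by (intro mult_left_mono kern_real_weight_le C)
  finally show "norm (g q * of_real (kern_real q)) \<le> (C * 20736) / (1 + q\<^sup>2)" by simp
qed

text \<open>The easy half of Paley-Wiener: at height \<open>b\<close> the factor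
  \<open>exp (- l * b)\<close> offsets the growth \<open>exp (2 * b)\<close> of the kernel. At the
  endpoint \<open>l = 2\<close> there is no exponential gain, so two orders of decay supply
  \<open>1 / (1 + b)^2\<close>, which tends to 0, and the other two supply integrability.\<close>

lemma kern_fourier_vanishes:
  assumes "l \<ge> 2"
  shows "(LINT q|lborel. exp (\<i> * of_real (l * q)) * kern (of_real q)) = 0"
proof -
  define G where "G = (\<lambda>\<zeta>. exp (\<i> * of_real l * \<zeta>) * kern \<zeta>)"
  define I where "I = (LINT q::real|lborel. 1 / (1 + q\<^sup>2))"
  have I: "I \<ge> 0" unfolding I_def by (intro Bochner_Integration.integral_nonneg) auto
  have hol: "G holomorphic_on {\<zeta>. Im \<zeta> > -1}"
    unfolding G_def by (intro holomorphic_intros holomorphic_kern)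
  have bd: "norm (G \<zeta>) \<le> 20736 / (1 + Im \<zeta>)\<^sup>2 / (1 + (Re \<zeta>)\<^sup>2)" if "Im \<zeta> \<ge> 0" for \<zeta>
  proof -
    have "norm (G \<zeta>) \<le> exp (- l * Im \<zeta>) * (20736 * exp (2 * Im \<zeta>) / (1 + norm \<zeta>) ^ 4)"
      unfolding G_def norm_mult using norm_kern_le[of \<zeta>] that by (intro mult_mono) auto
    also have "\<dots> = exp ((2 - l) * Im \<zeta>) * (20736 / (1 + norm \<zeta>) ^ 4)"
      by (simp add: algebra_simps exp_add exp_diff exp_minus divide_simps)
    also have "\<dots> \<le> 1 * (20736 / (1 + norm \<zeta>) ^ 4)"
      using assms that by (intro mult_right_mono) (auto simp: mult_nonpos_nonneg)
    also have "\<dots> = 20736 / ((1 + norm \<zeta>)\<^sup>2 * (1 + norm \<zeta>)\<^sup>2)" by (simp flip: power_add)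
    also have "\<dots> \<le> 20736 / ((1 + Im \<zeta>)\<^sup>2 * (1 + (Re \<zeta>)\<^sup>2))"
    proof (intro divide_left_mono mult_mono power_mono mult_pos_pos)
      show "1 + (Re \<zeta>)\<^sup>2 \<le> (1 + norm \<zeta>)\<^sup>2"
        using abs_Re_le_cmod[of \<zeta>] by (intro order.trans[OF one_plus_sq_le] power_mono) auto
      show "1 + Im \<zeta> \<le> 1 + norm \<zeta>" using abs_Im_le_cmod[of \<zeta>] by simp
      show "0 < (1 + norm \<zeta>)\<^sup>2" by (intro zero_less_power add_pos_nonneg) auto
      then show "0 < (1 + norm \<zeta>)\<^sup>2" .
      show "0 < (1 + Im \<zeta>)\<^sup>2" "0 < 1 + (Re \<zeta>)\<^sup>2"
        using that by (auto intro!: add_pos_nonneg zero_less_power)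
    qed (use that in auto)
    finally show ?thesis by simp
  qed
  have bound: "norm (LINT q|lborel. G (Complex q 0)) \<le> 20736 / (1 + b)\<^sup>2 * I" if b: "b \<ge> 0" for b
  proof -
    have "norm (G \<zeta>) \<le> 20736 / (1 + (Re \<zeta>)\<^sup>2)" if "0 \<le> Im \<zeta>" "Im \<zeta> \<le> b" for \<zeta>
      using that by (intro order.trans[OF bd] divide_right_mono) (auto simp: divide_le_eq)
    note sh = integral_horizontal_shift[OF hol _ b this]
    have "norm (LINT q|lborel. G (Complex q 0)) = norm (LINT q|lborel. G (Complex q b))"
      by (subst sh(3)) auto
    also have "\<dots> \<le> (LINT q|lborel. 20736 / (1 + b)\<^sup>2 * (1 / (1 + q\<^sup>2)))"
    proof (rule Bochner_Integration.integral_norm_bound_integral)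
      show "integrable lborel (\<lambda>q. G (Complex q b))" by (rule sh(2)) auto
      show "integrable lborel (\<lambda>q::real. 20736 / (1 + b)\<^sup>2 * (1 / (1 + q\<^sup>2)))"
        by (intro integrable_mult_right integrable_inverse_one_plus_sq)
      show "norm (G (Complex q b)) \<le> 20736 / (1 + b)\<^sup>2 * (1 / (1 + q\<^sup>2))" for q
        using bd[of "Complex q b"] b by simp
    qed
    also have "\<dots> = 20736 / (1 + b)\<^sup>2 * I" unfolding I_def
      by (rule Bochner_Integration.integral_mult_right_zero)
    finally show ?thesis .
  qed
  have "((\<lambda>b::real. 20736 / (1 + b)\<^sup>2 * I) \<longlongrightarrow> 0) at_top"
  proof -
    have "filterlim (\<lambda>b::real. (1 + b)\<^sup>2) at_top at_top"
      by (intro filterlim_pow_at_top filterlim_tendsto_add_at_top[OF tendsto_const] filterlim_ident) auto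
    from tendsto_mult_right_zero[OF tendsto_inverse_0_at_top[OF this], of "20736 * I"]
    show ?thesis by (simp add: divide_inverse mult_ac)
  qed
  then have "norm (LINT q|lborel. G (Complex q 0)) \<le> 0"
    using bound by (rule tendsto_lowerbound[OF _ eventually_mono[OF eventually_ge_at_top[of 0]]]) auto
  moreover have "G (Complex q 0) = exp (\<i> * of_real (l * q)) * kern (of_real q)" for q
    by (simp add: G_def Complex_eq mult_ac)
  ultimately show ?thesis by simp
qed

section \<open>Jacobi's theta identity\<close>

text \<open>The characteristic function of the standard normal law, rescaled by
  \<open>c = sqrt (2 * pi * t)\<close>.\<close>

lemma gaussian_cos_integral:
  fixes t b :: real
  assumes t: "t > 0"
  shows "integrable lborel (\<lambda>x. exp (- pi * t * x\<^sup>2) * cos (2 * pi * b * x))"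
    and "(LINT x|lborel. exp (- pi * t * x\<^sup>2) * cos (2 * pi * b * x)) = exp (- pi * b\<^sup>2 / t) / sqrt t"
proof -
  define c where "c = sqrt (2 * pi * t)"
  define s where "s = 2 * pi * b / c"
  have c: "c > 0" "c\<^sup>2 = 2 * pi * t" using t by (auto simp: c_def)
  define g where "g = (\<lambda>x. std_normal_density x * cos (s * x))"
  have cm: "(LINT x|std_normal_distribution. iexp (s * x)) = of_real (exp (- (s\<^sup>2) / 2))"
    using char_std_normal_distribution by (metis char_def)
  have intd: "integrable lborel (\<lambda>x. std_normal_density x *\<^sub>R iexp (s * x))"
    by (rule Bochner_Integration.integrable_bound[of _ std_normal_density])
       (auto simp: integrable_normal_density)
  have "(LINT x|std_normal_distribution. iexp (s * x)) = (LINT x|lborel. std_normal_density x *\<^sub>R iexp (s * x))"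
    by (rule integral_density) auto
  then have "Re (LINT x|lborel. std_normal_density x *\<^sub>R iexp (s * x)) = exp (- (s\<^sup>2) / 2)"
    using cm by simp
  then have gint: "(LINT x|lborel. g x) = exp (- (s\<^sup>2) / 2)"
    using integral_Re[OF intd] by (simp add: g_def Re_exp)
  have gi: "integrable lborel g"
    using integrable_Re[OF intd] by (simp add: g_def Re_exp)
  have geq: "c * g (0 + c * x) = sqrt t * (exp (- pi * t * x\<^sup>2) * cos (2 * pi * b * x))" for x
  proof -
    have 1: "s * (0 + c * x) = 2 * pi * b * x" using c by (simp add: s_def)
    have 2: "- (0 + c * x)\<^sup>2 / 2 = - pi * t * x\<^sup>2" using c by (simp add: power_mult_distrib)
    have 3: "c * (1 / sqrt (2 * pi)) = sqrt t" by (simp add: c_def real_sqrt_mult)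
    have "c * g (0 + c * x) = c * (1 / sqrt (2 * pi)) * (exp (- (0 + c * x)\<^sup>2 / 2) * cos (s * (0 + c * x)))"
      by (simp add: g_def std_normal_density_def)
    then show ?thesis by (simp only: 1 2 3)
  qed
  have st: "sqrt t > 0" using t by simp
  have "integrable lborel (\<lambda>x. c * g (0 + c * x))"
    using lborel_integrable_real_affine[OF gi, of c 0] c by (intro integrable_mult_right) auto
  then have "integrable lborel (\<lambda>x. inverse (sqrt t) * (sqrt t * (exp (- pi * t * x\<^sup>2) * cos (2 * pi * b * x))))"
    unfolding geq by (intro integrable_mult_right) auto
  then show "integrable lborel (\<lambda>x. exp (- pi * t * x\<^sup>2) * cos (2 * pi * b * x))"
    using st by (simp add: mult.assoc[symmetric])
  have "(LINT x|lborel. g x) = \<bar>c\<bar> *\<^sub>R (LINT x|lborel. g (0 + c * x))"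
    using c by (intro lborel_integral_real_affine) auto
  also have "\<dots> = (LINT x|lborel. c * g (0 + c * x))" using c by simp
  also have "\<dots> = sqrt t * (LINT x|lborel. exp (- pi * t * x\<^sup>2) * cos (2 * pi * b * x))"
    unfolding geq by (rule Bochner_Integration.integral_mult_right_zero)
  finally have "sqrt t * (LINT x|lborel. exp (- pi * t * x\<^sup>2) * cos (2 * pi * b * x)) = exp (- (s\<^sup>2) / 2)"
    using gint by simp
  moreover have "s\<^sup>2 / 2 = pi * b\<^sup>2 / t"
    using t c by (simp add: s_def power_divide power_mult_distrib field_simps power2_eq_square)
  ultimately show "(LINT x|lborel. exp (- pi * t * x\<^sup>2) * cos (2 * pi * b * x)) = exp (- pi * b\<^sup>2 / t) / sqrt t"
    using st by (simp add: field_simps)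
qed

section \<open>Cosine series and Poisson summation for the Gaussian\<close>

lemma suminf_continuous_integral:
  fixes f :: "nat \<Rightarrow> real \<Rightarrow> real"
  assumes cont: "\<And>n. continuous_on {0..1} (f n)" and M: "summable M"
    and bound: "\<And>n x. x \<in> {0..1} \<Longrightarrow> \<bar>f n x\<bar> \<le> M n"
    and c: "continuous_on {0..1} c" and c1: "\<And>x. \<bar>c x\<bar> \<le> 1"
  shows "continuous_on {0..1} (\<lambda>x. \<Sum>n. f n x)"
    and "(\<lambda>N. integral {0..1} (\<lambda>x. (\<Sum>n<N. f n x) * c x)) \<longlonglongrightarrow> integral {0..1} (\<lambda>x. (\<Sum>n. f n x) * c x)"
proof -
  have u: "uniform_limit {0..1} (\<lambda>N x. \<Sum>n<N. f n x) (\<lambda>x. \<Sum>n. f n x) sequentially"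
    using bound M by (intro Weierstrass_m_test) auto
  show "continuous_on {0..1} (\<lambda>x. \<Sum>n. f n x)"
    by (rule uniform_limit_theorem[OF _ u]) (auto intro!: always_eventually continuous_intros cont)
  have u2: "uniform_limit {0..1} (\<lambda>N x. \<Sum>n<N. f n x * c x) (\<lambda>x. \<Sum>n. f n x * c x) sequentially"
  proof (rule Weierstrass_m_test[OF _ M])
    fix n x assume x: "x \<in> {0..1::real}"
    have "\<bar>f n x\<bar> * \<bar>c x\<bar> \<le> M n * 1"
      using bound[OF x, of n] c1[of x] order.trans[OF abs_ge_zero bound[OF x, of n]] by (intro mult_mono) auto
    then show "norm (f n x * c x) \<le> M n" by (simp add: abs_mult)
  qed
  obtain I J where IJ: "\<And>N. ((\<lambda>x. \<Sum>n<N. f n x * c x) has_integral I N) {0..1}"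
      "((\<lambda>x. \<Sum>n. f n x * c x) has_integral J) {0..1}" "I \<longlonglongrightarrow> J"
    by (rule uniform_limit_integral[OF u2]) (auto intro!: continuous_intros cont c that)
  have "(\<Sum>n. f n x * c x) = (\<Sum>n. f n x) * c x" if "x \<in> {0..1}" for x
    by (intro suminf_mult2[symmetric] summable_comparison_test'[OF M]) (use bound that in auto)
  then have "integral {0..1} (\<lambda>x. (\<Sum>n. f n x) * c x) = J"
    by (intro integral_unique has_integral_eq[OF _ IJ(2)])
  moreover have "integral {0..1} (\<lambda>x. (\<Sum>n<N. f n x) * c x) = I N" for N
    using IJ(1)[of N] by (simp add: sum_distrib_right integral_unique)
  ultimately show "(\<lambda>N. integral {0..1} (\<lambda>x. (\<Sum>n<N. f n x) * c x)) \<longlonglongrightarrow> integral {0..1} (\<lambda>x. (\<Sum>n. f n x) * c x)"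
    using IJ(3) by simp
qed

lemma integral_cos_period: "integral {0..1} (\<lambda>x. cos (2 * pi * of_int k * x)) = (if k = 0 then 1 else 0)"
proof (cases "k = 0")
  case False
  have "((\<lambda>x. cos (2 * pi * of_int k * x)) has_integral
      (sin (2 * pi * of_int k * 1) / (2 * pi * of_int k) - sin (2 * pi * of_int k * 0) / (2 * pi * of_int k))) {0..1}"
    using False by (intro fundamental_theorem_of_calculus)
      (auto intro!: derivative_eq_intros simp: has_real_derivative_iff_has_vector_derivative[symmetric])
  moreover have "sin (2 * pi * of_int k) = 0"
    using sin_int_2pin[of k] by (simp add: mult_ac)
  ultimately show ?thesis using False by (simp add: integral_unique)
qed simp

text \<open>A symmetric function on the unit interval is a continuous function of
  \<open>cos (2 * pi * x)\<close>, hence uniformly close to a polynomial in it. Orthogonality to all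
  powers of the cosine then puts the integral of \<open>h^2\<close> below \<open>e\<close> times
  that of \<open>|h|\<close> for every \<open>e > 0\<close>.\<close>

lemma cos_orthogonal_imp_zero:
  fixes h :: "real \<Rightarrow> real"
  assumes cont: "continuous_on {0..1} h" and sym: "\<And>x. x \<in> {0..1} \<Longrightarrow> h (1 - x) = h x"
    and orth: "\<And>n::nat. integral {0..1} (\<lambda>x. h x * cos (2 * pi * real n * x)) = 0"
    and x: "x \<in> {0..1}"
  shows "h x = 0"
proof -
  have orth_int: "integral {0..1} (\<lambda>x. h x * cos (2 * pi * of_int j * x)) = 0" for j :: int
  proof (cases "j \<ge> 0")
    case True
    then show ?thesis using orth[of "nat j"] by simp
  next
    case False
    then have "cos (2 * pi * of_int j * x) = cos (2 * pi * real (nat (- j)) * x)" for x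
      by (subst cos_minus[symmetric]) simp
    then show ?thesis using orth[of "nat (- j)"] by simp
  qed
  \<comment> \<open>One more cosine shifts the frequency by +1 and -1, so the induction runs over
    integer frequencies.\<close>
  have pw: "integral {0..1} (\<lambda>x. h x * cos (2 * pi * x) ^ i * cos (2 * pi * of_int j * x)) = 0" for i and j :: int
  proof (induction i arbitrary: j)
    case 0
    then show ?case using orth_int[of j] by simp
  next
    case (Suc i)
    have "h x * cos (2 * pi * x) ^ Suc i * cos (2 * pi * of_int j * x) =
        (h x * cos (2 * pi * x) ^ i * cos (2 * pi * of_int (j + 1) * x)
         + h x * cos (2 * pi * x) ^ i * cos (2 * pi * of_int (j - 1) * x)) / 2" for x
    proof -
      have "cos (2 * pi * x) * cos (2 * pi * of_int j * x)
          = (cos (2 * pi * of_int (j + 1) * x) + cos (2 * pi * of_int (j - 1) * x)) / 2"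
        using cos_times_cos[of "2 * pi * of_int j * x" "2 * pi * x"] by (simp add: algebra_simps)
      moreover have "h x * cos (2 * pi * x) ^ Suc i * cos (2 * pi * of_int j * x) =
          h x * cos (2 * pi * x) ^ i * (cos (2 * pi * x) * cos (2 * pi * of_int j * x))" by simp
      ultimately show ?thesis by (simp only: times_divide_eq_right distrib_left)
    qed
    then show ?case
      using Suc.IH[of "j + 1"] Suc.IH[of "j - 1"]
      by (simp only: integral_divide)
         (subst integral_add; (intro integrable_continuous_real continuous_intros cont)?; simp)
  qed
  \<comment> \<open>\<open>arccos\<close> inverts \<open>cos (2 * pi * x)\<close> on the left half
    of the interval; the symmetry of \<open>h\<close> covers the right half.\<close>
  define \<phi> where "\<phi> = (\<lambda>y. h (arccos y / (2 * pi)))"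
  have arc: "arccos y / (2 * pi) \<in> {0..1}" if "y \<in> {-1..1}" for y
    using that arccos_lbound[of y] arccos_ubound[of y] by (auto simp: field_simps)
  have cphi: "continuous_on {-1..1} \<phi>" unfolding \<phi>_def
    by (rule continuous_on_compose2[OF cont]) (use arc in \<open>auto intro!: continuous_intros continuous_on_arccos'\<close>)
  have hphi: "h x = \<phi> (cos (2 * pi * x))" if "x \<in> {0..1}" for x
  proof (cases "x \<le> 1 / 2")
    case True
    then have "2 * pi * x \<le> pi" using mult_left_mono[OF True, of "2 * pi"] by simp
    then have "arccos (cos (2 * pi * x)) = 2 * pi * x" using that by (intro arccos_cos) auto
    then show ?thesis by (simp add: \<phi>_def)
  next
    case False
    have "cos (2 * pi * x) = cos (2 * pi * (1 - x))"
      using cos_2pi_minus[of "2 * pi * x"] by (simp add: algebra_simps)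
    moreover have "2 * pi * (1 - x) \<le> pi" using False mult_left_mono[of "1 - x" "1/2" "2 * pi"] by simp
    then have "arccos (cos (2 * pi * (1 - x))) = 2 * pi * (1 - x)" using that by (intro arccos_cos) auto
    ultimately have "\<phi> (cos (2 * pi * x)) = h (1 - x)" by (simp add: \<phi>_def)
    then show ?thesis using sym[OF that] by simp
  qed
  define K where "K = integral {0..1} (\<lambda>x. \<bar>h x\<bar>)"
  have small: "integral {0..1} (\<lambda>x. (h x)\<^sup>2) \<le> e * K" if e: "e > 0" for e
  proof -
    obtain p where p: "real_polynomial_function p" "\<And>y. y \<in> {-1..1} \<Longrightarrow> \<bar>\<phi> y - p y\<bar> < e"
      using Stone_Weierstrass_real_polynomial_function[OF compact_Icc cphi e] by metis
    obtain a n where an: "p = (\<lambda>x. \<Sum>i\<le>n. a i * x ^ i)"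
      using p(1) real_polynomial_function_iff_sum by blast
    have cp: "continuous_on {0..1} (\<lambda>x. p (cos (2 * pi * x)))"
      unfolding an by (intro continuous_intros)
    have "integral {0..1} (\<lambda>x. h x * p (cos (2 * pi * x))) = integral {0..1} (\<lambda>x. \<Sum>i\<le>n. a i * (h x * cos (2 * pi * x) ^ i))"
      unfolding an by (simp add: sum_distrib_left mult_ac)
    also have "\<dots> = (\<Sum>i\<le>n. a i * integral {0..1} (\<lambda>x. h x * cos (2 * pi * x) ^ i))"
      by (subst integral_sum) (auto intro!: integrable_continuous_real continuous_intros cont)
    also have "\<dots> = 0" using pw[of _ 0] by simp
    finally have zero: "integral {0..1} (\<lambda>x. h x * p (cos (2 * pi * x))) = 0" .
    have "integral {0..1} (\<lambda>x. (h x)\<^sup>2) = integral {0..1} (\<lambda>x. (h x)\<^sup>2) - integral {0..1} (\<lambda>x. h x * p (cos (2 * pi * x)))"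
      using zero by simp
    also have "\<dots> = integral {0..1} (\<lambda>x. (h x)\<^sup>2 - h x * p (cos (2 * pi * x)))"
      by (rule integral_diff[symmetric]) (intro integrable_continuous_real continuous_intros cont cp)+
    also have "\<dots> \<le> integral {0..1} (\<lambda>x. e * \<bar>h x\<bar>)"
    proof (rule integral_le)
      fix x assume x: "x \<in> {0..1::real}"
      have "\<bar>h x - p (cos (2 * pi * x))\<bar> \<le> e" using p(2)[of "cos (2 * pi * x)"] hphi[OF x] by simp
      then have "\<bar>h x\<bar> * \<bar>h x - p (cos (2 * pi * x))\<bar> \<le> \<bar>h x\<bar> * e" by (intro mult_left_mono) auto
      then have "\<bar>h x * (h x - p (cos (2 * pi * x)))\<bar> \<le> e * \<bar>h x\<bar>" by (simp add: abs_mult mult.commute)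
      then show "(h x)\<^sup>2 - h x * p (cos (2 * pi * x)) \<le> e * \<bar>h x\<bar>"
        by (simp add: power2_eq_square right_diff_distrib)
    qed (intro integrable_continuous_real continuous_intros cont cp)+
    also have "\<dots> = e * K" unfolding K_def by simp
    finally show ?thesis .
  qed
  have K: "K \<ge> 0" unfolding K_def
    by (intro integral_nonneg integrable_continuous_real continuous_intros cont) auto
  have "integral {0..1} (\<lambda>x. (h x)\<^sup>2) \<le> 0"
  proof (rule field_le_epsilon)
    fix e :: real assume e: "e > 0"
    have "integral {0..1} (\<lambda>x. (h x)\<^sup>2) \<le> e / (K + 1) * K" using e K by (intro small) auto
    also have "\<dots> \<le> e" using e K by (simp add: field_simps)
    finally show "integral {0..1} (\<lambda>x. (h x)\<^sup>2) \<le> 0 + e" by simp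
  qed
  moreover have "integral {0..1} (\<lambda>x. (h x)\<^sup>2) \<ge> 0"
    by (intro integral_nonneg integrable_continuous_real continuous_intros cont) auto
  ultimately have "integral {0..1} (\<lambda>x. (h x)\<^sup>2) = 0" by simp
  then have "\<forall>x\<in>{0..1}. (h x)\<^sup>2 = 0"
    by (subst (asm) integral_eq_0_iff) (auto intro!: continuous_intros cont)
  then show ?thesis using x by simp
qed

text \<open>Riemann's psi, that is \<open>(theta - 1) / 2\<close>; the index \<open>Suc n\<close>
  omits the constant term.\<close>

definition omega_theta :: "real \<Rightarrow> real" where
  "omega_theta t = (\<Sum>n. exp (- pi * t * (real (Suc n))\<^sup>2))"

lemma gauss_le_geometric:
  assumes "t > 0" shows "exp (- pi * t * (real n)\<^sup>2) \<le> exp (- pi * t) ^ n"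
proof -
  have "real n \<le> (real n)\<^sup>2" by (cases n) (auto simp: power2_eq_square)
  then have "pi * t * real n \<le> pi * t * (real n)\<^sup>2" using assms by (intro mult_left_mono) auto
  then show ?thesis by (simp add: exp_of_nat_mult[symmetric] mult_ac)
qed

lemma summable_exp_geometric: "t > 0 \<Longrightarrow> summable (\<lambda>n. exp (- pi * t) ^ n)"
  by (intro summable_geometric) auto

lemma summable_gauss: "t > 0 \<Longrightarrow> summable (\<lambda>n. exp (- pi * t * (real n)\<^sup>2))"
  by (rule summable_comparison_test'[OF summable_exp_geometric[of t]]) (use gauss_le_geometric in auto)

text \<open>Poisson summation: \<open>f\<close> is the periodized Gaussian and \<open>g\<close> the
  cosine series with the expected coefficients. Both are continuous and symmetric with equal cosine
  coefficients, hence equal, and their values at 0 are the two sides.\<close>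

theorem jacobi_theta:
  assumes t: "t > 0"
  shows "1 + 2 * omega_theta t = (1 + 2 * omega_theta (1 / t)) / sqrt t"
proof -
  define \<phi> where "\<phi> = (\<lambda>x. exp (- pi * t * x\<^sup>2))"
  \<comment> \<open>The Gaussian being even, \<open>real n + x\<close> and
    \<open>real n + 1 - x\<close> together run once through all integer translates of
    \<open>x\<close>, and each summand is unchanged when \<open>x\<close> becomes
    \<open>1 - x\<close>.\<close>
  define F where "F = (\<lambda>n x. \<phi> (real n + x) + \<phi> (real n + 1 - x))"
  define G where "G = (\<lambda>n x. 2 * exp (- pi * (1 / t) * (real (Suc n))\<^sup>2) * cos (2 * pi * real (Suc n) * x))"
  define f where "f = (\<lambda>x. \<Sum>n. F n x)"
  define g where "g = (\<lambda>x. (1 + (\<Sum>n. G n x)) / sqrt t)"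
  have cphi: "continuous_on A \<phi>" for A unfolding \<phi>_def by (intro continuous_intros)
  have phi_le: "\<phi> y \<le> exp (- pi * t) ^ n" if "real n \<le> y" for n y
  proof -
    have "(real n)\<^sup>2 \<le> y\<^sup>2" using that by (intro power_mono) auto
    then have "\<phi> y \<le> exp (- pi * t * (real n)\<^sup>2)" unfolding \<phi>_def using t by (simp add: mult_left_mono)
    then show ?thesis using gauss_le_geometric[OF t, of n] by simp
  qed
  have cF: "continuous_on {0..1} (F n)" for n
    unfolding F_def \<phi>_def by (intro continuous_intros)
  have MF: "summable (\<lambda>n. 2 * exp (- pi * t) ^ n)" using summable_exp_geometric[OF t] by (rule summable_mult)
  have bF: "\<bar>F n x\<bar> \<le> 2 * exp (- pi * t) ^ n" if "x \<in> {0..1}" for n x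
    using phi_le[of n "real n + x"] phi_le[of n "real n + 1 - x"] that by (auto simp: F_def \<phi>_def)
  have t1: "1 / t > 0" using t by simp
  have cG: "continuous_on {0..1} (G n)" for n unfolding G_def by (intro continuous_intros)
  have MG: "summable (\<lambda>n. 2 * exp (- pi * (1 / t)) ^ Suc n)"
    using summable_exp_geometric[OF t1] by (intro summable_mult) (subst summable_Suc_iff)
  have bG: "\<bar>G n x\<bar> \<le> 2 * exp (- pi * (1 / t)) ^ Suc n" for n x
  proof -
    have "\<bar>G n x\<bar> = 2 * exp (- pi * (1 / t) * (real (Suc n))\<^sup>2) * \<bar>cos (2 * pi * real (Suc n) * x)\<bar>"
      unfolding G_def by (simp add: abs_mult)
    also have "\<dots> \<le> 2 * exp (- pi * (1 / t) * (real (Suc n))\<^sup>2) * 1"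
      by (intro mult_left_mono) auto
    also have "\<dots> \<le> 2 * exp (- pi * (1 / t)) ^ Suc n"
      using gauss_le_geometric[OF t1, of "Suc n"] by simp
    finally show ?thesis .
  qed
  have ccos: "continuous_on {0..1} (\<lambda>x. cos (2 * pi * real m * x))" for m :: nat by (intro continuous_intros)
  have cf: "continuous_on {0..1} f" unfolding f_def
    by (rule suminf_continuous_integral(1)[OF cF MF bF ccos[of 0]]) auto
  have cg: "continuous_on {0..1} g" unfolding g_def
    using suminf_continuous_integral(1)[OF cG MG bG ccos[of 0]] t by (intro continuous_intros) auto
  have If: "integral {0..1} (\<lambda>x. f x * cos (2 * pi * real m * x)) = exp (- pi * (real m)\<^sup>2 / t) / sqrt t" for m
  proof -
    define c where "c = (\<lambda>x::real. cos (2 * pi * real m * x))"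
    have cc: "continuous_on A c" for A unfolding c_def by (intro continuous_intros)
    have cper1: "c (x + real k) = c x" for k x
    proof -
      have "2 * pi * real m * (x + real k) = 2 * pi * real m * x + real (m * k) * (2 * pi)" by (simp add: algebra_simps)
      then show ?thesis unfolding c_def
        using cos.plus_of_nat[of "2 * pi * real m * x" "m * k"] by (simp only: of_real_eq_id id_apply)
    qed
    have cper2: "c (- x) = c x" for x by (simp add: c_def)
    have cper3: "c (real k - x) = c x" for k x using cper1[of "- x" k] cper2[of x] by simp
    note cper = cper1 cper3 cper2
    \<comment> \<open>The translates unfold: a partial sum over the unit interval is one integral
      over \<open>{-N..N}\<close>, with the full Gaussian integral as limit.\<close>
    have part: "integral {0..1} (\<lambda>x. (\<Sum>n<N. F n x) * c x) = integral {-real N..real N} (\<lambda>x. \<phi> x * c x)" for N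
    proof (induction N)
      case (Suc N)
      have int: "(\<lambda>x. \<phi> x * c x) integrable_on {a..b}" for a b
        by (intro integrable_continuous_real continuous_intros cphi cc)
      have "integral {-real (Suc N)..real (Suc N)} (\<lambda>x. \<phi> x * c x)
        = integral {-real N - 1..-real N} (\<lambda>x. \<phi> x * c x) + integral {-real N..real N} (\<lambda>x. \<phi> x * c x)
          + integral {real N..real N + 1} (\<lambda>x. \<phi> x * c x)"
      proof -
        have "integral {-real N - 1..real N + 1} (\<lambda>x. \<phi> x * c x)
          = integral {-real N - 1..-real N} (\<lambda>x. \<phi> x * c x) + integral {-real N..real N + 1} (\<lambda>x. \<phi> x * c x)"
          by (intro Henstock_Kurzweil_Integration.integral_combine[symmetric] int) auto
        also have "integral {-real N..real N + 1} (\<lambda>x. \<phi> x * c x) = integral {-real N..real N} (\<lambda>x. \<phi> x * c x)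
          + integral {real N..real N + 1} (\<lambda>x. \<phi> x * c x)"
          by (intro Henstock_Kurzweil_Integration.integral_combine[symmetric] int) auto
        finally have "integral {-real N - 1..real N + 1} (\<lambda>x. \<phi> x * c x) = integral {-real N - 1..-real N} (\<lambda>x. \<phi> x * c x)
          + integral {-real N..real N} (\<lambda>x. \<phi> x * c x) + integral {real N..real N + 1} (\<lambda>x. \<phi> x * c x)" by simp
        moreover have "- real (Suc N) = - real N - 1" "real (Suc N) = real N + 1" by simp_all
        ultimately show ?thesis by (simp only:)
      qed
      also have "integral {real N..real N + 1} (\<lambda>x. \<phi> x * c x) = integral {0..1} (\<lambda>x. \<phi> (real N + x) * c x)"
        using integral_shift_real_ivl[of "real N" "real N" "real N + 1" "\<lambda>x. \<phi> x * c x"]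
        by (simp add: cper add.commute)
      also have "integral {-real N - 1..-real N} (\<lambda>x. \<phi> x * c x) = integral {0..1} (\<lambda>x. \<phi> (real N + 1 - x) * c x)"
      proof -
        have "integral {0..1} (\<lambda>x. \<phi> (x + (- real N - 1)) * c (x + (- real N - 1))) = integral {-real N - 1..-real N} (\<lambda>x. \<phi> x * c x)"
          using integral_shift_real_ivl[of "-real N - 1" "-real N - 1" "-real N" "\<lambda>x. \<phi> x * c x"] by simp
        moreover have "\<phi> (x + (- real N - 1)) = \<phi> (real N + 1 - x)" for x
          by (simp add: \<phi>_def power2_eq_square algebra_simps)
        moreover have "c (x + (- real N - 1)) = c x" for x
          using cper(1)[of "x + (- real N - 1)" "Suc N"] by (simp add: algebra_simps)
        ultimately show ?thesis by simp
      qed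
      finally have "integral {-real (Suc N)..real (Suc N)} (\<lambda>x. \<phi> x * c x) =
         integral {0..1} (\<lambda>x. \<phi> (real N + 1 - x) * c x) + integral {0..1} (\<lambda>x. (\<Sum>n<N. F n x) * c x)
         + integral {0..1} (\<lambda>x. \<phi> (real N + x) * c x)" using Suc by simp
      also have "\<dots> = integral {0..1} (\<lambda>x. \<phi> (real N + 1 - x) * c x + (\<Sum>n<N. F n x) * c x + \<phi> (real N + x) * c x)"
        by (subst integral_add, (intro integrable_continuous_real continuous_intros cc cF continuous_on_compose2[OF cphi[of UNIV]] subset_UNIV)+)+ simp
      also have "\<dots> = integral {0..1} (\<lambda>x. (\<Sum>n<Suc N. F n x) * c x)"
        by (simp add: F_def algebra_simps)
      finally show ?case by simp
    qed simp
    have "(\<lambda>N. integral {0..1} (\<lambda>x. (\<Sum>n<N. F n x) * c x)) \<longlonglongrightarrow> integral {0..1} (\<lambda>x. f x * c x)"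
      unfolding f_def by (rule suminf_continuous_integral(2)[OF cF MF bF cc]) (auto simp: c_def)
    then have 1: "(\<lambda>N. integral {-real N..real N} (\<lambda>x. \<phi> x * c x)) \<longlonglongrightarrow> integral {0..1} (\<lambda>x. f x * c x)"
      by (simp only: part)
    have 2: "(\<lambda>N. integral {-real N..real N} (\<lambda>x. \<phi> x * c x)) \<longlonglongrightarrow> exp (- pi * (real m)\<^sup>2 / t) / sqrt t"
      using filterlim_compose[OF integral_symmetric_interval_tendsto[OF gaussian_cos_integral(1)[OF t, of "real m"]] filterlim_real_sequentially]
      by (simp only: gaussian_cos_integral(2)[OF t] \<phi>_def c_def)
    show ?thesis using LIMSEQ_unique[OF 1 2] by (simp only: c_def)
  qed
  have Ig: "integral {0..1} (\<lambda>x. g x * cos (2 * pi * real m * x)) = exp (- pi * (real m)\<^sup>2 / t) / sqrt t" for m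
  proof -
    define c where "c = (\<lambda>x::real. cos (2 * pi * real m * x))"
    have cc: "continuous_on A c" for A unfolding c_def by (intro continuous_intros)
    have IG: "integral {0..1} (\<lambda>x. G n x * c x) = (if Suc n = m then exp (- pi * (real m)\<^sup>2 / t) else 0)" for n
    proof -
      define E where "E = exp (- pi * (1 / t) * (real (Suc n))\<^sup>2)"
      have "integral {0..1} (\<lambda>x. G n x * c x) =
        integral {0..1} (\<lambda>x. E * (cos (2 * pi * of_int (int (Suc n) - int m) * x) + cos (2 * pi * of_int (int (Suc n) + int m) * x)))"
      proof (rule integral_cong)
        fix x :: real
        have "cos (2 * pi * real (Suc n) * x) * cos (2 * pi * real m * x)
           = (cos (2 * pi * of_int (int (Suc n) - int m) * x) + cos (2 * pi * of_int (int (Suc n) + int m) * x)) / 2"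
          unfolding cos_times_cos by (simp add: algebra_simps)
        then show "G n x * c x = E * (cos (2 * pi * of_int (int (Suc n) - int m) * x) + cos (2 * pi * of_int (int (Suc n) + int m) * x))"
          unfolding G_def c_def E_def[symmetric] by (simp only: mult.assoc)
      qed
      also have "\<dots> = E * (integral {0..1} (\<lambda>x. cos (2 * pi * of_int (int (Suc n) - int m) * x)) + integral {0..1} (\<lambda>x. cos (2 * pi * of_int (int (Suc n) + int m) * x)))"
        by (subst integral_mult_right, subst integral_add) (auto intro!: integrable_continuous_real continuous_intros)
      also have "\<dots> = E * (if Suc n = m then 1 else 0)"
        unfolding integral_cos_period by auto
      finally show ?thesis by (simp add: E_def)
    qed
    have L: "(\<lambda>N. integral {0..1} (\<lambda>x. (\<Sum>n<N. G n x) * c x)) \<longlonglongrightarrow> integral {0..1} (\<lambda>x. (\<Sum>n. G n x) * c x)"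
      by (rule suminf_continuous_integral(2)[OF cG MG bG cc]) (auto simp: c_def)
    have eqI: "integral {0..1} (\<lambda>x. (\<Sum>n<N. G n x) * c x) = (\<Sum>n<N. if Suc n = m then exp (- pi * (real m)\<^sup>2 / t) else 0)" for N
      unfolding sum_distrib_right
      by (subst integral_sum) (auto intro!: integrable_continuous_real continuous_intros cG cc simp: IG)
    have ev: "eventually (\<lambda>N. (\<Sum>n<N. if Suc n = m then exp (- pi * (real m)\<^sup>2 / t) else 0) = (if m = 0 then 0 else exp (- pi * (real m)\<^sup>2 / t))) sequentially"
      using eventually_ge_at_top[of m]
    proof eventually_elim
      case (elim N)
      show ?case
      proof (cases m)
        case (Suc m')
        then show ?thesis using elim by (simp add: sum.delta)
      qed simp
    qed
    have "integral {0..1} (\<lambda>x. (\<Sum>n. G n x) * c x) = (if m = 0 then 0 else exp (- pi * (real m)\<^sup>2 / t))"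
      using LIMSEQ_unique[OF L[unfolded eqI] tendsto_eventually[OF ev]] .
    moreover have "integral {0..1} c = (if m = 0 then 1 else 0)"
      using integral_cos_period[of "int m"] by (simp add: c_def)
    moreover have "integral {0..1} (\<lambda>x. g x * c x) = (integral {0..1} c + integral {0..1} (\<lambda>x. (\<Sum>n. G n x) * c x)) / sqrt t"
    proof -
      have "integral {0..1} (\<lambda>x. g x * c x) = integral {0..1} (\<lambda>x. (c x + (\<Sum>n. G n x) * c x) / sqrt t)"
        by (simp add: g_def algebra_simps)
      also have "\<dots> = (integral {0..1} c + integral {0..1} (\<lambda>x. (\<Sum>n. G n x) * c x)) / sqrt t"
        unfolding integral_divide using suminf_continuous_integral(1)[OF cG MG bG ccos[of 0]]
        by (subst integral_add) (auto intro!: integrable_continuous_real continuous_intros cc)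
      finally show ?thesis .
    qed
    ultimately show ?thesis unfolding c_def by (auto split: if_splits)
  qed
  have "f 0 - g 0 = 0"
  proof (rule cos_orthogonal_imp_zero[of "\<lambda>x. f x - g x"])
    show "continuous_on {0..1} (\<lambda>x. f x - g x)" by (intro continuous_intros cf cg)
    show "f (1 - x) - g (1 - x) = f x - g x" if "x \<in> {0..1}" for x
    proof -
      have "F n (1 - x) = F n x" for n by (simp add: F_def algebra_simps)
      moreover have "G n (1 - x) = G n x" for n
      proof -
        have "2 * pi * real (Suc n) * (1 - x) = 2 * pi * real (Suc n) - 2 * pi * real (Suc n) * x" by (simp add: algebra_simps)
        moreover have "cos (2 * pi * real (Suc n) - y) = cos y" for y
          using cos_2npi[of "Suc n"] sin_2npi[of "Suc n"] by (simp add: cos_diff mult_ac del: of_nat_Suc)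
        ultimately show ?thesis by (simp only: G_def)
      qed
      ultimately show ?thesis by (simp add: f_def g_def)
    qed
    show "integral {0..1} (\<lambda>x. (f x - g x) * cos (2 * pi * real n * x)) = 0" for n
      unfolding left_diff_distrib
      by (subst integral_diff) (auto intro!: integrable_continuous_real continuous_intros cf cg simp: If Ig)
  qed auto
  then have "f 0 = g 0" by simp
  moreover have "f 0 = 1 + 2 * omega_theta t"
  proof -
    have s: "summable (\<lambda>n. \<phi> (real n))" unfolding \<phi>_def using summable_gauss[OF t] .
    then have s': "summable (\<lambda>n. \<phi> (real (Suc n)))" by (subst summable_Suc_iff)
    have "f 0 = (\<Sum>n. \<phi> (real n) + \<phi> (real (Suc n)))" by (simp add: f_def F_def add.commute)
    also have "\<dots> = (\<Sum>n. \<phi> (real n)) + (\<Sum>n. \<phi> (real (Suc n)))" using suminf_add[OF s s'] by simp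
    also have "(\<Sum>n. \<phi> (real n)) = (\<Sum>n. \<phi> (real (Suc n))) + \<phi> (real 0)" using suminf_split_head[OF s] by simp
    finally show ?thesis by (simp add: omega_theta_def \<phi>_def)
  qed
  moreover have "g 0 = (1 + 2 * omega_theta (1 / t)) / sqrt t"
  proof -
    have "summable (\<lambda>n. exp (- pi * (1 / t) * (real (Suc n))\<^sup>2))"
      using summable_gauss[OF t1] by (subst summable_Suc_iff)
    from suminf_mult[OF this, of 2] show ?thesis by (simp add: g_def G_def omega_theta_def)
  qed
  ultimately show ?thesis by simp
qed

section \<open>The completed zeta function\<close>

text \<open>Cauchy's inequality on discs of radius \<open>r\<close> inside \<open>A\<close> bounds
  every difference quotient at \<open>s0\<close> by \<open>g x / r\<close>, so the majorant of
  \<open>f\<close> also dominates the quotients. Dominated convergence is applied along sequences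
  tending to \<open>s0\<close>.\<close>

lemma holomorphic_LINT:
  fixes f :: "'a \<Rightarrow> complex \<Rightarrow> complex"
  assumes A: "open A" and hol: "\<And>x. f x holomorphic_on A"
    and meas: "\<And>s. s \<in> A \<Longrightarrow> (\<lambda>x. f x s) \<in> borel_measurable M"
    and g: "integrable M g" and bound: "\<And>x s. s \<in> A \<Longrightarrow> norm (f x s) \<le> g x"
  shows "(\<lambda>s. LINT x|M. f x s) holomorphic_on A"
  unfolding holomorphic_on_open[OF A]
proof (intro ballI exI)
  fix s0 assume s0: "s0 \<in> A"
  obtain r0 where r0: "r0 > 0" "ball s0 r0 \<subseteq> A" using A s0 by (meson openE)
  define r where "r = r0 / 3"
  have r: "r > 0" using r0 by (simp add: r_def)
  have sub: "cball w r \<subseteq> A" if "w \<in> ball s0 r" for w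
  proof
    fix v assume "v \<in> cball w r"
    then have "dist s0 v < r0" using that r0 dist_triangle[of s0 v w] by (simp add: r_def)
    then show "v \<in> A" using r0 by auto
  qed
  have sub0: "ball s0 r \<subseteq> A" using r0 by (auto simp: r_def)
  have intf: "integrable M (\<lambda>x. f x s)" if "s \<in> A" for s
    using bound[OF that] by (intro Bochner_Integration.integrable_bound[OF g meas[OF that]] AE_I2) (metis order.trans abs_ge_self real_norm_def)
  have lip: "norm (f x s - f x s0) \<le> g x / r * norm (s - s0)" if "s \<in> ball s0 r" for x s
  proof (rule field_differentiable_bound[where S = "ball s0 r" and f' = "deriv (f x)"])
    fix w assume w: "w \<in> ball s0 r"
    show "(f x has_field_derivative deriv (f x) w) (at w within ball s0 r)"
      using holomorphic_derivI[OF hol A] w sub0 has_field_derivative_at_within by blast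
    have "norm ((deriv ^^ 1) (f x) w) \<le> fact 1 * g x / r ^ 1"
    proof (rule Cauchy_inequality)
      show "f x holomorphic_on ball w r" using hol sub[OF w] ball_subset_cball holomorphic_on_subset by blast
      show "continuous_on (cball w r) (f x)" using hol sub[OF w] holomorphic_on_imp_continuous_on holomorphic_on_subset by blast
      show "norm (f x v) \<le> g x" if "norm (w - v) = r" for v
        using bound[of v x] sub[OF w] that by (auto simp: dist_norm)
    qed (use r in auto)
    then show "norm (deriv (f x) w) \<le> g x / r" by simp
  qed (use that r in auto)
  show "((\<lambda>s. LINT x|M. f x s) has_field_derivative (LINT x|M. deriv (f x) s0)) (at s0)"
    unfolding has_field_derivative_iff tendsto_at_iff_sequentially
  proof (intro allI impI)
    fix X :: "nat \<Rightarrow> complex" assume X: "\<forall>i. X i \<in> UNIV - {s0}" "X \<longlonglongrightarrow> s0"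
    obtain N where N: "\<And>n. n \<ge> N \<Longrightarrow> X n \<in> ball s0 r"
      using X(2) r unfolding lim_sequentially by (metis mem_ball dist_commute)
    define Y where "Y = (\<lambda>n. X (n + N))"
    have Y: "Y n \<in> ball s0 r" "Y n \<noteq> s0" for n using N X(1) by (auto simp: Y_def)
    have YA: "Y n \<in> A" for n using Y(1) sub0 by blast
    have Ylim: "Y \<longlonglongrightarrow> s0" unfolding Y_def using X(2) by (rule LIMSEQ_ignore_initial_segment)
    have ptw: "(\<lambda>n. (f x (Y n) - f x s0) / (Y n - s0)) \<longlonglongrightarrow> deriv (f x) s0" for x
    proof -
      have "((\<lambda>y. (f x y - f x s0) / (y - s0)) \<longlongrightarrow> deriv (f x) s0) (at s0)"
        using holomorphic_derivI[OF hol A s0] unfolding has_field_derivative_iff .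
      then show ?thesis using Y(2) Ylim unfolding tendsto_at_iff_sequentially by (auto simp: o_def)
    qed
    have "(\<lambda>n. LINT x|M. (f x (Y n) - f x s0) / (Y n - s0)) \<longlonglongrightarrow> (LINT x|M. deriv (f x) s0)"
    proof (rule integral_dominated_convergence[where w = "\<lambda>x. g x / r"])
      show "(\<lambda>x. (f x (Y n) - f x s0) / (Y n - s0)) \<in> borel_measurable M" for n
        by (intro borel_measurable_divide borel_measurable_diff meas YA s0 borel_measurable_const)
      then show "(\<lambda>x. deriv (f x) s0) \<in> borel_measurable M"
        by (rule borel_measurable_LIMSEQ_metric) (rule ptw)
      show "integrable M (\<lambda>x. g x / r)" using g by simp
      show "AE x in M. norm ((f x (Y n) - f x s0) / (Y n - s0)) \<le> g x / r" for n
        using lip[OF Y(1)] Y(2) by (intro AE_I2) (simp add: norm_divide divide_le_eq)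
    qed (use ptw in auto)
    moreover have "(LINT x|M. (f x (Y n) - f x s0) / (Y n - s0)) = ((LINT x|M. f x (Y n)) - (LINT x|M. f x s0)) / (Y n - s0)" for n
      using intf[OF YA] intf[OF s0] by simp
    ultimately have "(\<lambda>n. ((LINT x|M. f x (Y n)) - (LINT x|M. f x s0)) / (Y n - s0)) \<longlonglongrightarrow> (LINT x|M. deriv (f x) s0)"
      by (simp only:)
    then have "(\<lambda>n. ((LINT x|M. f x (X (n + N))) - (LINT x|M. f x s0)) / (X (n + N) - s0)) \<longlonglongrightarrow> (LINT x|M. deriv (f x) s0)"
      by (simp add: Y_def)
    then show "((\<lambda>s. ((LINT x|M. f x s) - (LINT x|M. f x s0)) / (s - s0)) \<circ> X) \<longlonglongrightarrow> (LINT x|M. deriv (f x) s0)"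
      unfolding o_def by (rule LIMSEQ_offset)
  qed
qed

text \<open>In the variable \<open>u = ln t\<close> Mellin integrals live on the whole line, where
  scaling of \<open>t\<close> is translation and inversion of \<open>t\<close> is reflection. The
  change of variables is stated for real integrands, hence the split into real and imaginary
  parts.\<close>

lemma integral_exp_substitution:
  fixes f :: "real \<Rightarrow> complex"
  assumes abs: "f absolutely_integrable_on {0<..}" and meas: "(\<lambda>u. of_real (exp u) * f (exp u)) \<in> borel_measurable borel"
  shows "integrable lborel (\<lambda>u. of_real (exp u) * f (exp u))"
    "(LINT u|lborel. of_real (exp u) * f (exp u)) = integral {0<..} f"
proof -
  have img: "exp ` (UNIV::real set) = {0<..}"
    by (auto simp: image_iff) (metis exp_ln)
  have sub: "(\<lambda>x. exp x * h (exp x)) absolutely_integrable_on UNIV \<and>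
     integral UNIV (\<lambda>x. exp x * h (exp x)) = integral {0<..} h"
    if "h absolutely_integrable_on {0<..}" for h :: "real \<Rightarrow> real"
    using has_absolute_integral_change_of_variables_1'[of UNIV exp exp h "integral {0<..} h"] that
    by (auto simp: img inj_on_def intro!: derivative_eq_intros)
  have lb: "integrable lborel k" if "k absolutely_integrable_on UNIV" "k \<in> borel_measurable borel" for k :: "real \<Rightarrow> real"
    using that integrable_completion[of k lborel] by (simp add: set_integrable_def)
  have r1: "(\<lambda>x. Re (f x)) absolutely_integrable_on {0<..}" "(\<lambda>x. Im (f x)) absolutely_integrable_on {0<..}"
    using abs absolutely_integrable_linear[OF abs bounded_linear_Re] absolutely_integrable_linear[OF abs bounded_linear_Im]
    by (simp_all add: o_def)
  have m: "(\<lambda>u. exp u * Re (f (exp u))) \<in> borel_measurable borel" "(\<lambda>u. exp u * Im (f (exp u))) \<in> borel_measurable borel"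
    using measurable_compose[OF meas borel_measurable_Re] measurable_compose[OF meas borel_measurable_Im] by simp_all
  have i1: "integrable lborel (\<lambda>u. exp u * Re (f (exp u)))" using sub[OF r1(1)] m(1) by (intro lb) auto
  have i2: "integrable lborel (\<lambda>u. exp u * Im (f (exp u)))" using sub[OF r1(2)] m(2) by (intro lb) auto
  have eq: "of_real (exp u) * f (exp u) = of_real (exp u * Re (f (exp u))) + \<i> * of_real (exp u * Im (f (exp u)))" for u
    by (simp add: complex_eq_iff)
  show int: "integrable lborel (\<lambda>u. of_real (exp u) * f (exp u))"
    unfolding eq using i1 i2 by (intro Bochner_Integration.integrable_add integrable_mult_right integrable_of_real)
  have fi: "f integrable_on {0<..}" using abs by (simp add: absolutely_integrable_on_def)
  have "(LINT u|lborel. of_real (exp u) * f (exp u)) = of_real (LINT u|lborel. exp u * Re (f (exp u))) + \<i> * of_real (LINT u|lborel. exp u * Im (f (exp u)))"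
    unfolding eq Bochner_Integration.integral_add[OF integrable_of_real[OF i1] integrable_mult_right[OF integrable_of_real[OF i2]]]
    by (simp only: integral_mult_right_zero integral_complex_of_real)
  also have "(LINT u|lborel. exp u * Re (f (exp u))) = integral {0<..} (\<lambda>x. Re (f x))"
    using sub[OF r1(1)] integral_lborel[OF i1] by simp
  also have "\<dots> = Re (integral {0<..} f)" using integral_linear[OF fi bounded_linear_Re] by (simp add: o_def)
  also have "(LINT u|lborel. exp u * Im (f (exp u))) = integral {0<..} (\<lambda>x. Im (f x))"
    using sub[OF r1(2)] integral_lborel[OF i2] by simp
  also have "\<dots> = Im (integral {0<..} f)" using integral_linear[OF fi bounded_linear_Im] by (simp add: o_def)
  finally show "(LINT u|lborel. of_real (exp u) * f (exp u)) = integral {0<..} f" by (simp add: complex_eq_iff)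
qed

lemma Gamma_exp_integral:
  assumes z: "Re z > 0"
  shows "integrable lborel (\<lambda>u::real. exp (z * of_real u) * of_real (exp (- exp u)))"
    "(LINT u|lborel. exp (z * of_real u) * of_real (exp (- exp u))) = Gamma z"
proof -
  let ?f = "\<lambda>t::real. complex_of_real t powr (z - 1) / of_real (exp t)"
  have eq: "of_real (exp u) * ?f (exp u) = exp (z * of_real u) * of_real (exp (- exp u))" for u :: real
  proof -
    have "complex_of_real (exp u) powr (z - 1) = exp ((z - 1) * of_real u)"
      by (simp add: powr_def Ln_of_real)
    moreover have "complex_of_real (exp u) = exp (of_real u)" by (simp add: exp_of_real)
    ultimately have "of_real (exp u) * complex_of_real (exp u) powr (z - 1) = exp (z * of_real u)"
      by (simp add: exp_add[symmetric] algebra_simps)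
    then show ?thesis by (simp add: exp_minus divide_inverse mult.assoc[symmetric])
  qed
  have meas: "(\<lambda>u. of_real (exp u) * ?f (exp u)) \<in> borel_measurable borel"
    unfolding eq by (intro borel_measurable_continuous_onI continuous_intros)
  note * = integral_exp_substitution[OF absolutely_integrable_Gamma_integral'[OF z] meas]
  show "integrable lborel (\<lambda>u::real. exp (z * of_real u) * of_real (exp (- exp u)))"
    using *(1) unfolding eq .
  show "(LINT u|lborel. exp (z * of_real u) * of_real (exp (- exp u))) = Gamma z"
    using *(2) integral_unique[OF Gamma_integral_complex'[OF z]] unfolding eq by simp
qed

lemma Gamma_exp_integral_scaled:
  assumes z: "Re z > 0" and a: "a > 0"
  shows "integrable lborel (\<lambda>u::real. exp (z * of_real u) * of_real (exp (- a * exp u)))"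
    "(LINT u|lborel. exp (z * of_real u) * of_real (exp (- a * exp u))) = exp (- z * of_real (ln a)) * Gamma z"
proof -
  let ?f = "\<lambda>u::real. exp (z * of_real u) * of_real (exp (- exp u))"
  have eq: "exp (z * of_real u) * of_real (exp (- a * exp u)) = exp (- z * of_real (ln a)) * ?f (ln a + 1 * u)" for u
  proof -
    have 1: "exp (z * of_real (ln a + 1 * u)) = exp (z * of_real (ln a)) * exp (z * of_real u)"
      by (simp add: distrib_left exp_add)
    have 2: "exp (ln a + 1 * u) = a * exp u" using a by (simp add: exp_add)
    have 3: "exp (- z * of_real (ln a)) * exp (z * of_real (ln a)) = 1" by (simp flip: exp_add)
    have "exp (- z * of_real (ln a)) * ?f (ln a + 1 * u) =
        (exp (- z * of_real (ln a)) * exp (z * of_real (ln a))) * (exp (z * of_real u) * of_real (exp (- (a * exp u))))"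
      unfolding 1 2 by (simp only: mult.assoc)
    then show ?thesis unfolding 3 by simp
  qed
  show "integrable lborel (\<lambda>u::real. exp (z * of_real u) * of_real (exp (- a * exp u)))"
    unfolding eq by (intro integrable_mult_right lborel_integrable_real_affine Gamma_exp_integral(1)[OF z]) auto
  have "(LINT u|lborel. ?f (ln a + 1 * u)) = (LINT u|lborel. ?f u)"
    using lborel_integral_real_affine[of 1 ?f "ln a"] by simp
  then show "(LINT u|lborel. exp (z * of_real u) * of_real (exp (- a * exp u))) = exp (- z * of_real (ln a)) * Gamma z"
    unfolding eq by (simp add: Gamma_exp_integral(2)[OF z])
qed


section \<open>Bounds for the theta series\<close>

lemma summable_gauss_Suc: "t > 0 \<Longrightarrow> summable (\<lambda>n. exp (- pi * t * (real (Suc n))\<^sup>2))"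
  using summable_gauss[of t] by (subst summable_Suc_iff)

lemma omega_theta_nonneg: "t > 0 \<Longrightarrow> omega_theta t \<ge> 0"
  unfolding omega_theta_def by (intro suminf_nonneg summable_gauss_Suc) auto

lemma omega_theta_le:
  assumes t: "t \<ge> 1" shows "omega_theta t \<le> 2 * exp (- pi * t)"
proof -
  define r where "r = exp (- pi * t)"
  have "1 \<le> pi * t" using t pi_ge_two mult_mono[of 1 pi 1 t] by simp
  then have "2 \<le> exp (pi * t)" using exp_ge_add_one_self[of "pi * t"] by linarith
  then have r: "r > 0" "r \<le> 1 / 2" by (auto simp: r_def exp_minus divide_simps)
  have sg: "summable (\<lambda>n. r * r ^ n)" using r by (intro summable_mult summable_geometric) auto
  have "omega_theta t \<le> (\<Sum>n. r * r ^ n)" unfolding omega_theta_def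
  proof (rule suminf_le)
    show "exp (- pi * t * (real (Suc n))\<^sup>2) \<le> r * r ^ n" for n
      using gauss_le_geometric[of t "Suc n"] t by (simp add: r_def)
    show "summable (\<lambda>n. exp (- pi * t * (real (Suc n))\<^sup>2))"
      using t by (intro summable_gauss_Suc) auto
  qed (rule sg)
  also have "\<dots> = r * (1 / (1 - r))" using r by (subst suminf_mult) (auto simp: suminf_geometric)
  also have "\<dots> \<le> r * 2" using r by (intro mult_left_mono) (auto simp: divide_simps)
  finally show ?thesis by (simp add: r_def)
qed

lemma omega_theta_inversion:
  "omega_theta (exp (- u)) = exp (u / 2) * omega_theta (exp u) + (exp (u / 2) - 1) / 2"
proof -
  have s: "sqrt (exp u) = exp (u / 2)"
    by (rule real_sqrt_unique) (auto simp: power2_eq_square simp flip: exp_add)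
  have "1 + 2 * omega_theta (exp u) = (1 + 2 * omega_theta (exp (- u))) / exp (u / 2)"
    using jacobi_theta[of "exp u"] s by (simp add: exp_minus inverse_eq_divide)
  then show ?thesis by (simp add: field_simps)
qed

text \<open>Used with \<open>A\<close> of size \<open>norm s / 2\<close>: it trades the exponential
  weight for growth of order 3/2, and an order below 2 is what the sum over zeros asks for. The
  threshold \<open>54 * A\<close> comes from \<open>u^3 / 27 \<le> exp u\<close>: beyond it
  \<open>A * u \<le> u^3 / 54\<close>.\<close>

lemma linear_le_exp:
  fixes A u :: real
  assumes A: "A \<ge> 0" and u: "u \<ge> 0"
  shows "A * u \<le> 8 * A powr (3/2) + exp u / 2"
proof (cases "u\<^sup>2 \<le> 54 * A")
  case True
  have "u \<le> sqrt (64 * A)" using True A by (intro real_le_rsqrt) auto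
  also have "\<dots> = 8 * sqrt A" by (simp add: real_sqrt_mult)
  finally have "A * u \<le> 8 * (A * sqrt A)" using A by (simp add: mult_left_mono mult.left_commute)
  also have "A * sqrt A = A powr (3/2)"
  proof (cases "A = 0")
    case False
    then have "A powr (3/2) = A powr (1 + 1/2)" by simp
    also have "\<dots> = A * sqrt A" using False A by (subst powr_add) (simp add: powr_half_sqrt)
    finally show ?thesis by simp
  qed simp
  finally show ?thesis by (simp add: add_increasing2)
next
  case False
  have "(u / 3) ^ 3 \<le> exp (u / 3) ^ 3"
    using u exp_ge_add_one_self[of "u / 3"] by (intro power_mono) linarith+
  also have "\<dots> = exp u" by (simp flip: exp_of_nat_mult)
  finally have e: "u ^ 3 / 27 \<le> exp u" by (simp add: power_divide)
  have "A * u \<le> u\<^sup>2 / 54 * u" using False u by (intro mult_right_mono) auto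
  also have "\<dots> = (u ^ 3 / 27) / 2" by (simp add: power2_eq_square power3_eq_cube)
  also have "\<dots> \<le> exp u / 2" using e by simp
  finally show ?thesis by (simp add: add_increasing)
qed

lemma exp_minus_exp_le: "u \<ge> 0 \<Longrightarrow> exp (- exp u) \<le> 1 / (1 + u\<^sup>2)" for u :: real
proof -
  assume u: "u \<ge> 0"
  have x: "exp u \<ge> 1 + u + u\<^sup>2 / 2" using exp_lower_Taylor_quadratic[OF u] .
  have "(1 + u)\<^sup>2 \<le> (exp u)\<^sup>2" using u exp_ge_add_one_self[of u] by (intro power_mono) auto
  then have "u\<^sup>2 \<le> (exp u)\<^sup>2" using u by (simp add: power2_eq_square algebra_simps)
  with x u have "1 + u\<^sup>2 \<le> 1 + exp u + (exp u)\<^sup>2 / 2" by linarith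
  also have "\<dots> \<le> exp (exp u)" by (rule exp_lower_Taylor_quadratic) simp
  finally show ?thesis by (simp add: exp_minus inverse_eq_divide frac_le add_pos_nonneg)
qed

lemma omega_theta_exp_weight:
  assumes A: "A \<ge> 0" and u: "u \<ge> 0"
  shows "omega_theta (exp u) * exp (A * u) \<le> 2 * exp (8 * A powr (3/2)) / (1 + u\<^sup>2)"
proof -
  have "omega_theta (exp u) * exp (A * u) \<le> (2 * exp (- pi * exp u)) * exp (8 * A powr (3/2) + exp u / 2)"
    using u linear_le_exp[OF A u] by (intro mult_mono omega_theta_le) auto
  also have "\<dots> = 2 * exp (8 * A powr (3/2)) * exp (- pi * exp u + exp u / 2)"
    by (simp only: exp_add mult_ac)
  also have "\<dots> \<le> 2 * exp (8 * A powr (3/2)) * exp (- exp u)"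
  proof -
    have "3 / 2 * exp u \<le> pi * exp u" using pi_ge_two by (intro mult_right_mono) auto
    then have "- pi * exp u + exp u / 2 \<le> - exp u" by (simp add: field_simps)
    then show ?thesis by (intro mult_left_mono) auto
  qed
  also have "\<dots> \<le> 2 * exp (8 * A powr (3/2)) * (1 / (1 + u\<^sup>2))"
    using exp_minus_exp_le[OF u] by (intro mult_left_mono) auto
  finally show ?thesis by simp
qed

lemma borel_measurable_omega_theta [measurable]: "(\<lambda>u. omega_theta (exp u)) \<in> borel_measurable borel"
  unfolding omega_theta_def by measurable

section \<open>Riemann's xi function as a folded theta integral\<close>

text \<open>With \<open>t = exp u\<close> this is
  \<open>omega_theta t * (t powr (s/2) + t powr ((1-s)/2))\<close> against \<open>dt / t\<close> on
  \<open>t > 1\<close>. Folding the range by theta inversion leaves rapid decay for every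
  \<open>s\<close> and makes the symmetry between \<open>s\<close> and \<open>1 - s\<close>
  visible.\<close>

definition xi_integrand :: "real \<Rightarrow> complex \<Rightarrow> complex" where
  "xi_integrand u s = of_real (indicator {0<..} u * omega_theta (exp u)) * (exp (s * of_real u / 2) + exp ((1 - s) * of_real u / 2))"

text \<open>Normalized as \<open>s * (s - 1) / 2 * pi^(-s/2) * Gamma(s/2) * zeta(s)\<close>. The
  summand 1/2 is what the polar terms \<open>1 / (s - 1) - 1 / s\<close> become after multiplication
  by \<open>s * (s - 1) / 2\<close>.\<close>

definition xi :: "complex \<Rightarrow> complex" where
  "xi s = 1 / 2 + s * (s - 1) / 2 * (LINT u|lborel. xi_integrand u s)"

lemma norm_xi_integrand_le:
  assumes "norm s \<le> R"
  shows "norm (xi_integrand u s) \<le> 4 * exp (8 * ((1 + R) / 2) powr (3/2)) / (1 + u\<^sup>2)"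
proof (cases "u > 0")
  case True
  define A where "A = (1 + R) / 2"
  have A: "A \<ge> 0" using order.trans[OF norm_ge_zero assms] by (simp add: A_def)
  have 1: "norm (exp (w * of_real u / 2)) \<le> exp (A * u)" if "norm w \<le> 1 + R" for w :: complex
  proof -
    have "Re w * u / 2 \<le> A * u" using complex_Re_le_cmod[of w] that True by (simp add: A_def)
    then show ?thesis by simp
  qed
  have "norm (1 - s) \<le> 1 + R" using norm_triangle_ineq4[of 1 s] assms by simp
  then have "norm (exp (s * of_real u / 2) + exp ((1 - s) * of_real u / 2)) \<le> exp (A * u) + exp (A * u)"
    using assms by (intro order.trans[OF norm_triangle_ineq] add_mono 1) auto
  then have "norm (xi_integrand u s) \<le> omega_theta (exp u) * (2 * exp (A * u))"
    unfolding xi_integrand_def norm_mult using True omega_theta_nonneg[of "exp u"]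
    by (intro mult_mono) auto
  also have "\<dots> = 2 * (omega_theta (exp u) * exp (A * u))" by simp
  also have "\<dots> \<le> 2 * (2 * exp (8 * A powr (3/2)) / (1 + u\<^sup>2))"
    using omega_theta_exp_weight[OF A, of u] True by simp
  finally show ?thesis by (simp add: A_def)
qed (auto simp: xi_integrand_def intro!: divide_nonneg_nonneg)

lemma measurable_xi_integrand: "(\<lambda>u. xi_integrand u s) \<in> borel_measurable borel"
proof -
  have "(\<lambda>u::real. exp (s * of_real u / 2) + exp ((1 - s) * of_real u / 2)) \<in> borel_measurable borel"
    by (intro borel_measurable_continuous_onI continuous_intros) auto
  then show ?thesis unfolding xi_integrand_def by measurable
qed

lemma integrable_xi_bound: "integrable lborel (\<lambda>u::real. C / (1 + u\<^sup>2))"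
  using integrable_mult_right[OF integrable_inverse_one_plus_sq, of C] by simp

lemma integrable_xi_integrand: "integrable lborel (\<lambda>u. xi_integrand u s)"
proof (rule Bochner_Integration.integrable_bound[OF integrable_xi_bound[of "4 * exp (8 * ((1 + norm s) / 2) powr (3/2))"]])
  show "(\<lambda>u. xi_integrand u s) \<in> borel_measurable lborel" using measurable_xi_integrand by simp
  have "norm (xi_integrand u s) \<le> norm (4 * exp (8 * ((1 + norm s) / 2) powr (3/2)) / (1 + u\<^sup>2))" for u
    using norm_xi_integrand_le[of s "norm s" u] by (rule order.trans) auto
  then show "AE u in lborel. norm (xi_integrand u s) \<le> norm (4 * exp (8 * ((1 + norm s) / 2) powr (3/2)) / (1 + u\<^sup>2))"
    by simp
qed

lemma holomorphic_xi: "xi holomorphic_on UNIV"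
proof -
  have "(\<lambda>s. LINT u|lborel. xi_integrand u s) holomorphic_on ball 0 R" for R
  proof (rule holomorphic_LINT[OF open_ball _ _ integrable_xi_bound[of "4 * exp (8 * ((1 + R) / 2) powr (3/2))"]])
    show "xi_integrand u holomorphic_on ball 0 R" for u
      unfolding xi_integrand_def by (intro holomorphic_intros) auto
    show "norm (xi_integrand u s) \<le> 4 * exp (8 * ((1 + R) / 2) powr (3/2)) / (1 + u\<^sup>2)" if "s \<in> ball 0 R" for u s
      using that by (intro norm_xi_integrand_le) auto
  qed (use measurable_xi_integrand in auto)
  then have "(\<lambda>s. LINT u|lborel. xi_integrand u s) field_differentiable at s" for s
    using holomorphic_on_imp_differentiable_at[of _ "ball 0 (norm s + 1)" s] by simp
  then have "(\<lambda>s. LINT u|lborel. xi_integrand u s) holomorphic_on UNIV"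
    by (simp add: holomorphic_on_def)
  then show ?thesis unfolding xi_def by (intro holomorphic_intros) auto
qed

lemma xi_reflect: "xi (1 - s) = xi s"
proof -
  have "xi_integrand u (1 - s) = xi_integrand u s" for u by (simp add: xi_integrand_def add.commute)
  moreover have "(1 - s) * (1 - s - 1) = s * (s - 1)" by (simp add: algebra_simps)
  ultimately show ?thesis by (simp add: xi_def)
qed

lemma xi_1: "xi 1 = 1 / 2" by (simp add: xi_def)

lemma xi_growth: "\<exists>A. \<forall>s. norm (xi s) \<le> exp (A * (1 + norm s) powr (3/2))"
proof -
  define I where "I = (LINT u::real|lborel. 1 / (1 + u\<^sup>2))"
  have I: "I \<ge> 0" unfolding I_def by (intro Bochner_Integration.integral_nonneg) auto
  define B where "B = 1 / 2 + 2 * I"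
  have B: "B > 0" using I by (simp add: B_def)
  have "norm (xi s) \<le> exp ((ln (1 + B) + 10) * (1 + norm s) powr (3/2))" for s
  proof -
    define y where "y = 1 + norm s"
    define p where "p = y powr (3/2)"
    have y: "y \<ge> 1" by (simp add: y_def)
    have p: "p \<ge> y" using powr_mono[of 1 "3/2" y] y by (simp add: p_def)
    have "norm (LINT u|lborel. xi_integrand u s) \<le> (LINT u::real|lborel. (4 * exp (8 * (y / 2) powr (3/2))) * (1 / (1 + u\<^sup>2)))"
    proof (rule Bochner_Integration.integral_norm_bound_integral[OF integrable_xi_integrand])
      show "integrable lborel (\<lambda>u::real. (4 * exp (8 * (y / 2) powr (3/2))) * (1 / (1 + u\<^sup>2)))"
        by (intro integrable_mult_right integrable_inverse_one_plus_sq)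
      show "norm (xi_integrand u s) \<le> (4 * exp (8 * (y / 2) powr (3/2))) * (1 / (1 + u\<^sup>2))" for u
        using norm_xi_integrand_le[of s "norm s" u] by (simp add: y_def)
    qed
    also have "\<dots> = 4 * exp (8 * (y / 2) powr (3/2)) * I"
      unfolding I_def by (rule Bochner_Integration.integral_mult_right_zero)
    also have "\<dots> \<le> 4 * exp (8 * p) * I"
    proof -
      have "(y / 2) powr (3/2) \<le> p" unfolding p_def using y by (intro powr_mono2) auto
      then show ?thesis using I by (intro mult_right_mono) auto
    qed
    finally have n: "norm (LINT u|lborel. xi_integrand u s) \<le> 4 * exp (8 * p) * I" .
    have "norm (s - 1) \<le> y" using norm_triangle_ineq4[of s 1] by (simp add: y_def)
    then have ns: "norm (s * (s - 1) / 2) \<le> y * y / 2"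
      unfolding norm_mult norm_divide norm_numeral using y by (intro divide_right_mono mult_mono) (auto simp: y_def)
    have "norm (xi s) \<le> 1 / 2 + norm (s * (s - 1) / 2 * (LINT u|lborel. xi_integrand u s))"
      unfolding xi_def using norm_triangle_ineq[of "1/2 :: complex"] by (metis norm_divide norm_numeral norm_one)
    also have "\<dots> \<le> 1 / 2 + (y * y / 2) * (4 * exp (8 * p) * I)"
      unfolding norm_mult[of "s * (s - 1) / 2"] using ns n y by (intro add_left_mono mult_mono) auto
    also have "\<dots> \<le> 1 / 2 * (exp (2 * p) * exp (8 * p)) + 2 * (exp (2 * p) * exp (8 * p)) * I"
    proof (rule add_mono)
      have "p \<ge> 0" using p y by linarith
      then show "(1::real) / 2 \<le> 1 / 2 * (exp (2 * p) * exp (8 * p))" by (simp flip: exp_add)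
      have "y \<le> exp p" using p exp_ge_add_one_self[of p] by linarith
      then have "y * y \<le> exp p * exp p" using y by (intro mult_mono) auto
      also have "\<dots> = exp (2 * p)" by (simp flip: exp_add)
      finally have "y * y * (2 * exp (8 * p) * I) \<le> exp (2 * p) * (2 * exp (8 * p) * I)"
        using I by (intro mult_right_mono) auto
      then show "(y * y / 2) * (4 * exp (8 * p) * I) \<le> 2 * (exp (2 * p) * exp (8 * p)) * I"
        by (simp add: mult_ac)
    qed
    also have "\<dots> = B * exp (10 * p)" by (simp add: B_def algebra_simps flip: exp_add)
    also have "\<dots> \<le> exp (ln (1 + B) * p) * exp (10 * p)"
    proof (rule mult_right_mono)
      have "ln (1 + B) * 1 \<le> ln (1 + B) * p" using B p y by (intro mult_left_mono) auto
      then have "exp (ln (1 + B)) \<le> exp (ln (1 + B) * p)" by simp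
      then show "B \<le> exp (ln (1 + B) * p)" using B by simp
    qed simp
    finally show ?thesis by (simp add: p_def y_def distrib_right exp_add)
  qed
  then show ?thesis by blast
qed


lemma laplace_exp:
  assumes a: "Re a > 0"
  shows "integrable lborel (\<lambda>u::real. indicator {0<..} u *\<^sub>R exp (- (a * of_real u)))"
    "(LINT u|lborel. indicator {0<..} u *\<^sub>R exp (- (a * of_real u))) = 1 / a"
proof -
  define C where "C = 1 + 2 / (Re a)\<^sup>2"
  have C: "C \<ge> 1" by (simp add: C_def)
  show int: "integrable lborel (\<lambda>u::real. indicator {0<..} u *\<^sub>R exp (- (a * of_real u)))"
  proof (rule Bochner_Integration.integrable_bound[OF integrable_xi_bound[of C]])
    have "(\<lambda>u::real. exp (- (a * of_real u))) \<in> borel_measurable borel"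
      by (intro borel_measurable_continuous_onI continuous_intros)
    then show "(\<lambda>u::real. indicator {0<..} u *\<^sub>R exp (- (a * of_real u))) \<in> borel_measurable lborel"
      by measurable
    have "norm (indicator {0<..} u *\<^sub>R exp (- (a * of_real u))) \<le> norm (C / (1 + u\<^sup>2))" for u
    proof (cases "u > 0")
      case True
      define x where "x = Re a * u"
      have x: "x > 0" using a True by (simp add: x_def)
      have u2: "u\<^sup>2 = x\<^sup>2 / (Re a)\<^sup>2" using a by (simp add: x_def power_mult_distrib)
      have "1 + u\<^sup>2 \<le> C * (1 + x\<^sup>2 / 2)"
        unfolding u2 C_def by (simp add: algebra_simps)
      also have "\<dots> \<le> C * exp x"
        using exp_lower_Taylor_quadratic[of x] x C by (intro mult_left_mono) auto
      finally have "exp (- x) \<le> C / (1 + u\<^sup>2)"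
        by (simp add: exp_minus field_simps add_pos_nonneg)
      then show ?thesis using True C by (simp add: x_def)
    qed auto
    then show "AE u in lborel. norm (indicator {0<..} u *\<^sub>R exp (- (a * of_real u))) \<le> norm (C / (1 + u\<^sup>2))" by simp
  qed
  have ex: "((\<lambda>u::real. - exp (- (a * of_real u)) / a) \<longlongrightarrow> 0) at_top"
  proof (rule Lim_null_comparison)
    show "\<forall>\<^sub>F u in at_top. norm (- exp (- (a * of_real u)) / a) \<le> exp (- (Re a * u)) / norm a"
      by (intro always_eventually) (simp add: norm_divide)
    have "((\<lambda>u. exp (- (Re a * u))) \<longlongrightarrow> 0) at_top"
      using a by (intro filterlim_compose[OF exp_at_bot] filterlim_compose[OF filterlim_uminus_at_bot_at_top]
         filterlim_tendsto_pos_mult_at_top[OF tendsto_const] filterlim_ident) auto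
    then show "((\<lambda>u. exp (- (Re a * u)) / norm a) \<longlongrightarrow> 0) at_top"
      by (rule tendsto_divide_zero)
  qed
  have a0: "a \<noteq> 0" using a by auto
  have "(LBINT u=0..\<infinity>. exp (- (a * complex_of_real u))) = 0 - (- 1 / a)"
  proof (rule interval_integral_FTC_integrable[where F = "\<lambda>u. - exp (- (a * of_real u)) / a"])
    show "((\<lambda>u. - exp (- (a * of_real u)) / a) has_vector_derivative exp (- (a * of_real u))) (at u)" for u :: real
      using a0 by (auto intro!: derivative_eq_intros has_vector_derivative_real_field)
    show "set_integrable lborel (einterval 0 \<infinity>) (\<lambda>u. exp (- (a * complex_of_real u)))"
      using int by (simp add: set_integrable_def einterval_def zero_ereal_def greaterThan_def)
    have "((\<lambda>u. - exp (- (a * of_real u)) / a) \<longlongrightarrow> - exp (- (a * of_real 0)) / a) (at_right (0::real))"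
      using a0 by (intro tendsto_intros) auto
    then show "(((\<lambda>u. - exp (- (a * complex_of_real u)) / a) \<circ> real_of_ereal) \<longlongrightarrow> - 1 / a) (at_right 0)"
      by (simp add: ereal_tendsto_simps zero_ereal_def)
    show "(((\<lambda>u. - exp (- (a * complex_of_real u)) / a) \<circ> real_of_ereal) \<longlongrightarrow> 0) (at_left \<infinity>)"
      using ex by (simp add: ereal_tendsto_simps)
  qed (auto intro!: continuous_intros)
  then show "(LINT u|lborel. indicator {0<..} u *\<^sub>R exp (- (a * of_real u))) = 1 / a"
    by (simp add: interval_lebesgue_integral_0_infty set_lebesgue_integral_def)
qed

lemma one_over_powr_eq: "1 / of_nat (Suc n) powr s = exp (- s * of_real (ln (real (Suc n))))" for s :: complex
proof -
  have "of_nat (Suc n) powr s = exp (s * Ln (of_real (real (Suc n))))" by (simp add: powr_def del: of_nat_Suc)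
  also have "Ln (complex_of_real (real (Suc n))) = of_real (ln (real (Suc n)))" by (rule Ln_of_real) simp
  finally show ?thesis by (simp add: exp_minus inverse_eq_divide)
qed

lemma summable_norm_one_over_powr:
  assumes "Re s > 1" shows "summable (\<lambda>n. norm (1 / of_nat (Suc n) powr s :: complex))"
proof -
  have "summable (\<lambda>n. norm (exp (of_real (ln (of_nat n)) * (- s))))"
    using assms by (subst abs_summable_complex_powr_iff) auto
  then have "summable (\<lambda>n. norm (exp (of_real (ln (of_nat (Suc n))) * (- s))))" by (subst summable_Suc_iff)
  then show ?thesis unfolding one_over_powr_eq by (simp add: mult.commute)
qed

text \<open>Each Gaussian of \<open>omega_theta\<close> yields one term \<open>n^(-s)\<close>
  through the Gamma integral, and absolute convergence for \<open>Re s > 1\<close> permits summation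
  under the integral. The negative half line is then folded onto the positive one by
  \<open>omega_theta_inversion\<close>.\<close>

lemma xi_eq_Dirichlet_series:
  assumes s: "Re s > 1"
  shows "xi s = s * (s - 1) / 2 * (exp (- (s / 2) * of_real (ln pi)) * Gamma (s / 2)) * (\<Sum>n. 1 / of_nat (Suc n) powr s)"
proof -
  define P where "P = exp (- (s / 2) * of_real (ln pi)) * Gamma (s / 2)"
  define f where "f = (\<lambda>n u. exp (s / 2 * of_real u) * complex_of_real (exp (- (pi * (real (Suc n))\<^sup>2) * exp u)))"
  define g where "g = (\<lambda>u. exp (s / 2 * of_real u) * complex_of_real (omega_theta (exp u)))"
  have lnpi: "ln (pi * (real (Suc n))\<^sup>2) = ln pi + 2 * ln (real (Suc n))" for n
    by (subst ln_mult) (auto simp: ln_realpow)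
  have pp: "pi * (real (Suc n))\<^sup>2 > 0" for n by simp
  have s2: "Re (s / 2) > 0" using s by simp
  have F1: "integrable lborel (f n)" for n
    unfolding f_def by (rule Gamma_exp_integral_scaled(1)[OF s2 pp])
  have F2: "(LINT u|lborel. f n u) = exp (- (s / 2) * of_real (ln (pi * (real (Suc n))\<^sup>2))) * Gamma (s / 2)" for n
    unfolding f_def by (rule Gamma_exp_integral_scaled(2)[OF s2 pp])
  have Fv: "(LINT u|lborel. f n u) = P * (1 / of_nat (Suc n) powr s)" for n
  proof -
    have "exp (- (s / 2) * of_real (ln (pi * (real (Suc n))\<^sup>2))) = exp (- (s / 2) * of_real (ln pi)) * exp (- s * of_real (ln (real (Suc n))))"
      unfolding lnpi by (simp add: exp_add[symmetric] algebra_simps)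
    then show ?thesis unfolding F2 one_over_powr_eq P_def by (simp only: mult_ac)
  qed
  have r2: "Re (of_real (Re s / 2) :: complex) > 0" using s by simp
  have normint: "(LINT u|lborel. norm (f n u)) = norm (Gamma (of_real (Re s / 2) :: complex)) * exp (- (Re s / 2) * ln pi) * norm (1 / of_nat (Suc n) powr s)" for n
  proof -
    have nf: "complex_of_real (norm (f n u)) = exp (of_real (Re s / 2) * of_real u) * of_real (exp (- (pi * (real (Suc n))\<^sup>2) * exp u))" for u
      unfolding of_real_mult[symmetric] exp_of_real by (simp add: f_def norm_mult)
    have "complex_of_real (LINT u|lborel. norm (f n u)) = (LINT u|lborel. complex_of_real (norm (f n u)))"
      by (rule integral_complex_of_real[symmetric])
    also have "\<dots> = exp (- of_real (Re s / 2) * of_real (ln (pi * (real (Suc n))\<^sup>2))) * Gamma (of_real (Re s / 2))"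
      unfolding nf by (rule Gamma_exp_integral_scaled(2)[OF r2 pp])
    finally have "norm (complex_of_real (LINT u|lborel. norm (f n u))) = norm (exp (- of_real (Re s / 2) * complex_of_real (ln (pi * (real (Suc n))\<^sup>2)))) * norm (Gamma (of_real (Re s / 2) :: complex))"
      by (simp only: norm_mult)
    moreover have "norm (exp (- of_real (Re s / 2) * complex_of_real (ln (pi * (real (Suc n))\<^sup>2)))) = exp (- (Re s / 2) * ln pi) * norm (1 / of_nat (Suc n) powr s)"
      unfolding lnpi one_over_powr_eq norm_exp_eq_Re by (simp add: exp_add[symmetric] algebra_simps)
    moreover have "norm (complex_of_real (LINT u|lborel. norm (f n u))) = (LINT u|lborel. norm (f n u))"
      by (simp add: Bochner_Integration.integral_nonneg)
    ultimately show ?thesis by (simp add: mult_ac)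
  qed
  have sumn: "summable (\<lambda>n. LINT u|lborel. norm (f n u))"
    unfolding normint by (intro summable_mult summable_norm_one_over_powr s)
  have suf: "summable (\<lambda>n. norm (f n u))" for u
  proof -
    have "norm (f n u) = exp (Re s / 2 * u) * exp (- pi * exp u * (real (Suc n))\<^sup>2)" for n
      by (simp add: f_def norm_mult mult_ac)
    then show ?thesis by (simp only:) (intro summable_mult summable_gauss_Suc exp_gt_zero)
  qed
  have Sg: "(\<Sum>n. f n u) = g u" for u
  proof -
    have "(\<lambda>n. complex_of_real (exp (- (pi * (real (Suc n))\<^sup>2) * exp u))) sums of_real (omega_theta (exp u))"
      unfolding omega_theta_def
      using summable_sums[OF summable_gauss_Suc[of "exp u"]] by (intro sums_of_real) (simp add: mult_ac)
    from sums_mult[OF this] show ?thesis unfolding f_def g_def by (simp add: sums_iff)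
  qed
  note SI = integrable_suminf[OF F1 AE_I2[OF suf] sumn] sums_integral[OF F1 AE_I2[OF suf] sumn]
  have gi: "integrable lborel g" using SI(1) unfolding Sg by simp
  have "(\<lambda>n. P * (1 / of_nat (Suc n) powr s)) sums (LINT u|lborel. g u)"
    using SI(2) unfolding Sg Fv by simp
  moreover have "(\<lambda>n. P * (1 / of_nat (Suc n) powr s)) sums (P * (\<Sum>n. 1 / of_nat (Suc n) powr s))"
    by (intro sums_mult summable_sums summable_norm_cancel[OF summable_norm_one_over_powr[OF s]])
  ultimately have L: "(LINT u|lborel. g u) = P * (\<Sum>n. 1 / of_nat (Suc n) powr s)"
    by (rule sums_unique2)
  \<comment> \<open>The elementary terms of \<open>omega_theta_inversion\<close> after
    multiplication by \<open>exp (- s * u / 2)\<close>; their Laplace transforms are the polar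
    terms.\<close>
  let ?e1 = "\<lambda>u::real. indicator {0<..} u *\<^sub>R exp (- ((s - 1) / 2 * of_real u))"
  let ?e2 = "\<lambda>u::real. indicator {0<..} u *\<^sub>R exp (- (s / 2 * of_real u))"
  have r1: "Re ((s - 1) / 2) > 0" using s by simp
  have gpos: "integrable lborel (\<lambda>u. indicator {0<..} u *\<^sub>R g u)"
    and gneg: "integrable lborel (\<lambda>u. indicator {..0} u *\<^sub>R g u)"
    using gi by (auto intro!: integrable_mult_indicator)
  have gneg': "integrable lborel (\<lambda>u. indicator {..0} (0 + (-1) * u) *\<^sub>R g (0 + (-1) * u))"
    by (rule lborel_integrable_real_affine[OF gneg]) auto
  \<comment> \<open>Reflection maps \<open>{..0}\<close> to \<open>{0..}\<close>, which differs from
    the open half line by one point.\<close>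
  have ae: "AE u in lborel. indicator {..0} (0 + (-1) * u) *\<^sub>R g (0 + (-1) * u) = indicator {0<..} u *\<^sub>R g (- u)"
    using AE_lborel_singleton[of "0::real"] by eventually_elim (auto simp: indicator_def)
  have gm: "g \<in> borel_measurable borel" using borel_measurable_integrable[OF gi] by simp
  have gneg2: "integrable lborel (\<lambda>u. indicator {0<..} u *\<^sub>R g (- u))"
  proof (rule integrable_cong_AE_imp[OF gneg'])
    show "(\<lambda>u. indicator {0<..} u *\<^sub>R g (- u)) \<in> borel_measurable lborel" using gm by measurable
  qed (rule ae)
  have "(LINT u|lborel. g u) = (LINT u|lborel. indicator {0<..} u *\<^sub>R g u + indicator {..0} u *\<^sub>R g u)"
    by (intro Bochner_Integration.integral_cong) (auto simp: indicator_def)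
  also have "\<dots> = (LINT u|lborel. indicator {0<..} u *\<^sub>R g u) + (LINT u|lborel. indicator {..0} u *\<^sub>R g u)"
    by (rule Bochner_Integration.integral_add[OF gpos gneg])
  also have "(LINT u|lborel. indicator {..0} u *\<^sub>R g u) = (LINT u|lborel. indicator {..0} (0 + (-1) * u) *\<^sub>R g (0 + (-1) * u))"
    using lborel_integral_real_affine[of "-1" "\<lambda>u. indicator {..0} u *\<^sub>R g u" 0] by simp
  also have "\<dots> = (LINT u|lborel. indicator {0<..} u *\<^sub>R g (- u))"
    by (rule integral_cong_AE[OF _ _ ae]) (use gneg' gneg2 in auto)
  also have "(LINT u|lborel. indicator {0<..} u *\<^sub>R g u) + \<dots> = (LINT u|lborel. indicator {0<..} u *\<^sub>R g u + indicator {0<..} u *\<^sub>R g (- u))"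
    by (rule Bochner_Integration.integral_add[OF gpos gneg2, symmetric])
  also have "\<dots> = (LINT u|lborel. xi_integrand u s + (1 / 2 * ?e1 u - 1 / 2 * ?e2 u))"
  proof (rule Bochner_Integration.integral_cong[OF refl])
    fix u :: real
    show "indicator {0<..} u *\<^sub>R g u + indicator {0<..} u *\<^sub>R g (- u) = xi_integrand u s + (1 / 2 * ?e1 u - 1 / 2 * ?e2 u)"
    proof (cases "u > 0")
      case True
      define w where "w = complex_of_real (omega_theta (exp u))"
      define E where "E = exp (- (s / 2 * complex_of_real u))"
      define H where "H = complex_of_real (exp (u / 2))"
      have EH: "E * H = exp ((1 - s) * of_real u / 2)" "exp (- ((s - 1) / 2 * of_real u)) = E * H"
        unfolding E_def H_def exp_of_real[symmetric] exp_add[symmetric]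
        by (intro arg_cong[of _ _ exp], simp add: field_simps)+
      have "complex_of_real (omega_theta (exp (- u))) = H * w + (H - 1) / 2"
        unfolding omega_theta_inversion by (simp add: H_def w_def)
      then have "g (- u) = E * (H * w + (H - 1) / 2)"
        by (simp add: g_def E_def)
      then have "g (- u) = E * H * w + (E * H - E) / 2" by (simp add: algebra_simps)
      moreover have "g u = exp (s * of_real u / 2) * w" by (simp add: g_def w_def)
      ultimately show ?thesis using True
        by (simp add: xi_integrand_def EH E_def[symmetric] w_def[symmetric]) (simp add: algebra_simps diff_divide_distrib E_def)
    qed (simp add: xi_integrand_def)
  qed
  also have "\<dots> = (LINT u|lborel. xi_integrand u s) + ((LINT u|lborel. 1 / 2 * ?e1 u) - (LINT u|lborel. 1 / 2 * ?e2 u))"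
    using integrable_mult_right[OF laplace_exp(1)[OF r1], of "1/2"] integrable_mult_right[OF laplace_exp(1)[OF s2], of "1/2"]
    by (simp only: Bochner_Integration.integral_add[OF integrable_xi_integrand Bochner_Integration.integrable_diff] Bochner_Integration.integral_diff)
  also have "(LINT u|lborel. 1 / 2 * ?e1 u) = 1 / 2 * (1 / ((s - 1) / 2))"
    by (simp only: integral_mult_right_zero laplace_exp(2)[OF r1])
  also have "(LINT u|lborel. 1 / 2 * ?e2 u) = 1 / 2 * (1 / (s / 2))"
    by (simp only: integral_mult_right_zero laplace_exp(2)[OF s2])
  finally have LX: "(LINT u|lborel. g u) = (LINT u|lborel. xi_integrand u s) + (1 / (s - 1) - 1 / s)" by simp
  have nz: "s \<noteq> 0" "s - 1 \<noteq> 0" using s by auto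
  have "s * (s - 1) / 2 * (LINT u|lborel. g u) = s * (s - 1) / 2 * (LINT u|lborel. xi_integrand u s) + s * (s - 1) / 2 * (1 / (s - 1) - 1 / s)"
    unfolding LX by (simp only: distrib_left)
  also have "s * (s - 1) / 2 * (1 / (s - 1) - 1 / s) = 1 / 2"
    using nz by (simp add: field_simps)
  finally show ?thesis unfolding L by (simp add: xi_def P_def mult.assoc add.commute)
qed

section \<open>Partial fractions of even entire functions\<close>

text \<open>The Moebius map \<open>g / (2 * M - g)\<close> carries the half plane
  \<open>Re g < M\<close> into the unit disc and fixes 0, so the Schwarz lemma applies; at
  \<open>norm w \<le> 1 / 2\<close> it gives \<open>norm (g w) \<le> 2 * M\<close>.\<close>

lemma Borel_Caratheodory:
  fixes f :: "complex \<Rightarrow> complex"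
  assumes holf: "f holomorphic_on ball c R" and R: "R > 0"
    and less: "\<And>z. z \<in> ball c R \<Longrightarrow> Re (f z - f c) < M"
    and z: "norm (z - c) \<le> R / 2"
  shows "norm (f z - f c) \<le> 2 * M"
proof -
  have M: "M > 0" using less[of c] R by simp
  define g where "g = (\<lambda>w. f (c + of_real R * w) - f c)"
  define \<phi> where "\<phi> = (\<lambda>w. g w / (of_real (2 * M) - g w))"
  have inb: "c + of_real R * w \<in> ball c R" if "norm w < 1" for w
    using that R by (simp add: dist_norm norm_mult)
  have holg: "g holomorphic_on ball 0 1"
    unfolding g_def using inb
    by (intro holomorphic_intros holomorphic_on_compose_gen[OF _ holf, unfolded o_def]) auto
  have Reg: "Re (g w) < M" if "norm w < 1" for w
    using less[OF inb[OF that]] by (simp add: g_def)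
  have nz: "of_real (2 * M) - g w \<noteq> 0" if "norm w < 1" for w
  proof
    assume "of_real (2 * M) - g w = 0"
    then have "Re (g w) = 2 * M" by (metis Re_complex_of_real right_minus_eq)
    with Reg[OF that] M show False by simp
  qed
  have lt: "norm (g w) < norm (of_real (2 * M) - g w)" if "norm w < 1" for w
  proof -
    have "(norm (of_real (2 * M) - g w))\<^sup>2 - (norm (g w))\<^sup>2 = 4 * M * (M - Re (g w))"
      unfolding cmod_power2 by (simp add: power2_eq_square algebra_simps)
    also have "\<dots> > 0" using M Reg[OF that] by simp
    finally show ?thesis by (simp add: power2_less_imp_less)
  qed
  define w where "w = (z - c) / of_real R"
  have nw: "norm w \<le> 1 / 2" using z R by (simp add: w_def norm_divide field_simps)
  have gw: "g w = f z - f c" using R by (simp add: g_def w_def)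
  have "norm (\<phi> w) \<le> norm w"
  proof (rule Schwarz_Lemma)
    show "\<phi> holomorphic_on ball 0 1" unfolding \<phi>_def using nz
      by (intro holomorphic_intros holg) auto
    show "\<phi> 0 = 0" by (simp add: \<phi>_def g_def)
    show "norm (\<phi> v) < 1" if "norm v < 1" for v
      using lt[OF that] nz[OF that] by (simp add: \<phi>_def norm_divide divide_less_eq)
    show "norm w < 1" using nw by simp
  qed
  then have "norm (g w) / norm (of_real (2 * M) - g w) \<le> 1 / 2"
    using nw by (simp only: \<phi>_def norm_divide)
  then have "norm (g w) \<le> 1 / 2 * norm (of_real (2 * M) - g w)"
    using nz[of w] nw by (simp add: divide_le_eq)
  also have "\<dots> \<le> 1 / 2 * (2 * M + norm (g w))"
    using norm_triangle_ineq4[of "of_real (2 * M)" "g w"] M by simp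
  finally show ?thesis by (simp add: gw)
qed

text \<open>A holomorphic logarithm \<open>l\<close> exists on the disc, and the growth of
  \<open>g\<close> bounds \<open>Re (l z - l c)\<close> by \<open>M\<close>. Borel-Caratheodory
  bounds \<open>l - l c\<close> by \<open>2 * M\<close> on the half disc, and Cauchy's estimate of
  radius \<open>R / 4\<close> for the second derivative gives
  \<open>2 * (3 * M) / (R / 4)^2\<close>. The 3 places the values in an open ball.\<close>

lemma norm_deriv_log_deriv_le:
  fixes g :: "complex \<Rightarrow> complex"
  assumes holg: "g holomorphic_on ball c R" and R: "R > 0" and M: "M > 0"
    and nz: "\<And>z. z \<in> ball c R \<Longrightarrow> g z \<noteq> 0"
    and less: "\<And>z. z \<in> ball c R \<Longrightarrow> norm (g z) < exp M * norm (g c)"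
    and z: "norm (z - c) < R / 4"
  shows "norm (deriv (\<lambda>w. deriv g w / g w) z) \<le> 96 * M / R\<^sup>2"
proof -
  obtain l where l: "l holomorphic_on ball c R" "\<And>z. z \<in> ball c R \<Longrightarrow> g z = exp (l z)"
    using contractible_imp_holomorphic_log[OF holg convex_imp_contractible[OF convex_ball] nz] by metis
  have bd: "norm (l w - l c) \<le> 2 * M" if "norm (w - c) \<le> R / 2" for w
  proof (rule Borel_Caratheodory[OF l(1) R _ that])
    fix v assume v: "v \<in> ball c R"
    have "exp (Re (l v)) < exp M * exp (Re (l c))"
      using less[OF v] l(2)[OF v] l(2)[of c] R by simp
    then show "Re (l v - l c) < M" by (simp flip: exp_add)
  qed
  have ld: "deriv g w / g w = deriv l w" if "w \<in> ball c R" for w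
  proof -
    have "(l has_field_derivative deriv l w) (at w)"
      using l(1) that holomorphic_derivI open_ball by blast
    then have "((\<lambda>w. exp (l w)) has_field_derivative exp (l w) * deriv l w) (at w)"
      by (auto intro!: derivative_eq_intros)
    moreover have "eventually (\<lambda>x. exp (l x) = g x) (nhds w)"
      using that l(2) by (intro eventually_nhds_in_open[THEN eventually_mono, of "ball c R"]) auto
    ultimately have "(g has_field_derivative exp (l w) * deriv l w) (at w)"
      using DERIV_cong_ev[of w w "\<lambda>x. exp (l x)" g] by blast
    then show ?thesis using l(2)[OF that] by (simp add: DERIV_imp_deriv)
  qed
  have zin: "z \<in> ball c R" using z R by (auto simp: dist_norm norm_minus_commute)
  have "deriv (\<lambda>w. deriv g w / g w) z = deriv (deriv l) z"
    by (rule deriv_cong_ev)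
       (use zin ld in \<open>auto intro!: eventually_nhds_in_open[THEN eventually_mono, of "ball c R"]\<close>)
  also have "\<dots> = (deriv ^^ 2) l z" by (simp add: numeral_2_eq_2)
  finally have eq: "deriv (\<lambda>w. deriv g w / g w) z = (deriv ^^ 2) l z" .
  have sub: "norm (w - c) < R / 2" if "w \<in> cball z (R / 4)" for w
  proof -
    have "norm (w - c) \<le> norm (w - z) + norm (z - c)"
      using norm_triangle_ineq[of "w - z" "z - c"] by simp
    also have "norm (w - z) \<le> R / 4" using that by (simp add: dist_norm norm_minus_commute)
    finally show ?thesis using z by linarith
  qed
  then have sub': "cball z (R / 4) \<subseteq> ball c R"
    using R by (force simp: dist_norm norm_minus_commute)
  have "norm ((deriv ^^ 2) l z) \<le> fact 2 * (3 * M) / (R / 4) ^ 2"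
  proof (rule Cauchy_higher_deriv_bound[where y = "l c"])
    show "l holomorphic_on ball z (R / 4)"
      using l(1) sub' ball_subset_cball holomorphic_on_subset by blast
    show "continuous_on (cball z (R / 4)) l"
      using l(1) sub' continuous_on_subset holomorphic_on_imp_continuous_on by blast
    show "l w \<in> ball (l c) (3 * M)" if "w \<in> ball z (R / 4)" for w
      using bd[of w] sub[of w] that M by (simp add: dist_norm norm_minus_commute)
  qed (use R in auto)
  also have "\<dots> = 96 * M / R\<^sup>2" by (simp add: power_divide fact_numeral)
  finally show ?thesis by (simp add: eq)
qed

section \<open>Dividing out finitely many zeros\<close>

lemma entire_factor_point:
  fixes f :: "complex \<Rightarrow> complex"
  assumes holf: "f holomorphic_on UNIV" and nz: "f b \<noteq> 0"
  obtains h where "h holomorphic_on UNIV" "\<And>z. f z = h z * (z - a) ^ nat (zorder f a)" "h a \<noteq> 0"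
proof -
  define n where "n = nat (zorder f a)"
  obtain r where r: "r > 0" "zor_poly f a holomorphic_on cball a r"
     "\<And>w. w \<in> cball a r \<Longrightarrow> f w = zor_poly f a w * (w - a) ^ n \<and> zor_poly f a w \<noteq> 0"
    using zorder_exist_zero[OF holf open_UNIV connected_UNIV UNIV_I, of a] nz unfolding n_def by blast
  define h where "h = (\<lambda>z. if z \<in> ball a r then zor_poly f a z else f z / (z - a) ^ n)"
  have eq: "h z = f z / (z - a) ^ n" if "z \<noteq> a" for z
    using r(3)[of z] that by (auto simp: h_def)
  have "h holomorphic_on ball a r"
    by (rule holomorphic_transform[OF holomorphic_on_subset[OF r(2) ball_subset_cball]]) (auto simp: h_def)
  moreover have "h holomorphic_on (- {a})"
  proof (rule holomorphic_transform[of "\<lambda>z. f z / (z - a) ^ n"])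
    show "(\<lambda>z. f z / (z - a) ^ n) holomorphic_on - {a}"
      by (intro holomorphic_intros holomorphic_on_subset[OF holf]) auto
  qed (auto simp: eq)
  ultimately have "h holomorphic_on (ball a r \<union> - {a})"
    by (intro holomorphic_on_Un) auto
  moreover have "ball a r \<union> - {a} = UNIV" using r(1) by auto
  ultimately have "h holomorphic_on UNIV" by simp
  moreover have "f z = h z * (z - a) ^ n" for z
    using r(1) r(3)[of z] by (auto simp: h_def dist_commute)
  moreover have "h a \<noteq> 0" using r by (auto simp: h_def)
  ultimately show ?thesis using that unfolding n_def by blast
qed

lemma entire_factor_finite:
  fixes f :: "complex \<Rightarrow> complex"
  assumes holf: "f holomorphic_on UNIV" and nz: "f b \<noteq> 0" and "finite Z"
  obtains g where "g holomorphic_on UNIV"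
    "\<And>z. f z = g z * (\<Prod>\<rho>\<in>Z. (z - \<rho>) ^ nat (zorder f \<rho>))" "\<And>\<rho>. \<rho> \<in> Z \<Longrightarrow> g \<rho> \<noteq> 0"
proof -
  have "\<exists>g. g holomorphic_on UNIV \<and> (\<forall>z. f z = g z * (\<Prod>\<rho>\<in>Z. (z - \<rho>) ^ nat (zorder f \<rho>)))
          \<and> (\<forall>\<rho>\<in>Z. g \<rho> \<noteq> 0)"
    using \<open>finite Z\<close>
  proof (induction Z rule: finite_induct)
    case empty
    show ?case using holf by (intro exI[of _ f]) auto
  next
    case (insert a Z)
    define P where "P = (\<lambda>z. \<Prod>\<rho>\<in>Z. (z - \<rho>) ^ nat (zorder f \<rho>))"
    from insert.IH obtain g where g: "g holomorphic_on UNIV" "\<And>z. f z = g z * P z"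
      "\<And>\<rho>. \<rho> \<in> Z \<Longrightarrow> g \<rho> \<noteq> 0" unfolding P_def by blast
    have "g b \<noteq> 0" using g(2)[of b] nz by auto
    from entire_factor_point[OF g(1) this, of a] obtain h where
      h: "h holomorphic_on UNIV" "\<And>z. g z = h z * (z - a) ^ nat (zorder g a)" "h a \<noteq> 0" by blast
    have "P a \<noteq> 0" using insert.hyps by (auto simp: P_def)
    \<comment> \<open>The factors removed so far do not vanish at \<open>a\<close>, so
      \<open>g\<close> has the same order there as \<open>f\<close>.\<close>
    have "zorder f a = int (nat (zorder g a))"
    proof (rule zorder_eqI[of UNIV a "\<lambda>z. h z * P z"])
      show "(\<lambda>z. h z * P z) holomorphic_on UNIV"
        unfolding P_def by (intro holomorphic_intros h)
    qed (use h(3) \<open>P a \<noteq> 0\<close> in \<open>auto simp: g(2) h(2) mult_ac simp del: int_nat_eq\<close>)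
    then have "nat (zorder f a) = nat (zorder g a)" by simp
    then have "\<forall>z. f z = h z * (\<Prod>\<rho>\<in>insert a Z. (z - \<rho>) ^ nat (zorder f \<rho>))"
      using g(2) h(2) insert.hyps by (simp add: P_def mult_ac)
    moreover have "h \<rho> \<noteq> 0" if "\<rho> \<in> insert a Z" for \<rho>
      using that h(3) g(3)[of \<rho>] h(2)[of \<rho>] by auto
    ultimately show ?case using h(1) by blast
  qed
  then show ?thesis using that by blast
qed

lemma zorder_even:
  fixes f :: "complex \<Rightarrow> complex"
  assumes holf: "f holomorphic_on UNIV" and nz: "f b \<noteq> 0" and even: "\<And>z. f (- z) = f z"
  shows "zorder f (- a) = zorder f a"
proof -
  from entire_factor_point[OF holf nz, of a] obtain h where
    h: "h holomorphic_on UNIV" "\<And>z. f z = h z * (z - a) ^ nat (zorder f a)" "h a \<noteq> 0" by blast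
  have pos: "zorder f a \<ge> 0"
    using zorder_exist_zero[OF holf open_UNIV connected_UNIV UNIV_I, of a] nz
    by (metis UNIV_I order.order_iff_strict)
  define n where "n = nat (zorder f a)"
  have "zorder f (- a) = int n"
  proof (rule zorder_eqI[of UNIV "- a" "\<lambda>z. h (- z) * (- 1) ^ n"])
    show "(\<lambda>z. h (- z) * (- 1) ^ n) holomorphic_on UNIV"
      by (intro holomorphic_intros holomorphic_on_compose_gen[OF _ h(1), unfolded o_def]) auto
    fix w assume "w \<noteq> - a"
    have "(- w - a) ^ n = (- 1) ^ n * (w - - a) ^ n"
      by (simp flip: power_mult_distrib)
    then show "f w = h (- w) * (- 1) ^ n * (w - - a) powi int n"
      using h(2)[of "- w"] even[of w] by (simp add: n_def mult_ac del: int_nat_eq)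
  qed (use h in auto)
  then show ?thesis using pos by (simp add: n_def)
qed

text \<open>After division by the zeros with \<open>|\<gamma>| < V\<close> the quotient
  \<open>g\<close> is zero-free on a disc of radius \<open>R\<close> around \<open>c\<close>, and
  \<open>h = g'/g\<close> is the difference to be bounded. Evenness makes \<open>h\<close> odd, so
  \<open>2 * h z = h z - h (- z)\<close> is controlled by the derivative of \<open>h\<close>, of
  size \<open>M / R^2\<close>; for growth of order below 2 this tends to 0. The centre is some
  \<open>c > 0\<close>, where \<open>f\<close> cannot vanish, rather than 0, where it might.\<close>

lemma even_entire_log_deriv_approx:
  fixes f :: "complex \<Rightarrow> complex" and c V M :: real
  assumes holf: "f holomorphic_on UNIV" and even: "\<And>z. f (- z) = f z"
    and zeros: "\<And>z. f z = 0 \<Longrightarrow> Re z = 0"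
    and c: "c > 0" and V: "V > 0" and M: "M > 0"
  defines "R \<equiv> sqrt (V\<^sup>2 + c\<^sup>2)"
  assumes bound: "\<And>z. norm (z - of_real c) \<le> 2 * R \<Longrightarrow> norm (f z) < exp M * norm (f (of_real c))"
    and z: "Re z > 0" "norm z + c < R / 4"
  shows "norm ((\<Sum>\<gamma> | \<bar>\<gamma>\<bar> < V \<and> f (\<i> * of_real \<gamma>) = 0.
             of_int (zorder f (\<i> * of_real \<gamma>)) / (z - \<i> * of_real \<gamma>)) - deriv f z / f z)
           \<le> norm z * (96 * M / R\<^sup>2)"
proof -
  define G where "G = {\<gamma>::real. \<bar>\<gamma>\<bar> < V \<and> f (\<i> * of_real \<gamma>) = 0}"
  define Z where "Z = (\<lambda>\<gamma>. \<i> * complex_of_real \<gamma>) ` G"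
  define m where "m = (\<lambda>\<rho>. nat (zorder f \<rho>))"
  have R: "R > 0" "V < R" using V c by (auto simp: R_def real_less_rsqrt sum_power2_gt_zero_iff)
  have fc: "f (of_real c) \<noteq> 0" using zeros[of "of_real c"] c by auto
  \<comment> \<open>The circle of radius \<open>R\<close> around \<open>c\<close> meets the
    imaginary axis exactly at the ordinates \<open>V\<close> and \<open>- V\<close>, so zeros in the
    disc are the zeros below the cutoff.\<close>
  have distc: "norm (\<i> * of_real \<gamma> - of_real c) < R \<longleftrightarrow> \<bar>\<gamma>\<bar> < V" for \<gamma>
  proof -
    have "norm (\<i> * of_real \<gamma> - of_real c) = sqrt (\<gamma>\<^sup>2 + c\<^sup>2)"
      by (simp add: cmod_def add.commute)
    then have "norm (\<i> * of_real \<gamma> - of_real c) < R \<longleftrightarrow> \<gamma>\<^sup>2 < V\<^sup>2" by (simp add: R_def)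
    also have "\<dots> \<longleftrightarrow> \<bar>\<gamma>\<bar> < V"
      using abs_le_square_iff[of V \<gamma>] V by (auto simp flip: not_le)
    finally show ?thesis .
  qed
  have Zeq: "Z = {w \<in> ball (of_real c) R. f w = 0}"
  proof (intro equalityI subsetI)
    fix w assume "w \<in> {w \<in> ball (of_real c) R. f w = 0}"
    then have w: "norm (w - of_real c) < R" "f w = 0" by (auto simp: dist_norm norm_minus_commute)
    have "w = \<i> * of_real (Im w)" using zeros[OF w(2)] by (simp add: complex_eq_iff)
    then show "w \<in> Z" unfolding Z_def G_def using w distc[of "Im w"] by auto
  qed (auto simp: Z_def G_def dist_norm norm_minus_commute[of "complex_of_real c"] distc)
  have "finite {w \<in> cball (of_real c) R. f w = 0}"
  proof (cases "f constant_on UNIV")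
    case True
    then have "f w \<noteq> 0" for w using fc by (auto simp: constant_on_def)
    then show ?thesis by simp
  next
    case False
    from holomorphic_compact_finite_zeros[OF holf open_UNIV connected_UNIV compact_cball subset_UNIV this]
    show ?thesis .
  qed
  then have finZ: "finite Z" by (rule rev_finite_subset) (auto simp: Zeq)
  have inj: "inj_on (\<lambda>\<gamma>. \<i> * complex_of_real \<gamma>) G" by (auto simp: inj_on_def)
  have pos: "zorder f \<rho> \<ge> 0" for \<rho>
    using zorder_exist_zero[OF holf open_UNIV connected_UNIV UNIV_I, of \<rho>] fc
    by (metis UNIV_I order.order_iff_strict)
  define S where "S = (\<lambda>w. \<Sum>\<rho>\<in>Z. of_nat (m \<rho>) / (w - \<rho>))"
  have S: "S w = (\<Sum>\<gamma> | \<bar>\<gamma>\<bar> < V \<and> f (\<i> * of_real \<gamma>) = 0.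
             of_int (zorder f (\<i> * of_real \<gamma>)) / (w - \<i> * of_real \<gamma>))" for w
    unfolding S_def Z_def using pos by (subst sum.reindex[OF inj]) (auto simp: G_def m_def)
  from entire_factor_finite[OF holf fc finZ] obtain g where
    g: "g holomorphic_on UNIV" "\<And>w. f w = g w * (\<Prod>\<rho>\<in>Z. (w - \<rho>) ^ m \<rho>)"
       "\<And>\<rho>. \<rho> \<in> Z \<Longrightarrow> g \<rho> \<noteq> 0" unfolding m_def by blast
  define P where "P = (\<lambda>w. \<Prod>\<rho>\<in>Z. (w - \<rho>) ^ m \<rho>)"
  have fgP: "f w = g w * P w" for w using g(2) by (simp add: P_def)
  have gnz: "g w \<noteq> 0" if "w \<in> ball (of_real c) R" for w
  proof
    assume "g w = 0"
    then have "f w = 0" using g(2) by simp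
    then have "w \<in> Z" using that by (simp add: Zeq)
    with g(3) \<open>g w = 0\<close> show False by blast
  qed
  have Pc: "P (of_real c) \<noteq> 0" using fc fgP[of "of_real c"] by auto
  \<comment> \<open>On the circle of radius \<open>2 * R\<close> each \<open>w - \<rho>\<close> has
    modulus at least \<open>R\<close>, while \<open>c - \<rho>\<close> has modulus below
    \<open>R\<close>; dividing out the zeros therefore preserves the bound relative to the
    centre.\<close>
  have bdry: "norm (g w) \<le> exp M * norm (g (of_real c))" if w: "norm (w - of_real c) = 2 * R" for w
  proof -
    have "norm (P (of_real c)) \<le> norm (P w)"
      unfolding P_def prod_norm[symmetric] norm_power
    proof (intro prod_mono conjI power_mono)
      fix \<rho> assume "\<rho> \<in> Z"
      then have "norm (of_real c - \<rho>) < R" by (auto simp: Zeq dist_norm)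
      moreover have "2 * R \<le> norm (w - \<rho>) + norm (of_real c - \<rho>)"
        using w norm_triangle_ineq4[of "w - \<rho>" "of_real c - \<rho>"] by simp
      ultimately show "norm (of_real c - \<rho>) \<le> norm (w - \<rho>)" by linarith
    qed auto
    then have "norm (g w) * norm (P (of_real c)) \<le> norm (g w) * norm (P w)"
      by (intro mult_left_mono) auto
    also have "\<dots> = norm (f w)" by (simp add: fgP norm_mult)
    also have "\<dots> \<le> exp M * norm (f (of_real c))" using bound[of w] w by simp
    also have "\<dots> = exp M * norm (g (of_real c)) * norm (P (of_real c))" by (simp add: fgP norm_mult)
    finally show ?thesis using Pc by simp
  qed
  have gbound: "norm (g w) \<le> exp M * norm (g (of_real c))" if "norm (w - of_real c) \<le> 2 * R" for w
  proof (rule maximum_modulus_frontier[of g "cball (of_real c) (2 * R)"])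
    show "g holomorphic_on interior (cball (of_real c) (2 * R))"
      using g(1) holomorphic_on_subset by blast
    show "continuous_on (closure (cball (of_real c) (2 * R))) g"
      using g(1) holomorphic_on_imp_continuous_on continuous_on_subset by blast
    show "norm (g u) \<le> exp M * norm (g (of_real c))" if "u \<in> frontier (cball (of_real c) (2 * R))" for u
      using that R by (intro bdry) (simp add: frontier_cball dist_norm norm_minus_commute)
  qed (use that in \<open>auto simp: dist_norm norm_minus_commute\<close>)
  have gc: "norm (g (of_real c)) > 0" using gnz[of "of_real c"] R by simp
  define h where "h = (\<lambda>w. deriv g w / g w)"
  have hS: "h w = deriv f w / f w - S w" if "f w \<noteq> 0" for w
  proof -
    have gw: "g w \<noteq> 0" "P w \<noteq> 0" using that by (auto simp: fgP)
    have nw: "w - \<rho> \<noteq> 0" if "\<rho> \<in> Z" for \<rho> using that \<open>f w \<noteq> 0\<close> by (auto simp: Zeq)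
    have dP: "(P has_field_derivative P w * S w) (at w)"
    proof -
      have "((\<lambda>w. \<Prod>\<rho>\<in>Z. (w - \<rho>) ^ m \<rho>) has_field_derivative
             (\<Prod>\<rho>\<in>Z. (w - \<rho>) ^ m \<rho>) * (\<Sum>\<rho>\<in>Z. (of_nat (m \<rho>) * (w - \<rho>) ^ (m \<rho> - 1)) / (w - \<rho>) ^ m \<rho>)) (at w)"
        using nw by (intro has_field_derivative_prod') (auto intro!: derivative_eq_intros)
      moreover have "(of_nat (m \<rho>) * (w - \<rho>) ^ (m \<rho> - 1)) / (w - \<rho>) ^ m \<rho> = of_nat (m \<rho>) / (w - \<rho>)"
        if "\<rho> \<in> Z" for \<rho> using nw[OF that] by (cases "m \<rho>") (auto simp: divide_simps)
      ultimately show ?thesis by (simp add: P_def S_def)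
    qed
    have dg: "(g has_field_derivative deriv g w) (at w)"
      using g(1) holomorphic_derivI by blast
    have "((\<lambda>w. g w * P w) has_field_derivative deriv g w * P w + P w * S w * g w) (at w)"
      using DERIV_mult[OF dg dP] by simp
    then have "(f has_field_derivative deriv g w * P w + P w * S w * g w) (at w)"
      by (subst (asm) fgP[symmetric])
    then have "deriv f w = deriv g w * P w + P w * S w * g w" by (rule DERIV_imp_deriv)
    then show ?thesis using gw by (simp add: h_def fgP field_simps)
  qed
  have fz: "f z \<noteq> 0" using zeros z(1) by force
  \<comment> \<open>The removed zeros are symmetric under negation with equal multiplicities, so
    \<open>S\<close> is odd like \<open>deriv f / f\<close>.\<close>
  have odd: "h (- z) = - h z"
  proof -
    have "(f has_field_derivative deriv f (- z)) (at (- z))"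
      using holf holomorphic_derivI by blast
    then have "((\<lambda>w. f (- w)) has_field_derivative deriv f (- z) * (- 1)) (at z)"
      by (intro DERIV_chain2[of f _ uminus]) (auto intro!: derivative_eq_intros)
    then have "deriv f z = - deriv f (- z)"
      using even by (simp add: DERIV_imp_deriv)
    moreover have "S (- z) = - S z"
    proof -
      have "S (- z) = (\<Sum>\<rho>\<in>Z. of_nat (m (- \<rho>)) / (- z - (- \<rho>)))"
        unfolding S_def
      proof (rule sum.reindex_bij_witness[of _ uminus uminus])
        fix \<rho> assume "\<rho> \<in> Z"
        have "- \<rho> \<in> Z" if r: "\<rho> \<in> Z" for \<rho>
        proof -
          obtain \<gamma> where "\<rho> = \<i> * of_real \<gamma>" "\<gamma> \<in> G" using r by (auto simp: Z_def)
          moreover from this have "- \<gamma> \<in> G" using even[of "\<i> * of_real \<gamma>"] by (simp add: G_def)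
          ultimately show ?thesis unfolding Z_def by (intro image_eqI[of _ _ "- \<gamma>"]) auto
        qed
        with \<open>\<rho> \<in> Z\<close> show "- \<rho> \<in> Z" "- \<rho> \<in> Z" by auto
      qed auto
      also have "\<dots> = - S z"
        unfolding S_def sum_negf[symmetric]
      proof (rule sum.cong[OF refl])
        fix \<rho> assume "\<rho> \<in> Z"
        have "m (- \<rho>) = m \<rho>" using zorder_even[OF holf fc even] by (simp add: m_def)
        moreover have "- z - - \<rho> = - (z - \<rho>)" by simp
        ultimately show "of_nat (m (- \<rho>)) / (- z - - \<rho>) = - (of_nat (m \<rho>) / (z - \<rho>))"
          by (metis divide_minus_right)
      qed
      finally show ?thesis .
    qed
    ultimately show ?thesis using hS[of z] hS[of "- z"] fz even[of z] by simp
  qed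
  have "norm (h z - h (- z)) \<le> 96 * M / R\<^sup>2 * norm (z - - z)"
  proof (rule field_differentiable_bound[where S = "ball (of_real c) (R / 4)" and f' = "deriv h"])
    have holh: "h holomorphic_on ball (of_real c) R"
      unfolding h_def using gnz by (intro holomorphic_intros holomorphic_on_subset[OF g(1)]) auto
    fix w :: complex assume w: "w \<in> ball (of_real c) (R / 4)"
    then have w': "w \<in> ball (of_real c) R" using R by simp
    show "(h has_field_derivative deriv h w) (at w within ball (of_real c) (R / 4))"
      using holomorphic_derivI[OF holh open_ball w'] has_field_derivative_at_within by blast
    show "norm (deriv h w) \<le> 96 * M / R\<^sup>2"
      unfolding h_def
    proof (rule norm_deriv_log_deriv_le[where c = "of_real c"])
      \<comment> \<open>Equality at an interior point would make \<open>g\<close> constant by the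
        maximum principle and force \<open>exp M = 1\<close>.\<close>
      show "norm (g u) < exp M * norm (g (of_real c))" if "u \<in> ball (of_real c) R" for u
      proof -
        have "norm (P (of_real c)) > 0" using Pc by simp
        show ?thesis
        proof (rule ccontr)
          assume "\<not> ?thesis"
          then have eq: "norm (g u) = exp M * norm (g (of_real c))"
            using gbound[of u] that R by (simp add: dist_norm norm_minus_commute)
          have "norm (g v) \<le> norm (g u)" if "v \<in> ball (of_real c) (2 * R)" for v
            using gbound[of v] that eq by (simp add: dist_norm norm_minus_commute)
          then have "g constant_on ball (of_real c) (2 * R)"
            using maximum_modulus_principle[of g "ball (of_real c) (2 * R)" "ball (of_real c) (2 * R)" u]
              g(1) holomorphic_on_subset \<open>u \<in> ball (of_real c) R\<close> R by auto
          then have "g u = g (of_real c)"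
            using R \<open>u \<in> ball (of_real c) R\<close> unfolding constant_on_def by auto
          then have "exp M = 1" using eq gc by simp
          with M show False by simp
        qed
      qed
    qed (use g(1) holomorphic_on_subset R M gnz w in \<open>auto simp: dist_norm norm_minus_commute\<close>)
  next
    have *: "norm (w - of_real c) < R / 4" if "norm w = norm z" for w :: complex
      using norm_triangle_ineq4[of w "of_real c"] that z c by simp
    show "z \<in> ball (of_real c) (R / 4)" "- z \<in> ball (of_real c) (R / 4)"
      using *[of z] *[of "- z"] by (simp_all only: mem_ball dist_norm norm_minus_commute[of "complex_of_real c"] norm_minus_cancel)
  qed simp
  moreover have "norm (h z - h (- z)) = 2 * norm (h z)"
    by (simp add: odd norm_mult flip: mult_2)
  moreover have "norm (z - - z) = 2 * norm z"
    by (simp add: norm_mult flip: mult_2)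
  ultimately have "norm (h z) \<le> 96 * M / R\<^sup>2 * norm z" by simp
  moreover have "norm (h z) = norm (S z - deriv f z / f z)"
    using hS[OF fz] by (simp add: norm_minus_commute)
  ultimately show ?thesis by (simp add: S[symmetric] mult.commute)
qed

section \<open>Termwise comparison when all zeros are imaginary\<close>

locale even_entire_imaginary_zeros =
  fixes f :: "complex \<Rightarrow> complex" and A :: real
  assumes holf: "f holomorphic_on UNIV" and even: "\<And>z. f (- z) = f z"
    and zeros: "\<And>z. f z = 0 \<Longrightarrow> Re z = 0"
    and growth: "\<And>z. norm (f z) \<le> exp (A * (1 + norm z) powr (3/2))"
begin

definition zero_sum :: "real \<Rightarrow> complex \<Rightarrow> complex" where
  "zero_sum V z = (\<Sum>\<gamma> | \<bar>\<gamma>\<bar> < V \<and> f (\<i> * of_real \<gamma>) = 0.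
             of_int (zorder f (\<i> * of_real \<gamma>)) / (z - \<i> * of_real \<gamma>))"

definition ldf :: "complex \<Rightarrow> complex" where "ldf z = deriv f z / f z"

lemma nonzero: "Re z \<noteq> 0 \<Longrightarrow> f z \<noteq> 0" using zeros by blast

lemma zorder_nonneg: "zorder f \<rho> \<ge> 0"
  using zorder_exist_zero[OF holf open_UNIV connected_UNIV UNIV_I, of \<rho>] nonzero[of 1]
  by (metis UNIV_I order.order_iff_strict one_complex.sel(1) zero_neq_one)

lemma holomorphic_ldf: "ldf holomorphic_on {z. Re z > 0}"
  unfolding ldf_def using nonzero
  by (intro holomorphic_intros holomorphic_on_subset[OF holf]) (auto simp: open_halfspace_Re_gt)

text \<open>Growth of order 3/2 makes the \<open>M\<close> of
  \<open>even_entire_log_deriv_approx\<close> at most of size \<open>R powr (3/2)\<close>, so the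
  error \<open>M / R^2\<close> vanishes. The symmetric cutoff keeps each zero together with its
  negative.\<close>

lemma zero_sum_tendsto:
  assumes z: "Re z > 0"
  shows "((\<lambda>V. zero_sum V z) \<longlongrightarrow> ldf z) at_top"
proof -
  define c :: real where "c = 1 / 2"
  define R where "R = (\<lambda>V::real. sqrt (V\<^sup>2 + c\<^sup>2))"
  define K where "K = \<bar>ln (norm (f (of_real c)))\<bar> + 1"
  define M where "M = (\<lambda>V. \<bar>A\<bar> * (2 + 2 * R V) powr (3/2) + K)"
  have fc: "norm (f (of_real c)) > 0" using nonzero[of "of_real c"] by (simp add: c_def)
  have Kpos: "K > 0" by (simp add: K_def)
  have Mpos: "M V > 0" for V unfolding M_def using Kpos by (intro add_nonneg_pos) auto
  have bound: "norm (f w) < exp (M V) * norm (f (of_real c))"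
    if "norm (w - of_real c) \<le> 2 * R V" for w V
  proof -
    have "norm w \<le> norm (w - of_real c) + norm (complex_of_real c)"
      using norm_triangle_ineq[of "w - of_real c" "of_real c"] by simp
    also have "\<dots> \<le> 2 * R V + 1" using that by (simp add: c_def)
    finally have w: "1 + norm w \<le> 2 + 2 * R V" by simp
    have "norm (f w) \<le> exp (A * (1 + norm w) powr (3/2))" by (rule growth)
    also have "A * (1 + norm w) powr (3/2) \<le> \<bar>A\<bar> * (1 + norm w) powr (3/2)"
      by (intro mult_right_mono) auto
    also have "\<dots> \<le> \<bar>A\<bar> * (2 + 2 * R V) powr (3/2)"
      using w by (intro mult_left_mono powr_mono2) auto
    also have "\<dots> = M V - K" by (simp add: M_def)
    also have "exp (M V - K) < exp (M V + ln (norm (f (of_real c))))"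
      by (simp add: K_def)
    also have "\<dots> = exp (M V) * norm (f (of_real c))" using fc by (simp add: exp_add)
    finally show ?thesis by simp
  qed
  have lim: "filterlim R at_top at_top" unfolding R_def c_def by real_asymp
  have ev: "\<forall>\<^sub>F V in at_top. norm (zero_sum V z - ldf z) \<le> norm z * (96 * M V / (R V)\<^sup>2)"
    using eventually_gt_at_top[of 0] filterlim_at_top_dense[THEN iffD1, OF lim, rule_format, of "4 * (norm z + c)"]
  proof eventually_elim
    case (elim V)
    show ?case unfolding zero_sum_def ldf_def R_def
      by (rule even_entire_log_deriv_approx[OF holf even zeros _ elim(1) Mpos])
         (use bound elim z in \<open>auto simp: R_def c_def\<close>)
  qed
  have "((\<lambda>V. norm z * (96 * M V / (R V)\<^sup>2)) \<longlongrightarrow> 0) at_top"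
  proof -
    have 1: "((\<lambda>r::real. (2 + 2 * r) powr (3/2) / r\<^sup>2) \<longlongrightarrow> 0) at_top" by real_asymp
    have 2: "((\<lambda>r::real. 1 / r\<^sup>2) \<longlongrightarrow> 0) at_top" by real_asymp
    have "((\<lambda>V. norm z * (96 * (\<bar>A\<bar> * ((2 + 2 * R V) powr (3/2) / (R V)\<^sup>2) + K * (1 / (R V)\<^sup>2)))) \<longlongrightarrow>
            norm z * (96 * (\<bar>A\<bar> * 0 + K * 0))) at_top"
      by (intro tendsto_intros filterlim_compose[OF 1 lim] filterlim_compose[OF 2 lim])
    then show ?thesis by (simp add: M_def algebra_simps add_divide_distrib)
  qed
  then have "((\<lambda>V. zero_sum V z - ldf z) \<longlongrightarrow> 0) at_top"
    by (rule Lim_null_comparison[OF ev])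
  then show ?thesis by (rule Lim_null[THEN iffD2])
qed

text \<open>Multiplicities are nonnegative, so an inequality between single terms survives
  summation; it is proved for every truncation and passed to the limit. As the majorant is a
  multiple of a real part of one term, it sums to a value of \<open>Re ldf\<close>.\<close>

lemma norm_ldf_diff_le:
  assumes "Re z > 0" "Re w > 0" "Re u > 0" "B > 0"
    and le: "\<And>\<gamma>. B * norm (1 / (z - \<i> * of_real \<gamma>) - 1 / (w - \<i> * of_real \<gamma>)) \<le> C * Re (1 / (u - \<i> * of_real \<gamma>))"
  shows "B * norm (ldf z - ldf w) \<le> C * Re (ldf u)"
proof (rule tendsto_le[OF trivial_limit_at_top_linorder])
  show "((\<lambda>V. B * norm (zero_sum V z - zero_sum V w)) \<longlongrightarrow> B * norm (ldf z - ldf w)) at_top"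
    by (intro tendsto_intros zero_sum_tendsto assms)
  show "((\<lambda>V. C * Re (zero_sum V u)) \<longlongrightarrow> C * Re (ldf u)) at_top"
    by (intro tendsto_intros zero_sum_tendsto assms)
  show "\<forall>\<^sub>F V in at_top. B * norm (zero_sum V z - zero_sum V w) \<le> C * Re (zero_sum V u)"
  proof (intro always_eventually allI)
    fix V
    let ?G = "{\<gamma>. \<bar>\<gamma>\<bar> < V \<and> f (\<i> * complex_of_real \<gamma>) = 0}"
    let ?m = "\<lambda>\<gamma>. real_of_int (zorder f (\<i> * of_real \<gamma>))"
    have "B * norm (zero_sum V z - zero_sum V w) =
          B * norm (\<Sum>\<gamma>\<in>?G. of_real (?m \<gamma>) * (1 / (z - \<i> * of_real \<gamma>) - 1 / (w - \<i> * of_real \<gamma>)))"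
      by (simp add: zero_sum_def sum_subtractf algebra_simps)
    also have "\<dots> \<le> B * (\<Sum>\<gamma>\<in>?G. ?m \<gamma> * norm (1 / (z - \<i> * of_real \<gamma>) - 1 / (w - \<i> * of_real \<gamma>)))"
      using zorder_nonneg \<open>B > 0\<close>
      by (intro mult_left_mono order.trans[OF norm_sum] sum_mono) (auto simp: norm_mult)
    also have "\<dots> = (\<Sum>\<gamma>\<in>?G. ?m \<gamma> * (B * norm (1 / (z - \<i> * of_real \<gamma>) - 1 / (w - \<i> * of_real \<gamma>))))"
      by (simp add: sum_distrib_left mult_ac)
    also have "\<dots> \<le> (\<Sum>\<gamma>\<in>?G. ?m \<gamma> * (C * Re (1 / (u - \<i> * of_real \<gamma>))))"
      using zorder_nonneg by (intro sum_mono mult_left_mono le) auto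
    also have "\<dots> = (\<Sum>\<gamma>\<in>?G. C * Re (of_int (zorder f (\<i> * of_real \<gamma>)) / (u - \<i> * of_real \<gamma>)))"
      by (intro sum.cong refl) (simp add: Re_divide)
    also have "\<dots> = C * Re (zero_sum V u)"
      by (simp add: zero_sum_def sum_distrib_left)
    finally show "B * norm (zero_sum V z - zero_sum V w) \<le> C * Re (zero_sum V u)" .
  qed
qed

lemma Re_ldf_le:
  assumes "Re u > 0" "Re v > 0"
    and le: "\<And>\<gamma>. Re (1 / (u - \<i> * of_real \<gamma>)) \<le> C * Re (1 / (v - \<i> * of_real \<gamma>))"
  shows "Re (ldf u) \<le> C * Re (ldf v)"
proof (rule tendsto_le[OF trivial_limit_at_top_linorder])
  show "((\<lambda>V. Re (zero_sum V u)) \<longlongrightarrow> Re (ldf u)) at_top"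
    using assms(1) by (intro tendsto_Re zero_sum_tendsto)
  show "((\<lambda>V. C * Re (zero_sum V v)) \<longlongrightarrow> C * Re (ldf v)) at_top"
    using assms(2) by (intro tendsto_mult tendsto_const tendsto_Re zero_sum_tendsto)
  show "\<forall>\<^sub>F V in at_top. Re (zero_sum V u) \<le> C * Re (zero_sum V v)"
  proof (intro always_eventually allI)
    fix V
    have *: "Re (of_int (zorder f (\<i> * of_real \<gamma>)) / (u - \<i> * of_real \<gamma>))
        = of_int (zorder f (\<i> * of_real \<gamma>)) * Re (1 / (u - \<i> * of_real \<gamma>))" for u \<gamma>
      by (simp add: Re_divide)
    have "Re (of_int (zorder f (\<i> * of_real \<gamma>)) / (u - \<i> * of_real \<gamma>)) \<le>
        C * Re (of_int (zorder f (\<i> * of_real \<gamma>)) / (v - \<i> * of_real \<gamma>))" for \<gamma>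
      unfolding * using mult_left_mono[OF le[of \<gamma>], of "of_int (zorder f (\<i> * of_real \<gamma>))"] zorder_nonneg[of "\<i> * of_real \<gamma>"]
      by (simp add: mult_ac)
    then show "Re (zero_sum V u) \<le> C * Re (zero_sum V v)"
      unfolding zero_sum_def Re_sum sum_distrib_left by (intro sum_mono)
  qed
qed

lemma Re_one_divide: "Re (1 / w) = Re w / (norm w)\<^sup>2"
  by (simp add: Re_divide cmod_power2)

lemma Re_ldf_nonneg:
  assumes "Re u > 0" shows "Re (ldf u) \<ge> 0"
proof -
  \<comment> \<open>Comparing \<open>u\<close> with itself for \<open>C = 2\<close> reduces
    nonnegativity to that of the single terms.\<close>
  have "Re (ldf u) \<le> 2 * Re (ldf u)"
  proof (rule Re_ldf_le[OF assms assms])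
    fix \<gamma>
    have "Re (1 / (u - \<i> * of_real \<gamma>)) \<ge> 0" unfolding Re_one_divide using assms by (intro divide_nonneg_nonneg) auto
    then show "Re (1 / (u - \<i> * of_real \<gamma>)) \<le> 2 * Re (1 / (u - \<i> * of_real \<gamma>))" by linarith
  qed
  then show ?thesis by simp
qed

lemma norm_le_norm_plus: "Y > 0 \<Longrightarrow> norm (Complex Y x) \<le> norm (Complex Y (x - Y * q)) * (1 + \<bar>q\<bar>)"
proof -
  assume Y: "Y > 0"
  have eq: "Complex Y x = Complex Y (x - Y * q) + \<i> * of_real (Y * q)" by (simp add: complex_eq_iff)
  have "norm (Complex Y x) \<le> norm (Complex Y (x - Y * q)) + norm (\<i> * of_real (Y * q))"
    by (subst eq) (rule norm_triangle_ineq)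
  also have "norm (\<i> * of_real (Y * q)) = Y * \<bar>q\<bar>" using Y by (simp add: norm_mult abs_mult)
  also have "\<dots> \<le> norm (Complex Y (x - Y * q)) * \<bar>q\<bar>"
    using complex_Re_le_cmod[of "Complex Y (x - Y * q)"] by (intro mult_right_mono) auto
  finally show ?thesis by (simp add: algebra_simps)
qed

text \<open>Write the difference of reciprocals as a quotient and multiply by \<open>n^2\<close>:
  the three factors are at most \<open>3 * Y\<close>, \<open>2 * Y * (1 + |q|)\<close> and
  \<open>1 + |q|\<close>, while \<open>Re (1 / Complex Y x) = Y / n^2\<close>. The factor
  \<open>a\<close> on the left offsets a zero with ordinate near \<open>t\<close>, whose term has
  size \<open>1 / a\<close>, so the bound is uniform for small \<open>a\<close>.\<close>

lemma ldf_compare: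
  assumes a: "0 < a" "a \<le> 2 * Y" and Y: "Y > 0"
  shows "a * norm (ldf (Complex a t) - ldf (Complex Y (t - Y * q)))
           \<le> 6 * Y * (1 + \<bar>q\<bar>)\<^sup>2 * Re (ldf (Complex Y t))"
proof (rule norm_ldf_diff_le)
  fix \<gamma> :: real
  define x where "x = t - \<gamma>"
  define n where "n = norm (Complex Y x)"
  have n: "n > 0" "n\<^sup>2 = Y\<^sup>2 + x\<^sup>2" using Y by (auto simp: n_def cmod_power2 complex_eq_iff)
  have e: "Complex a t - \<i> * of_real \<gamma> = Complex a x"
     "Complex Y (t - Y * q) - \<i> * of_real \<gamma> = Complex Y (x - Y * q)"
     "Complex Y t - \<i> * of_real \<gamma> = Complex Y x" by (auto simp: x_def complex_eq_iff)
  have nz: "Complex a x \<noteq> 0" "Complex Y (x - Y * q) \<noteq> 0" "Complex Y x \<noteq> 0"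
    using a Y by (auto simp: complex_eq_iff)
  have 1: "a * n \<le> 3 * Y * norm (Complex a x)"
  proof -
    have "n \<le> Y + \<bar>x\<bar>" unfolding n_def using cmod_le[of "Complex Y x"] Y by simp
    then have "a * n \<le> a * Y + a * \<bar>x\<bar>" using a by (simp flip: distrib_left)
    also have "\<dots> \<le> norm (Complex a x) * Y + (2 * Y) * norm (Complex a x)"
      using complex_Re_le_cmod[of "Complex a x"] abs_Im_le_cmod[of "Complex a x"] a Y
      by (intro add_mono mult_mono) auto
    finally show ?thesis by simp
  qed
  have 2: "n \<le> norm (Complex Y (x - Y * q)) * (1 + \<bar>q\<bar>)"
    unfolding n_def using Y by (rule norm_le_norm_plus)
  have 3: "norm (Complex Y (x - Y * q) - Complex a x) \<le> 2 * Y * (1 + \<bar>q\<bar>)"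
  proof -
    have "norm (Complex Y (x - Y * q) - Complex a x) \<le> \<bar>Y - a\<bar> + \<bar>Y * q\<bar>"
      using cmod_le[of "Complex Y (x - Y * q) - Complex a x"] by simp
    also have "\<dots> \<le> 2 * Y + 2 * (Y * \<bar>q\<bar>)"
    proof (rule add_mono)
      show "\<bar>Y * q\<bar> \<le> 2 * (Y * \<bar>q\<bar>)" using Y by (simp add: abs_mult)
    qed (use a Y in linarith)
    finally show ?thesis by (simp add: algebra_simps)
  qed
  have "norm (1 / Complex a x - 1 / Complex Y (x - Y * q))
      = norm (Complex Y (x - Y * q) - Complex a x) / (norm (Complex a x) * norm (Complex Y (x - Y * q)))"
    using nz by (simp add: field_simps flip: norm_divide norm_mult)
  then have "a * norm (1 / Complex a x - 1 / Complex Y (x - Y * q)) * n\<^sup>2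
     = (a * n / norm (Complex a x)) * norm (Complex Y (x - Y * q) - Complex a x) * (n / norm (Complex Y (x - Y * q)))"
    by (simp add: power2_eq_square)
  also have "\<dots> \<le> (3 * Y) * (2 * Y * (1 + \<bar>q\<bar>)) * (1 + \<bar>q\<bar>)"
    using 1 2 3 a Y n nz by (intro mult_mono) (auto simp: divide_le_eq mult.commute)
  finally have "a * norm (1 / Complex a x - 1 / Complex Y (x - Y * q)) \<le> (3 * Y) * (2 * Y * (1 + \<bar>q\<bar>)) * (1 + \<bar>q\<bar>) / n\<^sup>2"
    using n(1) by (simp add: pos_le_divide_eq del: n(2))
  also have "\<dots> = 6 * Y * (1 + \<bar>q\<bar>)\<^sup>2 * Re (1 / Complex Y x)"
    by (simp add: Re_one_divide n_def power2_eq_square)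
  finally show "a * norm (1 / (Complex a t - \<i> * of_real \<gamma>) - 1 / (Complex Y (t - Y * q) - \<i> * of_real \<gamma>))
      \<le> 6 * Y * (1 + \<bar>q\<bar>)\<^sup>2 * Re (1 / (Complex Y t - \<i> * of_real \<gamma>))" by (simp only: e)
qed (use assms in auto)

text \<open>Harnack's inequality for the nonnegative harmonic function \<open>Re ldf\<close>, read
  off term by term: a move by at most \<open>Y\<close> at distance \<open>Y\<close> from the axis
  changes each squared modulus by at most the factor 4.\<close>

lemma Re_ldf_Harnack:
  assumes Y: "Y > 0" and q: "\<bar>q\<bar> \<le> 1"
  shows "Re (ldf (Complex Y t)) \<le> 4 * Re (ldf (Complex Y (t - Y * q)))"
proof (rule Re_ldf_le)
  fix \<gamma> :: real
  define x where "x = t - \<gamma>"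
  have e: "Complex Y (t - Y * q) - \<i> * of_real \<gamma> = Complex Y (x - Y * q)"
     "Complex Y t - \<i> * of_real \<gamma> = Complex Y x" by (auto simp: x_def complex_eq_iff)
  have Re: "Re (1 / Complex Y x) = Y / (norm (Complex Y x))\<^sup>2" for x
    by (simp add: Re_one_divide)
  have "norm (Complex Y (x - Y * q)) \<le> norm (Complex Y x) * (1 + \<bar>- q\<bar>)"
    using norm_le_norm_plus[OF Y, of "x - Y * q" "- q"] by simp
  also have "\<dots> \<le> norm (Complex Y x) * 2" using q by (intro mult_left_mono) auto
  finally have "(norm (Complex Y (x - Y * q)))\<^sup>2 \<le> (norm (Complex Y x) * 2)\<^sup>2" by (intro power_mono) auto
  moreover have "norm (Complex Y x) > 0" "norm (Complex Y (x - Y * q)) > 0"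
    using Y by (auto simp: complex_eq_iff)
  ultimately show "Re (1 / (Complex Y t - \<i> * of_real \<gamma>)) \<le> 4 * Re (1 / (Complex Y (t - Y * q) - \<i> * of_real \<gamma>))"
    unfolding e Re using Y by (simp add: field_simps power_mult_distrib)
qed (use assms in auto)

text \<open>The constants depend on \<open>Y\<close>: this growth justifies integrability and
  contour shifts and does not enter the final estimate.\<close>

lemma norm_ldf_growth:
  assumes Y: "Y > 0" and z: "Re z \<ge> Y"
  shows "norm (ldf z) \<le> norm (ldf (of_real Y)) + norm (z - of_real Y) * (1 + norm (z - of_real Y) / Y) / Y * Re (ldf (of_real Y))"
proof -
  have "1 * norm (ldf z - ldf (of_real Y)) \<le> norm (z - of_real Y) * (1 + norm (z - of_real Y) / Y) / Y * Re (ldf (of_real Y))"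
  proof (rule norm_ldf_diff_le)
    fix \<gamma> :: real
    define d where "d = norm (z - of_real Y)"
    define w where "w = z - \<i> * of_real \<gamma>"
    define u where "u = complex_of_real Y - \<i> * of_real \<gamma>"
    have w: "norm w \<ge> Y" using complex_Re_le_cmod[of w] z by (simp add: w_def)
    have u: "norm u \<ge> Y" using complex_Re_le_cmod[of u] by (simp add: u_def)
    have nz: "w \<noteq> 0" "u \<noteq> 0" using w u Y by auto
    have "norm u \<le> norm w + d" unfolding d_def
      using norm_triangle_ineq4[of w "z - of_real Y"] by (simp add: w_def u_def)
    also have "d \<le> norm w * (d / Y)"
      using mult_right_mono[OF w, of "d / Y"] Y by (simp add: d_def)
    finally have uw: "norm u / norm w \<le> 1 + d / Y" using nz by (simp add: divide_le_eq algebra_simps)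
    have "norm (1 / w - 1 / u) = d / (norm w * norm u)"
    proof -
      have "1 / w - 1 / u = - ((z - of_real Y) / (w * u))" using nz by (simp add: field_simps) (simp add: w_def u_def algebra_simps)
      then show ?thesis by (simp add: norm_divide norm_mult d_def)
    qed
    also have "\<dots> = d * (norm u / norm w) / (norm u)\<^sup>2" using nz by (simp add: power2_eq_square)
    also have "\<dots> \<le> d * (1 + d / Y) / (norm u)\<^sup>2"
      using uw by (intro divide_right_mono mult_left_mono) (auto simp: d_def)
    also have "\<dots> = d * (1 + d / Y) / Y * Re (1 / u)"
      using Y by (simp add: Re_one_divide) (simp add: u_def)
    finally show "1 * norm (1 / (z - \<i> * of_real \<gamma>) - 1 / (of_real Y - \<i> * of_real \<gamma>)) \<le>
        norm (z - of_real Y) * (1 + norm (z - of_real Y) / Y) / Y * Re (1 / (of_real Y - \<i> * of_real \<gamma>))"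
      by (simp add: w_def u_def d_def)
  qed (use assms in auto)
  then show ?thesis using norm_triangle_sub[of "ldf z" "ldf (of_real Y)"] by simp
qed

end

section \<open>The digamma function on the critical line\<close>

text \<open>Summed over \<open>x = 1, 2, ...\<close> with \<open>B\<close> a natural number, the
  right side telescopes to a multiple of a harmonic number; this is the origin of the logarithm in
  \<open>norm_Digamma_le\<close>.\<close>

lemma min_recip_le:
  fixes x B :: real assumes "x > 0" "B > 0"
  shows "min (5 / x) (4 * B / x\<^sup>2) \<le> 10 * (1 / x - 1 / (x + B))"
proof -
  have eq: "1 / x - 1 / (x + B) = B / (x * (x + B))" using assms by (simp add: field_simps)
  show ?thesis
  proof (cases "x \<le> B")
    case True
    have "5 / x = 5 * (x + B) / (x * (x + B))" using assms by (simp del: distrib_left_numeral)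
    also have "\<dots> \<le> 10 * B / (x * (x + B))" using True assms by (intro divide_right_mono) auto
    finally show ?thesis unfolding eq by simp
  next
    case False
    have "4 * B / x\<^sup>2 = 8 * B / (x * (2 * x))" using assms by (simp add: power2_eq_square)
    also have "\<dots> \<le> 8 * B / (x * (x + B))"
      using False assms by (intro divide_left_mono mult_left_mono mult_pos_pos) auto
    also have "\<dots> \<le> 10 * B / (x * (x + B))" using assms by (intro divide_right_mono) auto
    finally show ?thesis unfolding eq by simp
  qed
qed

text \<open>The Digamma series at \<open>w\<close> is compared termwise with the one at
  \<open>n + 1\<close> for an integer \<open>n\<close> slightly above \<open>norm w\<close>, whose
  sum is \<open>harm n \<le> ln n + 1\<close>.\<close>

lemma norm_Digamma_le:
  fixes w :: complex
  assumes w: "Re w \<ge> 1 / 4"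
  shows "norm (Digamma w) \<le> 30 * ln (2 + norm w)"
proof -
  define n where "n = nat \<lceil>norm w\<rceil> + 1"
  have n: "real n \<ge> norm (w - 1)" "real n \<le> norm w + 2" "n \<ge> 1"
    unfolding n_def using norm_triangle_ineq4[of w 1] by (auto simp: of_nat_ceiling) linarith+
  define a where "a = (\<lambda>k::nat. inverse (of_nat (Suc k)) - inverse (w + of_nat k))"
  define b where "b = (\<lambda>k::nat. inverse (real (Suc k)) - inverse (real (Suc n) + real k))"
  have w0: "w \<noteq> 0" using w by auto
  have "summable b" unfolding b_def by (rule summable_Digamma) auto
  moreover have "suminf b = harm n"
    using Digamma_of_nat[of n, where 'a = real] Digamma_def[of "real (Suc n)"] by (simp add: b_def add_ac)
  ultimately have bs: "b sums harm n" by (metis summable_sums)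
  have ab: "norm (a k) \<le> 10 * b k" for k
  proof -
    define x where "x = real (Suc k)"
    have x: "x > 0" by (simp add: x_def)
    have wk: "norm (w + of_nat k) \<ge> x / 4"
      using complex_Re_le_cmod[of "w + of_nat k"] w by (simp add: x_def)
    then have wk0: "w + of_nat k \<noteq> 0" using x by auto
    have 1: "norm (inverse (w + of_nat k)) \<le> 4 / x"
      using le_imp_inverse_le[OF wk] x by (simp add: norm_inverse inverse_eq_divide norm_divide)
    have "norm (a k) \<le> norm (inverse (of_nat (Suc k)) :: complex) + norm (inverse (w + of_nat k))"
      unfolding a_def by (rule norm_triangle_ineq4)
    also have "norm (inverse (of_nat (Suc k)) :: complex) = 1 / x"
      by (simp add: x_def norm_inverse norm_divide inverse_eq_divide del: of_nat_Suc)
    finally have A: "norm (a k) \<le> 5 / x" using 1 by (simp add: add_divide_distrib[symmetric])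
    have sx: "of_nat (Suc k) = complex_of_real x" by (simp add: x_def)
    have "a k = (w - 1) * (inverse (of_real x) * inverse (w + of_nat k))"
    proof -
      have "a k = (w + of_nat k - of_real x) * (inverse (of_real x) * inverse (w + of_nat k))"
        unfolding a_def sx using wk0 x by (simp add: field_simps)
      also have "w + of_nat k - of_real x = w - 1" by (simp add: x_def)
      finally show ?thesis .
    qed
    then have "norm (a k) = norm (w - 1) * (1 / x * norm (inverse (w + of_nat k)))"
      using x by (simp add: norm_mult norm_inverse inverse_eq_divide norm_divide)
    also have "\<dots> \<le> real n * (1 / x * (4 / x))"
      using 1 x n by (intro mult_mono) auto
    finally have B: "norm (a k) \<le> 4 * real n / x\<^sup>2" by (simp add: power2_eq_square mult_ac)
    have "norm (a k) \<le> min (5 / x) (4 * real n / x\<^sup>2)" using A B by simp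
    also have "\<dots> \<le> 10 * (1 / x - 1 / (x + real n))" using x n by (intro min_recip_le) auto
    also have "\<dots> = 10 * b k" by (simp add: b_def x_def inverse_eq_divide add_ac)
    finally show ?thesis .
  qed
  have "norm (suminf a) \<le> suminf (\<lambda>k. 10 * b k)"
    using ab bs by (intro norm_suminf_le summable_mult) (auto simp: sums_iff)
  also have "\<dots> = 10 * harm n" using sums_unique[OF sums_mult[OF bs, of 10]] by simp
  also have "harm n \<le> ln (real n) + 1" using euler_mascheroni_sequence_decreasing[of 1 n] n by (simp add: harm_expand)
  finally have s: "norm (suminf a) \<le> 10 * ln (real n) + 10" by simp
  have "Digamma w = suminf a - euler_mascheroni" unfolding a_def by (rule Digamma_def)
  then have "norm (Digamma w) \<le> norm (suminf a) + norm (euler_mascheroni :: complex)"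
    by (metis norm_triangle_ineq4)
  also have "norm (euler_mascheroni :: complex) \<le> 1"
  proof -
    have "norm (euler_mascheroni :: complex) = \<bar>euler_mascheroni :: real\<bar>"
      by (metis norm_of_real of_real_euler_mascheroni)
    then show ?thesis using euler_mascheroni_pos euler_mascheroni_less_13_over_22 by simp
  qed
  finally have "norm (Digamma w) \<le> 10 * ln (real n) + 11" using s by simp
  also have "ln (real n) \<le> ln (2 + norm w)" using n by (subst ln_le_cancel_iff) (auto intro: add_pos_nonneg)
  also have "11 \<le> 20 * ln (2 + norm w)"
  proof -
    have "11 / 20 \<le> ln (2::real)" using ln2_ge_two_thirds by simp
    also have "\<dots> \<le> ln (2 + norm w)" by (subst ln_le_cancel_iff) (auto intro: add_pos_nonneg)
    finally show ?thesis by simp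
  qed
  finally show ?thesis by simp
qed

lemma Digamma_cnj: "Digamma (cnj w) = cnj (Digamma w)" if "w \<noteq> 0" for w :: complex
proof -
  have "(\<lambda>k. cnj (inverse (of_nat (Suc k)) - inverse (w + of_nat k))) sums
      cnj (\<Sum>k. inverse (of_nat (Suc k)) - inverse (w + of_nat k))"
    by (intro bounded_linear.sums[OF bounded_linear_cnj] summable_sums summable_Digamma that)
  then have "(\<Sum>k. inverse (of_nat (Suc k)) - inverse (cnj w + of_nat k)) =
      cnj (\<Sum>k. inverse (of_nat (Suc k)) - inverse (w + of_nat k))"
    by (simp add: sums_iff)
  moreover have "cnj (euler_mascheroni :: complex) = euler_mascheroni"
    by (metis complex_cnj_complex_of_real of_real_euler_mascheroni)
  ultimately show ?thesis by (simp add: Digamma_def)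
qed

text \<open>Half of this is the logarithmic derivative of \<open>pi^(-s/2) * Gamma(s/2)\<close> at
  \<open>s = 1/2 + w\<close>; its average over \<open>\<i> * \<xi>\<close> and
  \<open>- \<i> * \<xi>\<close> is \<open>Omega \<xi>\<close>.\<close>

definition gamma_psi :: "complex \<Rightarrow> complex" where
  "gamma_psi w = Digamma (1 / 4 + w / 2) - of_real (ln pi)"

lemma holomorphic_gamma_psi: "gamma_psi holomorphic_on {w. Re w > - 1 / 2}"
proof -
  have "1 / 4 + w / 2 \<notin> \<int>\<^sub>\<le>\<^sub>0" if "Re w > - 1 / 2" for w
    using that by (auto elim!: nonpos_Ints_cases simp: complex_eq_iff)
  then show ?thesis unfolding gamma_psi_def
    by (intro holomorphic_intros holomorphic_on_compose_gen[OF _ holomorphic_on_Polygamma[of "- \<int>\<^sub>\<le>\<^sub>0"], unfolded o_def]) auto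
qed

lemma norm_gamma_psi_le:
  assumes "Re w \<ge> 0" shows "norm (gamma_psi w) \<le> 33 * ln (3 + norm w)"
proof -
  have "norm (1 / 4 + w / 2) \<le> 1 / 4 + norm w / 2"
    using norm_triangle_ineq[of "1/4" "w/2"] by (simp add: norm_divide)
  then have n: "2 + norm (1 / 4 + w / 2) \<le> 3 + norm w" using norm_ge_zero[of w] by linarith
  have "norm (Digamma (1 / 4 + w / 2)) \<le> 30 * ln (2 + norm (1 / 4 + w / 2))"
    using assms by (intro norm_Digamma_le) auto
  also have "ln (2 + norm (1 / 4 + w / 2)) \<le> ln (3 + norm w)"
    using n by (subst ln_le_cancel_iff) (auto intro: add_pos_nonneg)
  finally have 1: "norm (Digamma (1 / 4 + w / 2)) \<le> 30 * ln (3 + norm w)" by simp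
  have "ln pi \<le> ln (3 ^ 2)" using pi_less_4 pi_gt_zero by (subst ln_le_cancel_iff) auto
  also have "\<dots> = 2 * ln 3" by (subst ln_realpow) auto
  also have "ln 3 \<le> ln (3 + norm w)" by (subst ln_le_cancel_iff) (auto intro: add_pos_nonneg)
  finally have 2: "ln pi \<le> 2 * ln (3 + norm w)" by simp
  have "ln pi \<ge> 0" using pi_gt3 by simp
  then have "norm (gamma_psi w) \<le> norm (Digamma (1 / 4 + w / 2)) + ln pi"
    unfolding gamma_psi_def using norm_triangle_ineq4[of "Digamma (1 / 4 + w / 2)" "of_real (ln pi)"] by simp
  moreover have "ln (3 + norm w) \<ge> 0" by simp
  ultimately show ?thesis using 1 2 by linarith
qed

lemma Omega_eq: "complex_of_real (Omega \<xi>) = (gamma_psi (\<i> * of_real \<xi>) + gamma_psi (- (\<i> * of_real \<xi>))) / 2"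
proof -
  define w where "w = 1 / 4 + \<i> * complex_of_real \<xi> / 2"
  have "w \<noteq> 0" by (auto simp: w_def complex_eq_iff)
  then have c: "Digamma (cnj w) = cnj (Digamma w)" by (rule Digamma_cnj)
  have e: "cnj w = 1 / 4 - \<i> * complex_of_real \<xi> / 2" by (simp add: w_def)
  have "Digamma w + cnj (Digamma w) = of_real (2 * Re (Digamma w))" by (simp add: complex_eq_iff)
  then show ?thesis
    unfolding Omega_def gamma_psi_def using c e by (simp add: w_def[symmetric] complex_eq_iff)
qed

lemma continuous_gamma_psi_i: "continuous_on UNIV (\<lambda>\<xi>. gamma_psi (\<i> * complex_of_real \<xi>))"
  by (rule continuous_on_compose2[OF holomorphic_on_imp_continuous_on[OF holomorphic_gamma_psi]])
     (auto intro!: continuous_intros)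

section \<open>Cauchy integrals of the archimedean density\<close>

text \<open>Both logarithms have arguments of positive real part, so the principal branch gives an
  antiderivative throughout. Pulling out \<open>ln V\<close> leaves
  \<open>Ln (z / V - \<i>) - Ln (z / V + \<i>)\<close>, with limit
  \<open>- \<i> * pi\<close>.\<close>

lemma cauchy_kernel_integral_tendsto:
  assumes z: "Re z > 0"
  shows "((\<lambda>V. integral {-V..V} (\<lambda>\<xi>. 1 / (z - \<i> * of_real \<xi>) + 1 / (z + \<i> * of_real \<xi>))) \<longlongrightarrow> of_real (2 * pi)) at_top"
proof -
  define F where "F = (\<lambda>\<xi>::real. \<i> * Ln (z - \<i> * of_real \<xi>) - \<i> * Ln (z + \<i> * of_real \<xi>))"
  have nn: "z - \<i> * of_real \<xi> \<notin> \<real>\<^sub>\<le>\<^sub>0" "z + \<i> * of_real \<xi> \<notin> \<real>\<^sub>\<le>\<^sub>0" for \<xi> :: real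
    using z by (auto simp: complex_nonpos_Reals_iff)
  then have nz: "z - \<i> * of_real \<xi> \<noteq> 0" "z + \<i> * of_real \<xi> \<noteq> 0" for \<xi> :: real
    using z by (auto simp: complex_eq_iff)
  have int: "integral {-V..V} (\<lambda>\<xi>. 1 / (z - \<i> * of_real \<xi>) + 1 / (z + \<i> * of_real \<xi>)) = F V - F (- V)"
    if "V > 0" for V
  proof (rule integral_unique, rule fundamental_theorem_of_calculus)
    fix \<xi> :: real
    have 1: "((\<lambda>w. \<i> * Ln (z - \<i> * w) - \<i> * Ln (z + \<i> * w)) has_field_derivative
       1 / (z - \<i> * of_real \<xi>) + 1 / (z + \<i> * of_real \<xi>)) (at (of_real \<xi>))"
      using nn[of \<xi>] nz[of \<xi>] by (auto intro!: derivative_eq_intros simp: field_simps)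
    show "(F has_vector_derivative 1 / (z - \<i> * of_real \<xi>) + 1 / (z + \<i> * of_real \<xi>)) (at \<xi> within {-V..V})"
      unfolding F_def by (rule has_vector_derivative_real_field[OF has_field_derivative_at_within[OF 1]])
  qed (use that in auto)
  have F: "F V - F (- V) = 2 * \<i> * (Ln (z / of_real V - \<i>) - Ln (z / of_real V + \<i>))" if V: "V > 0" for V
  proof -
    have 1: "Ln (of_real V * (z / of_real V - \<i>)) = of_real (ln V) + Ln (z / of_real V - \<i>)"
      using Ln_times_of_real[OF V, of "z / of_real V - \<i>"] V z by (auto simp: complex_eq_iff Ln_of_real)
    have 2: "Ln (of_real V * (z / of_real V + \<i>)) = of_real (ln V) + Ln (z / of_real V + \<i>)"
      using Ln_times_of_real[OF V, of "z / of_real V + \<i>"] V z by (auto simp: complex_eq_iff Ln_of_real)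
    show ?thesis using V 1 2 by (simp add: F_def algebra_simps)
  qed
  have zl: "((\<lambda>V::real. z / of_real V) \<longlongrightarrow> 0) at_top"
  proof -
    have "((\<lambda>V::real. complex_of_real (inverse V)) \<longlongrightarrow> of_real 0) at_top"
      by (intro tendsto_of_real tendsto_inverse_0_at_top filterlim_ident)
    from tendsto_mult_left[OF this, of z] show ?thesis by (simp add: divide_inverse)
  qed
  have "((\<lambda>V::real. 2 * \<i> * (Ln (z / of_real V - \<i>) - Ln (z / of_real V + \<i>))) \<longlongrightarrow> 2 * \<i> * (Ln (0 - \<i>) - Ln (0 + \<i>))) at_top"
    by (intro tendsto_intros zl) (auto simp: complex_nonpos_Reals_iff)
  moreover have "2 * \<i> * (Ln (0 - \<i>) - Ln (0 + \<i>)) = of_real (2 * pi)"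
    by (simp add: complex_eq_iff)
  ultimately have "((\<lambda>V::real. 2 * \<i> * (Ln (z / of_real V - \<i>) - Ln (z / of_real V + \<i>))) \<longlongrightarrow> of_real (2 * pi)) at_top"
    by (simp only:)
  then show ?thesis
    by (rule Lim_transform_eventually)
       (use eventually_gt_at_top[of 0] in \<open>eventually_elim, simp add: int F\<close>)
qed


text \<open>Subtracting \<open>gamma_psi z\<close> cancels the pole of the Cauchy kernel at
  \<open>z\<close>. The segment can then be pushed to the other three sides of a rectangle in the
  right half plane, of length \<open>O(V)\<close>, where the integrand is
  \<open>O(ln V / V^2)\<close>.\<close>

lemma gamma_psi_remainder_tendsto:
  assumes z: "Re z > 0"
  shows "((\<lambda>V. integral {-V..V} (\<lambda>\<xi>. (gamma_psi (\<i> * of_real \<xi>) - gamma_psi z) *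
            (1 / (z - \<i> * of_real \<xi>) + 1 / (z + \<i> * of_real \<xi>)))) \<longlongrightarrow> 0) at_top"
proof -
  \<comment> \<open>\<open>d \<le> 1 / 2\<close> keeps \<open>S\<close> inside the domain of
    \<open>gamma_psi\<close>, and \<open>d \<le> Re z\<close> keeps the other pole
    \<open>- z\<close> outside \<open>S\<close>.\<close>
  define d where "d = min (1 / 2) (Re z)"
  define S where "S = {w. Re w > - d}"
  have d: "d > 0" "d \<le> 1 / 2" "d \<le> Re z" using z by (auto simp: d_def)
  have S: "open S" "convex S" unfolding S_def
    using open_halfspace_Re_gt[of "- d"] convex_halfspace_Re_gt[of "- d"] by auto
  have zS: "z \<in> S" using z d by (auto simp: S_def)
  have zp: "z + w \<noteq> 0" if "w \<in> S" for w using that d unfolding S_def by (auto simp: complex_eq_iff)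
  define h where "h = (\<lambda>w. if w = z then deriv gamma_psi z else (gamma_psi w - gamma_psi z) / (w - z))"
  define Q where "Q = (\<lambda>w. - h w * (2 * z / (z + w)))"
  have "h holomorphic_on S" unfolding h_def
  proof (rule pole_lemma)
    show "gamma_psi holomorphic_on S"
      by (rule holomorphic_on_subset[OF holomorphic_gamma_psi]) (use d in \<open>auto simp: S_def\<close>)
    show "z \<in> interior S" using zS S by (simp add: interior_open)
  qed
  then have holQ: "Q holomorphic_on S" unfolding Q_def using zp by (intro holomorphic_intros) auto
  obtain P where P0: "\<And>w. w \<in> S \<Longrightarrow> (P has_field_derivative Q w) (at w within S)"
    by (rule holomorphic_convex_primitive'[OF S(2,1) holQ]) (rule that)
  have P: "(P has_field_derivative Q w) (at w)" if "w \<in> S" for w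
    using P0[OF that] unfolding at_within_open[OF that S(1)] .
  have Q: "Q w = (gamma_psi w - gamma_psi z) * (1 / (z - w) + 1 / (z + w))" if "w \<in> S" "w \<noteq> z" for w
  proof -
    have "z - w \<noteq> 0" "w - z \<noteq> 0" using that by auto
    then have "1 / (z - w) + 1 / (z + w) = 2 * z / ((z - w) * (z + w))"
      using zp[OF that(1)] by (subst add_frac_eq) auto
    moreover have "- h w = (gamma_psi w - gamma_psi z) / (z - w)"
      using that minus_divide_right[of "gamma_psi w - gamma_psi z" "w - z"] by (simp add: h_def)
    ultimately show ?thesis unfolding Q_def by simp
  qed
  have iS: "\<i> * of_real \<xi> \<in> S" "\<i> * of_real \<xi> \<noteq> z" for \<xi> :: real using d z by (auto simp: S_def)
  have int: "integral {-V..V} (\<lambda>\<xi>. (gamma_psi (\<i> * of_real \<xi>) - gamma_psi z) *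
            (1 / (z - \<i> * of_real \<xi>) + 1 / (z + \<i> * of_real \<xi>))) = (P (\<i> * of_real V) - P (- (\<i> * of_real V))) / \<i>"
    if V: "V > 0" for V
  proof -
    have "((\<lambda>\<xi>. (gamma_psi (\<i> * of_real \<xi>) - gamma_psi z) *
            (1 / (z - \<i> * of_real \<xi>) + 1 / (z + \<i> * of_real \<xi>))) has_integral
            P (\<i> * of_real V) / \<i> - P (\<i> * of_real (-V)) / \<i>) {-V..V}"
    proof (rule fundamental_theorem_of_calculus)
      fix \<xi> :: real
      have "((\<lambda>w. P (\<i> * w) / \<i>) has_field_derivative Q (\<i> * of_real \<xi>) * \<i> / \<i>) (at (of_real \<xi>))"
        by (intro DERIV_cdivide DERIV_chain2[where f = P and g = "\<lambda>w. \<i> * w", OF P[OF iS(1)]]) (auto intro!: derivative_eq_intros)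
      then have "((\<lambda>w. P (\<i> * w) / \<i>) has_field_derivative Q (\<i> * of_real \<xi>)) (at (of_real \<xi>))"
        by (rule DERIV_cong) (rule nonzero_mult_div_cancel_right, simp)
      from has_vector_derivative_real_field[OF has_field_derivative_at_within[OF this]]
      show "((\<lambda>\<xi>. P (\<i> * of_real \<xi>) / \<i>) has_vector_derivative
         (gamma_psi (\<i> * of_real \<xi>) - gamma_psi z) * (1 / (z - \<i> * of_real \<xi>) + 1 / (z + \<i> * of_real \<xi>))) (at \<xi> within {-V..V})"
        using Q[OF iS] by simp
    qed (use V in auto)
    then show ?thesis by (simp add: integral_unique right_diff_distrib)
  qed
  define B where "B = (\<lambda>V::real. (33 * ln (3 + 2 * V) + norm (gamma_psi z)) * (2 * norm z / (V\<^sup>2 - (norm z)\<^sup>2)))"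
  have edge: "norm (P v - P u) \<le> B V * (2 * V)"
    if V: "V > norm z" and uv: "norm (v - u) \<le> 2 * V"
      and seg: "\<And>w. w \<in> closed_segment u v \<Longrightarrow> Re w \<ge> 0 \<and> V \<le> norm w \<and> norm w \<le> 2 * V" for u v V
  proof -
    have V0: "V > 0" using V norm_ge_zero[of z] by linarith
    have Vz: "V\<^sup>2 - (norm z)\<^sup>2 > 0" using V by (simp add: power_strict_mono)
    have "norm (P v - P u) \<le> B V * norm (v - u)"
    proof (rule field_differentiable_bound[where S = "closed_segment u v" and f' = Q])
      fix w assume w: "w \<in> closed_segment u v"
      then have wS: "w \<in> S" using seg[OF w] d by (simp add: S_def)
      show "(P has_field_derivative Q w) (at w within closed_segment u v)"
        by (rule has_field_derivative_at_within[OF P[OF wS]])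
      have wz: "w \<noteq> z" using seg[OF w] V by auto
      have n1: "norm (gamma_psi w - gamma_psi z) \<le> 33 * ln (3 + 2 * V) + norm (gamma_psi z)"
      proof -
        have "norm (gamma_psi w - gamma_psi z) \<le> norm (gamma_psi w) + norm (gamma_psi z)" by (rule norm_triangle_ineq4)
        also have "norm (gamma_psi w) \<le> 33 * ln (3 + norm w)" using seg[OF w] by (intro norm_gamma_psi_le) auto
        also have "ln (3 + norm w) \<le> ln (3 + 2 * V)" using seg[OF w] by (subst ln_le_cancel_iff) (auto intro: add_pos_nonneg)
        finally show ?thesis by simp
      qed
      have ne: "z - w \<noteq> 0" "z + w \<noteq> 0" using wz zp[OF wS] by auto
      have "1 / (z - w) + 1 / (z + w) = 2 * z / (z\<^sup>2 - w\<^sup>2)"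
      proof -
        have "z\<^sup>2 - w\<^sup>2 = (z - w) * (z + w)" by (simp add: power2_eq_square algebra_simps)
        then show ?thesis using ne by (subst add_frac_eq) auto
      qed
      moreover have "V\<^sup>2 - (norm z)\<^sup>2 \<le> norm (z\<^sup>2 - w\<^sup>2)"
      proof -
        have "V\<^sup>2 \<le> (norm w)\<^sup>2" using seg[OF w] V0 by (intro power_mono) auto
        then show ?thesis using norm_triangle_ineq2[of "w\<^sup>2" "z\<^sup>2"] by (simp add: norm_power norm_minus_commute)
      qed
      ultimately have n2: "norm (1 / (z - w) + 1 / (z + w)) \<le> 2 * norm z / (V\<^sup>2 - (norm z)\<^sup>2)"
        using Vz by (simp add: norm_divide norm_mult frac_le)
      show "norm (Q w) \<le> B V" unfolding Q[OF wS wz] norm_mult B_def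
        using n1 n2 V0 by (intro mult_mono) auto
    qed auto
    also have "\<dots> \<le> B V * (2 * V)" using uv V Vz V0 by (intro mult_left_mono) (auto simp: B_def intro!: divide_nonneg_nonneg mult_nonneg_nonneg add_nonneg_nonneg)
    finally show ?thesis .
  qed
  \<comment> \<open>On the three sides one coordinate has modulus \<open>V\<close>, so
    \<open>norm w\<close> lies between \<open>V\<close> and \<open>2 * V\<close>.\<close>
  have segs: "Re w \<ge> 0 \<and> V \<le> norm w \<and> norm w \<le> 2 * V"
    if V: "V > 0" and w: "w \<in> closed_segment (Complex a b) (Complex a' b')"
      and r: "0 \<le> a" "a \<le> V" "0 \<le> a'" "a' \<le> V" "\<bar>b\<bar> \<le> V" "\<bar>b'\<bar> \<le> V"
      and e: "(a = V \<and> a' = V) \<or> (b = V \<and> b' = V) \<or> (b = - V \<and> b' = - V)" for w V a b a' b'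
  proof -
    from w obtain u where u: "0 \<le> u" "u \<le> 1" "w = (1 - u) *\<^sub>R Complex a b + u *\<^sub>R Complex a' b'"
      by (auto simp: in_segment)
    have Rew: "Re w = (1 - u) * a + u * a'" and Imw: "Im w = (1 - u) * b + u * b'" using u by auto
    have cvx: "(1 - u) * x + u * y \<le> V" if "x \<le> V" "y \<le> V" for x y
      using convex_bound_le[OF that, of "1 - u" u] u by simp
    have R1: "Re w \<ge> 0" unfolding Rew using u r by (intro add_nonneg_nonneg mult_nonneg_nonneg) auto
    have R2: "Re w \<le> V" unfolding Rew using r by (intro cvx) auto
    have I1: "Im w \<le> V" unfolding Imw using r by (intro cvx) auto
    have "- Im w \<le> V" using cvx[of "- b" "- b'"] r unfolding Imw by (simp add: algebra_simps)
    then have I2: "\<bar>Im w\<bar> \<le> V" using I1 by linarith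
    have "norm w \<le> 2 * V" using cmod_le[of w] R1 R2 I2 by linarith
    moreover have "V \<le> norm w"
    proof -
      have "Re w = V \<or> Im w = V \<or> Im w = - V" using e unfolding Rew Imw by (auto simp: algebra_simps)
      then show ?thesis using abs_Re_le_cmod[of w] abs_Im_le_cmod[of w] V by auto
    qed
    ultimately show ?thesis using R1 by simp
  qed
  have bound: "norm (P (\<i> * of_real V) - P (- (\<i> * of_real V))) \<le> 6 * V * B V" if V: "V > norm z" for V
  proof -
    have V0: "V > 0" using V norm_ge_zero[of z] by linarith
    have e: "\<i> * of_real V = Complex 0 V" "- (\<i> * of_real V) = Complex 0 (-V)" by (auto simp: complex_eq_iff)
    have 1: "norm (P (Complex 0 V) - P (Complex V V)) \<le> B V * (2 * V)"
    proof (rule edge[OF V])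
      show "norm (Complex 0 V - Complex V V) \<le> 2 * V" using V0 by (simp add: cmod_def)
      show "Re w \<ge> 0 \<and> V \<le> norm w \<and> norm w \<le> 2 * V"
        if "w \<in> closed_segment (Complex V V) (Complex 0 V)" for w
        using segs[OF V0 that] V0 by simp
    qed
    have 2: "norm (P (Complex V V) - P (Complex V (-V))) \<le> B V * (2 * V)"
    proof (rule edge[OF V])
      show "norm (Complex V V - Complex V (-V)) \<le> 2 * V" using V0 cmod_le[of "Complex V V - Complex V (-V)"] by simp
      show "Re w \<ge> 0 \<and> V \<le> norm w \<and> norm w \<le> 2 * V"
        if "w \<in> closed_segment (Complex V (-V)) (Complex V V)" for w
        using segs[OF V0 that] V0 by simp
    qed
    have 3: "norm (P (Complex V (-V)) - P (Complex 0 (-V))) \<le> B V * (2 * V)"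
    proof (rule edge[OF V])
      show "norm (Complex V (-V) - Complex 0 (-V)) \<le> 2 * V" using V0 by (simp add: cmod_def)
      show "Re w \<ge> 0 \<and> V \<le> norm w \<and> norm w \<le> 2 * V"
        if "w \<in> closed_segment (Complex 0 (-V)) (Complex V (-V))" for w
        using segs[OF V0 that] V0 by simp
    qed
    have "P (Complex 0 V) - P (Complex 0 (-V)) = (P (Complex 0 V) - P (Complex V V)) +
       (P (Complex V V) - P (Complex V (-V))) + (P (Complex V (-V)) - P (Complex 0 (-V)))" by simp
    also have "norm \<dots> \<le> B V * (2 * V) + B V * (2 * V) + B V * (2 * V)"
      by (intro order.trans[OF norm_triangle_ineq] add_mono 1 2 3)
    finally show ?thesis unfolding e(2) unfolding e(1) by (simp add: algebra_simps)
  qed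
  have lim: "((\<lambda>V. 6 * V * B V) \<longlongrightarrow> 0) at_top"
  proof -
    define c where "c = norm z"
    define g where "g = norm (gamma_psi z)"
    have "((\<lambda>V. 6 * V * ((33 * ln (3 + 2 * V) + g) * (2 * c / (V\<^sup>2 - c\<^sup>2)))) \<longlongrightarrow> 0) at_top"
      by real_asymp
    then show ?thesis unfolding B_def c_def g_def .
  qed
  show ?thesis
  proof (rule Lim_null_comparison[OF _ lim])
    show "\<forall>\<^sub>F V in at_top. norm (integral {-V..V} (\<lambda>\<xi>. (gamma_psi (\<i> * of_real \<xi>) - gamma_psi z) *
            (1 / (z - \<i> * of_real \<xi>) + 1 / (z + \<i> * of_real \<xi>)))) \<le> 6 * V * B V"
      using eventually_gt_at_top[of "norm z"]
    proof eventually_elim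
      case (elim V)
      then have "V > 0" using norm_ge_zero[of z] by linarith
      then show ?case using bound[OF elim] by (simp only: int norm_divide norm_ii div_by_1)
    qed
  qed
qed

text \<open>\<open>Omega\<close> averages \<open>gamma_psi\<close> over two signs; reflecting one
  half turns the single Cauchy kernel into the even sum of two, to which the preceding limits apply.
  The final factor is \<open>2 * pi / (4 * pi)\<close>.\<close>

lemma Omega_cauchy_tendsto:
  assumes z: "Re z > 0"
  shows "((\<lambda>V. integral {-V..V} (\<lambda>\<xi>. of_real (Omega \<xi> / (2 * pi)) / (z - \<i> * of_real \<xi>))) \<longlongrightarrow> gamma_psi z / 2) at_top"
proof -
  let ?k = "\<lambda>\<xi>::real. 1 / (z - \<i> * of_real \<xi>) + 1 / (z + \<i> * of_real \<xi>)"
  let ?p = "\<lambda>\<xi>::real. gamma_psi (\<i> * of_real \<xi>)"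
  have nz: "z - \<i> * of_real \<xi> \<noteq> 0" "z + \<i> * of_real \<xi> \<noteq> 0" for \<xi> :: real
    using z by (auto simp: complex_eq_iff)
  note cp = continuous_on_subset[OF continuous_gamma_psi_i subset_UNIV]
  have c1: "continuous_on A (\<lambda>\<xi>::real. 1 / (z - \<i> * of_real \<xi>))"
     and c2: "continuous_on A (\<lambda>\<xi>::real. 1 / (z + \<i> * of_real \<xi>))" for A
    by (intro continuous_intros; use nz in auto)+
  have eq: "integral {-V..V} (\<lambda>\<xi>. of_real (Omega \<xi> / (2 * pi)) / (z - \<i> * of_real \<xi>))
      = (integral {-V..V} (\<lambda>\<xi>. (?p \<xi> - gamma_psi z) * ?k \<xi>) + gamma_psi z * integral {-V..V} ?k) / of_real (4 * pi)"
    if V: "V > 0" for V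
  proof -
    have cn: "continuous_on {-V..V} (\<lambda>\<xi>. gamma_psi (- (\<i> * of_real \<xi>)))"
      using continuous_on_compose2[OF continuous_gamma_psi_i, of "{-V..V}" uminus] continuous_on_minus[OF continuous_on_id, of "{-V..V}"] by simp
    have "integral {-V..V} (\<lambda>\<xi>. of_real (Omega \<xi> / (2 * pi)) / (z - \<i> * of_real \<xi>))
      = integral {-V..V} (\<lambda>\<xi>. (?p \<xi> * (1 / (z - \<i> * of_real \<xi>)) + gamma_psi (- (\<i> * of_real \<xi>)) * (1 / (z - \<i> * of_real \<xi>))) / of_real (4 * pi))"
      by (intro integral_cong) (simp add: Omega_eq add_divide_distrib mult_ac)
    also have "\<dots> = (integral {-V..V} (\<lambda>\<xi>. ?p \<xi> * (1 / (z - \<i> * of_real \<xi>)))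
         + integral {-V..V} (\<lambda>\<xi>. gamma_psi (- (\<i> * of_real \<xi>)) * (1 / (z - \<i> * of_real \<xi>)))) / of_real (4 * pi)"
      unfolding integral_divide
      by (subst integral_add) (intro integrable_continuous_real continuous_on_mult cp c1 cn refl)+
    also have "integral {-V..V} (\<lambda>\<xi>. gamma_psi (- (\<i> * of_real \<xi>)) * (1 / (z - \<i> * of_real \<xi>)))
       = integral {-V..V} (\<lambda>\<xi>. ?p \<xi> * (1 / (z + \<i> * of_real \<xi>)))"
      using Henstock_Kurzweil_Integration.integral_reflect_real[of V "-V" "\<lambda>\<xi>. ?p \<xi> * (1 / (z + \<i> * of_real \<xi>))"] by simp
    also have "integral {-V..V} (\<lambda>\<xi>. ?p \<xi> * (1 / (z - \<i> * of_real \<xi>))) + \<dots> = integral {-V..V} (\<lambda>\<xi>. ?p \<xi> * ?k \<xi>)"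
      unfolding distrib_left by (rule integral_add[symmetric]) (intro integrable_continuous_real continuous_on_mult cp c1 c2)+
    also have "\<dots> = integral {-V..V} (\<lambda>\<xi>. (?p \<xi> - gamma_psi z) * ?k \<xi> + gamma_psi z * ?k \<xi>)"
      by (simp only: left_diff_distrib diff_add_cancel)
    also have "\<dots> = integral {-V..V} (\<lambda>\<xi>. (?p \<xi> - gamma_psi z) * ?k \<xi>) + integral {-V..V} (\<lambda>\<xi>. gamma_psi z * ?k \<xi>)"
      by (rule integral_add) (intro integrable_continuous_real continuous_on_mult continuous_on_diff continuous_on_const continuous_on_add cp c1 c2)+
    also have "integral {-V..V} (\<lambda>\<xi>. gamma_psi z * ?k \<xi>) = gamma_psi z * integral {-V..V} ?k"
      by (rule integral_mult_right)
    finally show ?thesis .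
  qed
  have "((\<lambda>V. (integral {-V..V} (\<lambda>\<xi>. (?p \<xi> - gamma_psi z) * ?k \<xi>) + gamma_psi z * integral {-V..V} ?k) / of_real (4 * pi))
       \<longlongrightarrow> (0 + gamma_psi z * of_real (2 * pi)) / of_real (4 * pi)) at_top"
    by (intro tendsto_divide tendsto_add tendsto_mult tendsto_const gamma_psi_remainder_tendsto[OF z] cauchy_kernel_integral_tendsto[OF z]) auto
  moreover have "(0 + gamma_psi z * of_real (2 * pi)) / of_real (4 * pi) = gamma_psi z / 2" by simp
  ultimately have "((\<lambda>V. (integral {-V..V} (\<lambda>\<xi>. (?p \<xi> - gamma_psi z) * ?k \<xi>) + gamma_psi z * integral {-V..V} ?k) / of_real (4 * pi))
       \<longlongrightarrow> gamma_psi z / 2) at_top" by metis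
  then show ?thesis
    by (rule Lim_transform_eventually)
       (use eventually_gt_at_top[of 0] in \<open>eventually_elim, simp only: eq\<close>)
qed

section \<open>Zeta and its zeros\<close>

definition xi_half :: "complex \<Rightarrow> complex" where "xi_half z = xi (1 / 2 + z)"

text \<open>The quotient \<open>zeta / xi\<close>. The reciprocal Gamma function is entire, and
  taking it at \<open>s / 2 + 1\<close> absorbs the factor \<open>s\<close>, so that 1 is the only
  singularity.\<close>

definition zeta_factor :: "complex \<Rightarrow> complex" where
  "zeta_factor s = exp (s / 2 * of_real (ln pi)) * rGamma (s / 2 + 1) / (s - 1)"

lemma holomorphic_zeta_factor: "zeta_factor holomorphic_on - {1}"
proof -
  have "(\<lambda>s. rGamma (s / 2 + 1)) holomorphic_on A" for A :: "complex set"
    by (rule holomorphic_on_compose_gen[OF _ holomorphic_rGamma, unfolded o_def, of _ _ UNIV])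
       (auto intro!: holomorphic_intros)
  then show ?thesis unfolding zeta_factor_def by (intro holomorphic_intros) auto
qed

lemma not_nonpos_Int_if_Re_pos: "Re z > 0 \<Longrightarrow> z \<notin> \<int>\<^sub>\<le>\<^sub>0"
  by (auto elim!: nonpos_Ints_cases)

lemma zeta_factor_nonzero: "Re s > 0 \<Longrightarrow> s \<noteq> 1 \<Longrightarrow> zeta_factor s \<noteq> 0"
  using not_nonpos_Int_if_Re_pos[of "s / 2 + 1"] by (simp add: zeta_factor_def rGamma_eq_zero_iff)

lemma xi_eq_Dirichlet_series':
  assumes s: "Re s > 1"
  shows "xi s = (s - 1) * exp (- (s / 2) * of_real (ln pi)) * Gamma (s / 2 + 1) * (\<Sum>n. 1 / of_nat (Suc n) powr s)"
proof -
  have "Gamma (s / 2 + 1) = s / 2 * Gamma (s / 2)"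
    using s not_nonpos_Int_if_Re_pos[of "s / 2"] by (intro Gamma_plus1) auto
  then show ?thesis unfolding xi_eq_Dirichlet_series[OF s] by simp
qed

lemma xi_zeta_factor:
  assumes s: "Re s > 1"
  shows "xi s * zeta_factor s = (\<Sum>n. 1 / of_nat (Suc n) powr s)"
proof -
  define Z where "Z = (\<Sum>n. 1 / of_nat (Suc n) powr s)"
  define e where "e = exp (s / 2 * of_real (ln pi))"
  have g: "Gamma (s / 2 + 1) * rGamma (s / 2 + 1) = 1"
    using s not_nonpos_Int_if_Re_pos[of "s / 2 + 1"] by (simp add: rGamma_inverse_Gamma Gamma_eq_zero_iff)
  have e: "exp (- (s / 2) * of_real (ln pi)) * e = 1" by (simp add: e_def flip: exp_add)
  have s1: "s - 1 \<noteq> 0" using s by auto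
  have "xi s * zeta_factor s = ((s - 1) / (s - 1)) * (exp (- (s / 2) * of_real (ln pi)) * e) * (Gamma (s / 2 + 1) * rGamma (s / 2 + 1)) * Z"
    unfolding xi_eq_Dirichlet_series'[OF s] zeta_factor_def Z_def[symmetric] e_def[symmetric] by simp
  then show ?thesis using s1 by (simp only: g e Z_def) simp
qed

text \<open>The choice operator yields these properties once some function has them;
  \<open>xi s * zeta_factor s\<close> is the witness.\<close>

lemma zeta_spec: "zeta holomorphic_on - {1}" "Re s > 1 \<Longrightarrow> zeta s = (\<Sum>n. 1 / of_nat (Suc n) powr s)"
proof -
  have "(\<lambda>s. xi s * zeta_factor s) holomorphic_on - {1} \<and>
      (\<forall>s. Re s > 1 \<longrightarrow> xi s * zeta_factor s = (\<Sum>n. 1 / of_nat (Suc n) powr s))"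
    using xi_zeta_factor by (auto intro!: holomorphic_intros holomorphic_zeta_factor holomorphic_on_subset[OF holomorphic_xi])
  then have "\<exists>f. f holomorphic_on - {1} \<and> (\<forall>s. Re s > 1 \<longrightarrow> f s = (\<Sum>n. 1 / of_nat (Suc n) powr s))"
    by blast
  from someI_ex[OF this, folded zeta_def]
  show "zeta holomorphic_on - {1}" "Re s > 1 \<Longrightarrow> zeta s = (\<Sum>n. 1 / of_nat (Suc n) powr s)" by auto
qed

lemma zeta_eq: "s \<noteq> 1 \<Longrightarrow> zeta s = xi s * zeta_factor s"
proof (rule analytic_continuation_open[of "{s. Re s > 1}" "- {1}" zeta "\<lambda>s. xi s * zeta_factor s"])
  show "open {s. Re s > 1}" by (rule open_halfspace_Re_gt)
  have "(2::complex) \<in> {s. Re s > 1}" by simp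
  then show "{s::complex. Re s > 1} \<noteq> {}" by blast
  show "connected (- {1::complex})" by (rule connected_punctured_universe) simp
  show "(\<lambda>s. xi s * zeta_factor s) holomorphic_on - {1}"
    by (intro holomorphic_intros holomorphic_zeta_factor holomorphic_on_subset[OF holomorphic_xi]) auto
qed (use zeta_spec xi_zeta_factor in auto)

lemma xi_half_even: "xi_half (- z) = xi_half z"
  using xi_reflect[of "1 / 2 + z"] by (simp add: xi_half_def)

text \<open>The hypothesis is applied for \<open>Re z > 0\<close>, where no trivial zero occurs and
  the point 1 is excluded by \<open>xi 1 = 1 / 2\<close>; zeros to the left are reflected by
  evenness.\<close>

lemma xi_half_zero_imp:
  assumes RH: Riemann_hypothesis and z: "xi_half z = 0"
  shows "Re z = 0"
proof -
  have *: "\<not> Re z > 0" if "xi_half z = 0" for z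
  proof
    assume pos: "Re z > 0"
    define s where "s = 1 / 2 + z"
    have s1: "s \<noteq> 1" using that xi_1 by (auto simp: s_def xi_half_def)
    have "zeta s = 0" using zeta_eq[OF s1] that by (simp add: xi_half_def s_def)
    moreover have "\<not> (\<exists>n::nat. n \<ge> 1 \<and> s = - 2 * of_nat n)"
    proof
      assume "\<exists>n::nat. n \<ge> 1 \<and> s = - 2 * of_nat n"
      then obtain n :: nat where "s = - 2 * of_nat n" by blast
      then have "Re s = - 2 * real n" by simp
      with pos show False by (simp add: s_def)
    qed
    ultimately have "nontrivial_zeta_zero s" using s1 by (simp add: nontrivial_zeta_zero_def)
    then have "Re s = 1 / 2" using RH by (simp add: Riemann_hypothesis_def)
    with pos show False by (simp add: s_def)
  qed
  show ?thesis using *[OF z] *[of "- z"] z by (simp add: xi_half_even)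
qed

locale rh_xi = even_entire_imaginary_zeros xi_half A for A

lemma rh_xi_exists:
  assumes RH: Riemann_hypothesis shows "\<exists>A. rh_xi A"
proof -
  obtain B where B: "\<And>s. norm (xi s) \<le> exp (B * (1 + norm s) powr (3/2))" using xi_growth by blast
  define A where "A = \<bar>B\<bar> * 2 powr (3/2)"
  have "rh_xi A"
  proof
    show "xi_half holomorphic_on UNIV"
      unfolding xi_half_def
      by (rule holomorphic_on_compose_gen[OF _ holomorphic_xi, unfolded o_def]) (auto intro!: holomorphic_intros)
    fix z :: complex
    show "xi_half (- z) = xi_half z" by (rule xi_half_even)
    show "Re z = 0" if "xi_half z = 0" using xi_half_zero_imp[OF RH that] .
    have n: "1 + norm (1 / 2 + z) \<le> 2 * (1 + norm z)"
    proof -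
      have "norm (1 / 2 + z) \<le> 1 / 2 + norm z" using norm_triangle_ineq[of "1/2" z] by simp
      then have "1 + norm (1 / 2 + z) \<le> 1 + (1 / 2 + norm z)" by (rule add_left_mono)
      also have "\<dots> \<le> 2 * (1 + norm z)" using norm_ge_zero[of z] by simp
      finally show ?thesis .
    qed
    have "norm (xi_half z) \<le> exp (B * (1 + norm (1 / 2 + z)) powr (3/2))" unfolding xi_half_def by (rule B)
    also have "B * (1 + norm (1 / 2 + z)) powr (3/2) \<le> \<bar>B\<bar> * (1 + norm (1 / 2 + z)) powr (3/2)"
      by (intro mult_right_mono) auto
    also have "\<dots> \<le> \<bar>B\<bar> * (2 * (1 + norm z)) powr (3/2)"
      using n by (intro mult_left_mono powr_mono2) auto
    also have "\<dots> = A * (1 + norm z) powr (3/2)" by (simp add: A_def powr_mult del: distrib_left_numeral)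
    finally show "norm (xi_half z) \<le> exp (A * (1 + norm z) powr (3/2))" by simp
  qed
  then show ?thesis by blast
qed

section \<open>The pairing as a value of the logarithmic derivative\<close>

context rh_xi
begin

lemma critical_zero_iff:
  "nontrivial_zeta_zero (Complex (1 / 2) \<gamma>) \<longleftrightarrow> xi_half (\<i> * of_real \<gamma>) = 0"
proof -
  define s where "s = Complex (1 / 2) \<gamma>"
  have s: "s \<noteq> 1" "Re s = 1 / 2" "s = 1 / 2 + \<i> * of_real \<gamma>" by (auto simp: s_def complex_eq_iff)
  have "\<not> (\<exists>n::nat. n \<ge> 1 \<and> s = - 2 * of_nat n)"
  proof
    assume "\<exists>n::nat. n \<ge> 1 \<and> s = - 2 * of_nat n"
    then obtain n :: nat where "s = - 2 * of_nat n" by blast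
    then have "Re s = - 2 * real n" by simp
    with s show False by simp
  qed
  then show ?thesis unfolding s_def[symmetric] nontrivial_zeta_zero_def
    using zeta_eq[OF s(1)] zeta_factor_nonzero[of s] s by (simp add: xi_half_def)
qed

lemma zorder_zeta_eq: "zorder zeta (Complex (1 / 2) \<gamma>) = zorder xi_half (\<i> * of_real \<gamma>)"
proof -
  define s where "s = Complex (1 / 2) \<gamma>"
  define \<rho> where "\<rho> = \<i> * complex_of_real \<gamma>"
  have s: "s \<noteq> 1" "Re s = 1 / 2" "s = 1 / 2 + \<rho>" by (auto simp: s_def \<rho>_def complex_eq_iff)
  obtain k where k: "k holomorphic_on UNIV" "\<And>z. xi_half z = k z * (z - \<rho>) ^ nat (zorder xi_half \<rho>)" "k \<rho> \<noteq> 0"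
    using entire_factor_point[OF holf nonzero[of 1]] by auto
  have "zorder zeta s = int (nat (zorder xi_half \<rho>))"
  proof (rule zorder_eqI[of "- {1}" s "\<lambda>w. k (w - 1 / 2) * zeta_factor w"])
    show "(\<lambda>w. k (w - 1 / 2) * zeta_factor w) holomorphic_on - {1}"
      by (intro holomorphic_intros holomorphic_zeta_factor holomorphic_on_compose_gen[OF _ k(1), unfolded o_def]) auto
    show "k (s - 1 / 2) * zeta_factor s \<noteq> 0" using k(3) zeta_factor_nonzero[of s] s by simp
    fix w :: complex assume "w \<in> - {1}" "w \<noteq> s"
    then have "zeta w = xi_half (w - 1 / 2) * zeta_factor w" by (subst zeta_eq) (auto simp: xi_half_def)
    also have "\<dots> = k (w - 1 / 2) * (w - s) ^ nat (zorder xi_half \<rho>) * zeta_factor w"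
      unfolding k(2)[of "w - 1 / 2"] s(3) by (simp add: algebra_simps)
    finally show "zeta w = k (w - 1 / 2) * zeta_factor w * (w - s) powi int (nat (zorder xi_half \<rho>))"
      by (simp add: mult_ac del: int_nat_eq)
  qed (use s in auto)
  then show ?thesis using zorder_nonneg[of \<rho>] by (simp add: s_def \<rho>_def)
qed

text \<open>Up to scaling \<open>J\<close> is the conjugate Poisson kernel of height
  \<open>1 / L\<close>, which explains the imaginary part.\<close>

lemma J_eq:
  assumes L: "L > 0"
  shows "J (L / (2 * pi) * (\<gamma> - t)) = 1 / L * Im (1 / (Complex (1 / L) t - \<i> * of_real \<gamma>))"
proof -
  have "Complex (1 / L) t - \<i> * of_real \<gamma> = Complex (1 / L) (t - \<gamma>)" by (simp add: complex_eq_iff)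
  moreover have "1 / L * Im (1 / Complex (1 / L) (t - \<gamma>)) = L * (\<gamma> - t) / (1 + (L * (\<gamma> - t))\<^sup>2)"
  proof -
    have 1: "(1 / L)\<^sup>2 + (t - \<gamma>)\<^sup>2 = (1 + (L * (\<gamma> - t))\<^sup>2) / L\<^sup>2"
      using L by (simp add: field_simps power2_eq_square)
    have 2: "Im (1 / Complex (1 / L) (t - \<gamma>)) = (\<gamma> - t) / ((1 / L)\<^sup>2 + (t - \<gamma>)\<^sup>2)"
      by (simp add: Im_divide)
    show ?thesis unfolding 2 unfolding 1 using L by (simp add: power2_eq_square)
  qed
  ultimately show ?thesis by (simp add: J_def)
qed

lemma Im_of_real_divide: "Im (of_real r / w) = r * Im (1 / w)"
  by (simp add: Im_divide)

lemma Im_of_int_divide: "Im (of_int k / w) = of_int k * Im (1 / w)"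
  using Im_of_real_divide[of "of_int k" w] by simp

text \<open>The sum over zeros and the integral of \<open>Omega\<close> converge separately under
  the symmetric cutoff, so the \<open>Lim\<close> in \<open>zeta_pairing\<close> is a difference of
  two known limits.\<close>

lemma zeta_pairing_eq:
  assumes T: "T > 1"
  shows "zeta_pairing J T t = 1 / ln T * Im (ldf (Complex (1 / ln T) t) - gamma_psi (Complex (1 / ln T) t) / 2)"
proof -
  define L where "L = ln T"
  define z where "z = Complex (1 / L) t"
  have L: "L > 0" using T by (simp add: L_def)
  have z: "Re z > 0" using L by (simp add: z_def)
  have sum: "(\<Sum>\<gamma> | \<bar>\<gamma>\<bar> < V \<and> nontrivial_zeta_zero (Complex (1 / 2) \<gamma>).
          of_int (zorder zeta (Complex (1 / 2) \<gamma>)) * J (L / (2 * pi) * (\<gamma> - t))) = 1 / L * Im (zero_sum V z)" for V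
    unfolding critical_zero_iff zorder_zeta_eq J_eq[OF L] z_def[symmetric] zero_sum_def Im_sum sum_distrib_left
    by (intro sum.cong refl) (simp only: Im_of_int_divide mult.left_commute)
  have int: "integral {-V..V} (\<lambda>\<xi>. J (L / (2 * pi) * (\<xi> - t)) * (Omega \<xi> / (2 * pi)))
      = 1 / L * Im (integral {-V..V} (\<lambda>\<xi>. of_real (Omega \<xi> / (2 * pi)) / (z - \<i> * of_real \<xi>)))" for V
  proof -
    have nz: "z - \<i> * of_real \<xi> \<noteq> 0" for \<xi> :: real using z by (auto simp: complex_eq_iff)
    have "continuous_on UNIV (\<lambda>\<xi>. (gamma_psi (\<i> * of_real \<xi>) + gamma_psi (\<i> * of_real (- \<xi>))) / 2)"
      by (intro continuous_intros continuous_gamma_psi_i continuous_on_compose2[OF continuous_gamma_psi_i]) auto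
    then have cO: "continuous_on UNIV (\<lambda>\<xi>. complex_of_real (Omega \<xi>))" by (simp add: Omega_eq)
    have "continuous_on {-V..V} (\<lambda>\<xi>. of_real (Omega \<xi>) / of_real (2 * pi) / (z - \<i> * of_real \<xi>))"
      using nz by (intro continuous_intros continuous_on_subset[OF cO]) auto
    then have "(\<lambda>\<xi>. of_real (Omega \<xi> / (2 * pi)) / (z - \<i> * of_real \<xi>)) integrable_on {-V..V}"
      by (intro integrable_continuous_real) simp
    from integral_linear[OF this bounded_linear_Im]
    have "Im (integral {-V..V} (\<lambda>\<xi>. of_real (Omega \<xi> / (2 * pi)) / (z - \<i> * of_real \<xi>)))
        = integral {-V..V} (\<lambda>\<xi>. Im (of_real (Omega \<xi> / (2 * pi)) / (z - \<i> * of_real \<xi>)))"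
      by (simp add: o_def)
    also have "1 / L * \<dots> = integral {-V..V} (\<lambda>\<xi>. 1 / L * Im (of_real (Omega \<xi> / (2 * pi)) / (z - \<i> * of_real \<xi>)))"
      by (rule integral_mult_right[symmetric])
    also have "\<dots> = integral {-V..V} (\<lambda>\<xi>. J (L / (2 * pi) * (\<xi> - t)) * (Omega \<xi> / (2 * pi)))"
      unfolding J_eq[OF L] z_def[symmetric] by (intro integral_cong) (simp only: Im_of_real_divide mult_ac)
    finally show ?thesis by simp
  qed
  have "((\<lambda>V. 1 / L * Im (zero_sum V z) - 1 / L * Im (integral {-V..V} (\<lambda>\<xi>. of_real (Omega \<xi> / (2 * pi)) / (z - \<i> * of_real \<xi>))))
      \<longlongrightarrow> 1 / L * Im (ldf z) - 1 / L * Im (gamma_psi z / 2)) at_top"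
    by (intro tendsto_diff tendsto_mult tendsto_const tendsto_Im zero_sum_tendsto Omega_cauchy_tendsto z)
  from tendsto_Lim[OF trivial_limit_at_top_linorder this]
  show ?thesis unfolding zeta_pairing_def L_def[symmetric] sum int z_def[symmetric] by (simp add: right_diff_distrib)
qed

end

section \<open>The von Mangoldt series\<close>

text \<open>The power \<open>n^(-s)\<close>; the value 0 at \<open>n = 0\<close> makes
  \<open>npow_mult\<close> hold for all natural numbers and lets series start at 0.\<close>

definition npow :: "complex \<Rightarrow> nat \<Rightarrow> complex" where
  "npow s n = (if n = 0 then 0 else exp (- s * of_real (ln (real n))))"

lemma norm_npow: "n > 0 \<Longrightarrow> norm (npow s n) = real n powr (- Re s)"
  by (simp add: npow_def powr_def)

lemma npow_mult: "npow s (m * n) = npow s m * npow s n"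
  by (auto simp: npow_def ln_mult distrib_left simp flip: exp_add)

lemma ln_le_powr: "x \<ge> 1 \<Longrightarrow> ln x \<le> 4 * x powr (1/4)" for x :: real
  using ln_powr[of x "1/4"] ln_le_minus_one[of "x powr (1/4)"] by simp

lemma norm_ln_npow_le:
  assumes "Re s \<ge> 3 / 2" shows "norm (of_real (ln (real n)) * npow s n) \<le> 4 * real n powr (- (5/4))"
proof (cases "n = 0")
  case False
  then have n: "real n \<ge> 1" by simp
  have "norm (of_real (ln (real n)) * npow s n) = ln (real n) * real n powr (- Re s)"
    using n False by (simp add: norm_mult norm_npow)
  also have "\<dots> \<le> 4 * real n powr (1/4) * real n powr (- (3/2))"
    using n assms by (intro mult_mono ln_le_powr powr_mono) auto
  also have "\<dots> = 4 * real n powr (- (5/4))" by (simp flip: powr_add)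
  finally show ?thesis .
qed (simp add: npow_def)

lemma summable_npow_bound: "summable (\<lambda>n. 4 * real n powr (- (5/4)))"
  by (intro summable_mult) (simp add: summable_real_powr_iff)

lemma summable_norm_npow:
  assumes "Re s \<ge> 3 / 2" shows "summable (\<lambda>n. norm (npow s n))"
proof (rule summable_comparison_test'[OF summable_npow_bound])
  fix n :: nat
  show "norm (norm (npow s n)) \<le> 4 * real n powr (- (5/4))"
  proof (cases "n = 0")
    case False
    then have "norm (npow s n) \<le> 1 * real n powr (- (5/4))"
      using assms powr_mono[of "- Re s" "- (5/4)" "real n"] by (simp add: norm_npow)
    also have "\<dots> \<le> 4 * real n powr (- (5/4))" by (intro mult_right_mono) auto
    finally show ?thesis by simp
  qed (simp add: npow_def)
qed

lemma summable_norm_ln_npow: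
  assumes "Re s \<ge> 3 / 2" shows "summable (\<lambda>n. norm (of_real (ln (real n)) * npow s n))"
  using norm_ln_npow_le[OF assms] by (intro summable_comparison_test'[OF summable_npow_bound]) auto

lemma mangoldt_le_ln: "mangoldt n \<le> ln (real n)"
proof (cases "n = 0")
  case False
  have "(mangoldt n :: real) = (\<Sum>d\<in>{n}. mangoldt d)" by simp
  also have "\<dots> \<le> (\<Sum>d | d dvd n. mangoldt d)"
    using False by (intro sum_mono2) (auto simp: mangoldt_nonneg)
  also have "\<dots> = ln (real n)" using mangoldt_sum[of n, where 'a = real] False by simp
  finally show ?thesis .
qed simp

lemma summable_norm_mangoldt_npow:
  assumes "Re s \<ge> 3 / 2" shows "summable (\<lambda>n. norm (mangoldt n * npow s n))"
proof (rule summable_comparison_test'[OF summable_norm_ln_npow[OF assms]])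
  fix n :: nat
  show "norm (norm (mangoldt n * npow s n)) \<le> norm (of_real (ln (real n)) * npow s n)"
    using mangoldt_le_ln[of n] mangoldt_nonneg[of n] by (simp add: norm_mult mult_right_mono)
qed

text \<open>The convolution identity behind \<open>mangoldt_sum\<close> becomes a product of series
  by rearranging an absolutely convergent double sum along \<open>n = d * m\<close>.\<close>

lemma mangoldt_dirichlet_product:
  assumes s: "Re s \<ge> 3 / 2"
  shows "(\<Sum>n. mangoldt n * npow s n) * (\<Sum>n. npow s n) = (\<Sum>n. of_real (ln (real n)) * npow s n)"
proof -
  define f where "f = (\<lambda>n. mangoldt n * npow s n)"
  define g where "g = npow s"
  have f: "summable (\<lambda>n. norm (f n))" "summable (\<lambda>n. norm (g n))"
    using summable_norm_mangoldt_npow[OF s] summable_norm_npow[OF s] by (simp_all add: f_def g_def)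
  have hf: "(f has_sum suminf f) UNIV" and hg: "(g has_sum suminf g) UNIV"
    using f by (auto intro!: norm_summable_imp_has_sum summable_sums summable_norm_cancel)
  have af: "(\<lambda>n. norm (f n)) summable_on UNIV" "(\<lambda>n. norm (g n)) summable_on UNIV"
    using f by (auto intro!: norm_summable_imp_summable_on)
  define F where "F = (\<lambda>(d, m). f d * g m)"
  have "(\<lambda>x. norm (F x)) summable_on (UNIV \<times> UNIV)"
    unfolding Infinite_Sum.abs_summable_on_Sigma_iff
    using af by (auto simp: F_def norm_mult infsum_cmult_right' abs_mult infsum_nonneg intro!: summable_on_cmult_right summable_on_cmult_left)
  then have "F summable_on (UNIV \<times> UNIV)" by (rule abs_summable_summable)
  then have H: "(F has_sum (suminf f * suminf g)) (UNIV \<times> UNIV)"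
  proof (rule has_sum_SigmaI[rotated 2])
    show "((\<lambda>d. f d * suminf g) has_sum (suminf f * suminf g)) UNIV" by (rule has_sum_cmult_left[OF hf])
    show "((\<lambda>m. F (d, m)) has_sum (f d * suminf g)) UNIV" for d
      unfolding F_def using has_sum_cmult_right[OF hg] by simp
  qed
  \<comment> \<open>Terms with a zero index vanish and are dropped first, because the reindexing by
    divisors is a bijection on positive indices.\<close>
  have "(F has_sum (suminf f * suminf g)) ({1..} \<times> {1..})"
    using H by (rule has_sum_cong_neutral[THEN iffD1, rotated 3]) (auto simp: F_def f_def g_def npow_def Suc_le_eq split: if_splits)
  moreover have bij: "bij_betw (\<lambda>(n::nat, d). (d, n div d)) (Sigma {1..} (\<lambda>n. {d. d dvd n})) ({1..} \<times> {1..})"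
    by (rule bij_betwI[where g = "\<lambda>(d, m). (d * m, d)"]) (auto simp: Suc_le_eq dvd_div_eq_0_iff elim: dvdE intro!: Nat.gr0I)
  ultimately have "((\<lambda>x. F ((\<lambda>(n, d). (d, n div d)) x)) has_sum (suminf f * suminf g)) (Sigma {1..} (\<lambda>n. {d. d dvd n}))"
    by (intro has_sum_reindex_bij_betw[OF bij, THEN iffD2])
  then have "((\<lambda>n. of_real (ln (real n)) * npow s n) has_sum (suminf f * suminf g)) {1..}"
  proof (rule has_sum_SigmaD)
    fix n :: nat assume n: "n \<in> {1..}"
    have "(\<Sum>d | d dvd n. F (d, n div d)) = (\<Sum>d | d dvd n. mangoldt d * npow s n)"
      by (intro sum.cong refl) (auto simp: F_def f_def g_def mult.assoc npow_mult[symmetric])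
    also have "\<dots> = of_real (ln (real n)) * npow s n"
      using mangoldt_sum[of n, where 'a = complex] n by (simp flip: sum_distrib_right)
    finally show "((\<lambda>d. F ((\<lambda>(n, d). (d, n div d)) (n, d))) has_sum of_real (ln (real n)) * npow s n) {d. d dvd n}"
      using n by (intro has_sum_finiteI) auto
  qed
  then have "((\<lambda>n. of_real (ln (real n)) * npow s n) has_sum (suminf f * suminf g)) UNIV"
    by (rule has_sum_cong_neutral[THEN iffD1, rotated 3]) (auto simp: npow_def Suc_le_eq split: if_splits)
  from has_sum_imp_sums[OF this] show ?thesis by (simp add: sums_iff f_def g_def)
qed

lemma npow_series_has_derivative:
  assumes s: "Re s > 3 / 2"
  shows "((\<lambda>s. \<Sum>n. npow s n) has_field_derivative - (\<Sum>n. of_real (ln (real n)) * npow s n)) (at s)"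
proof -
  define S where "S = {s. Re s > 3 / 2}"
  have S: "open S" "convex S" unfolding S_def by (rule open_halfspace_Re_gt, rule convex_halfspace_Re_gt)
  have "((\<lambda>s. \<Sum>n. npow s n) has_field_derivative (\<Sum>n. - (of_real (ln (real n)) * npow s n))) (at s)"
  proof (rule has_field_derivative_series'(2)[OF S(2), where x0 = s])
    show "((\<lambda>s. npow s n) has_field_derivative - (of_real (ln (real n)) * npow x n)) (at x within S)" for n x
      by (cases "n = 0") (auto simp: npow_def intro!: derivative_eq_intros)
    show "uniformly_convergent_on S (\<lambda>n x. \<Sum>i<n. - (of_real (ln (real i)) * npow x i))"
      by (rule Weierstrass_m_test'[OF _ summable_npow_bound]) (use norm_ln_npow_le in \<open>auto simp: S_def\<close>)
    show "summable (\<lambda>n. npow s n)" using s by (intro summable_norm_cancel[OF summable_norm_npow]) auto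
    show "s \<in> S" "s \<in> interior S" using s S by (auto simp: S_def interior_open)
  qed
  moreover have "(\<Sum>n. - (of_real (ln (real n)) * npow s n)) = - (\<Sum>n. of_real (ln (real n)) * npow s n)"
    using s by (intro suminf_minus summable_norm_cancel[OF summable_norm_ln_npow]) auto
  ultimately show ?thesis by simp
qed

section \<open>Smoothing the logarithmic derivative\<close>

lemma suminf_npow: "Re s > 1 \<Longrightarrow> (\<Sum>n. 1 / of_nat (Suc n) powr s) = (\<Sum>n. npow s n)"
proof -
  assume s: "Re s > 1"
  have eq: "1 / of_nat (Suc n) powr s = npow s (Suc n)" for n
    unfolding one_over_powr_eq by (simp add: npow_def)
  have "summable (\<lambda>n. npow s (Suc n))"
    using summable_norm_cancel[OF summable_norm_one_over_powr[OF s]] unfolding eq .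
  then have "summable (npow s)" by (subst (asm) summable_Suc_iff)
  from suminf_split_head[OF this] show ?thesis unfolding eq by (simp add: npow_def[of s 0])
qed

text \<open>Derivatives are kept in the form value times logarithmic derivative, so that the latter
  simply add.\<close>

lemma DERIV_mult_log:
  fixes f g :: "complex \<Rightarrow> complex"
  assumes "(f has_field_derivative f z * a) (at z)" "(g has_field_derivative g z * b) (at z)"
  shows "((\<lambda>w. f w * g w) has_field_derivative (f z * g z) * (a + b)) (at z)"
  using DERIV_mult[OF assms] by (simp add: algebra_simps)

section \<open>Kernel averages of the von Mangoldt series\<close>

definition kern_hat :: "real \<Rightarrow> complex" where
  "kern_hat l = (LINT q|lborel. exp (\<i> * of_real (l * q)) * kern (of_real q))"

text \<open>The mass of the majorant \<open>1 / (1 + q^2)\<close>; the mass of the kernel itself is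
  \<open>kern_total\<close>.\<close>

definition kern_mass :: real where "kern_mass = (LINT q::real|lborel. 1 / (1 + q\<^sup>2))"

lemma kern_mass_pos: "kern_mass \<ge> 0"
  unfolding kern_mass_def by (intro Bochner_Integration.integral_nonneg) auto

text \<open>The decay check shared by the contour shifts: quadratic growth against quartic decay
  leaves \<open>1 / (1 + Re^2)\<close>, and climbing to height \<open>B\<close> costs
  \<open>exp (2 * B)\<close> because the kernel has type 2.\<close>

lemma kern_strip_bound:
  assumes "0 \<le> Im \<zeta>" "Im \<zeta> \<le> B" and K: "K \<ge> 0" and x: "norm x \<le> K * (1 + norm \<zeta>)\<^sup>2"
  shows "norm (x * kern \<zeta>) \<le> K * 20736 * exp (2 * B) / (1 + (Re \<zeta>)\<^sup>2)"
proof -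
  define m where "m = 1 + norm \<zeta>"
  have m: "m \<ge> 1" by (simp add: m_def)
  have "norm (x * kern \<zeta>) \<le> (K * m\<^sup>2) * (20736 * exp (2 * B) / m ^ 4)"
    unfolding norm_mult
  proof (rule mult_mono)
    have "norm (kern \<zeta>) \<le> 20736 * exp (2 * \<bar>Im \<zeta>\<bar>) / m ^ 4" unfolding m_def by (rule norm_kern_le)
    also have "\<dots> \<le> 20736 * exp (2 * B) / m ^ 4" using assms m by (intro divide_right_mono) auto
    finally show "norm (kern \<zeta>) \<le> 20736 * exp (2 * B) / m ^ 4" .
  qed (use x K m in \<open>auto simp: m_def\<close>)
  also have "\<dots> = K * 20736 * exp (2 * B) / m\<^sup>2"
  proof -
    have "m ^ 4 = m\<^sup>2 * m\<^sup>2" by (simp flip: power_add)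
    moreover have "m\<^sup>2 \<noteq> 0" using m by simp
    ultimately show ?thesis by (simp add: divide_simps)
  qed
  also have "\<dots> \<le> K * 20736 * exp (2 * B) / (1 + (Re \<zeta>)\<^sup>2)"
  proof (intro divide_left_mono mult_pos_pos)
    have "1 + (Re \<zeta>)\<^sup>2 \<le> (1 + \<bar>Re \<zeta>\<bar>)\<^sup>2" by (rule one_plus_sq_le)
    also have "\<dots> \<le> m\<^sup>2" using abs_Re_le_cmod[of \<zeta>] by (intro power_mono) (auto simp: m_def)
    finally show "1 + (Re \<zeta>)\<^sup>2 \<le> m\<^sup>2" .
  qed (use K m in \<open>auto simp: add_pos_nonneg\<close>)
  finally show ?thesis .
qed

text \<open>In \<open>z = Y + \<i> * (t - Y * \<zeta>)\<close>, raising \<open>Im \<zeta>\<close> by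
  \<open>B\<close> moves \<open>Re z\<close> from \<open>Y\<close> to \<open>Y * (1 + B)\<close>. On
  the lower line \<open>n^(-s)\<close> depends on \<open>q\<close> through
  \<open>exp (\<i> * Y * ln n * q)\<close>, so its average is a value of the Fourier transform of
  the kernel.\<close>

lemma mangoldt_term_shift:
  assumes Y: "Y > 0" and B: "B \<ge> 0" and n: "n > 0"
  shows "integrable lborel (\<lambda>q. npow (Complex (1 / 2 + Y * (1 + B)) (t - Y * q)) n * kern (Complex q B))"
    "(LINT q|lborel. npow (Complex (1 / 2 + Y * (1 + B)) (t - Y * q)) n * kern (Complex q B))
       = npow (Complex (1 / 2 + Y) t) n * kern_hat (Y * ln (real n))"
proof -
  define G where "G = (\<lambda>\<zeta>. npow (1 / 2 + of_real Y + \<i> * of_real t - \<i> * of_real Y * \<zeta>) n * kern \<zeta>)"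
  have G: "G (Complex q b) = npow (Complex (1 / 2 + Y * (1 + b)) (t - Y * q)) n * kern (Complex q b)" for q b
  proof -
    have "1 / 2 + of_real Y + \<i> * of_real t - \<i> * of_real Y * Complex q b = Complex (1 / 2 + Y * (1 + b)) (t - Y * q)"
      by (simp add: complex_eq_iff algebra_simps)
    then show ?thesis by (simp add: G_def)
  qed
  have hol: "G holomorphic_on {\<zeta>. Im \<zeta> > - 1}"
    unfolding G_def npow_def using n by (auto intro!: holomorphic_intros holomorphic_kern)
  have bd: "norm (G \<zeta>) \<le> (1 * 20736 * exp (2 * B)) / (1 + (Re \<zeta>)\<^sup>2)" if "0 \<le> Im \<zeta>" "Im \<zeta> \<le> B" for \<zeta>
    unfolding G_def
  proof (rule kern_strip_bound[OF that])
    have "norm (npow (1 / 2 + of_real Y + \<i> * of_real t - \<i> * of_real Y * \<zeta>) n) \<le> real n powr 0"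
      unfolding norm_npow[OF n]
    proof (rule powr_mono)
      have "0 \<le> Y * Im \<zeta>" using Y that by (intro mult_nonneg_nonneg) auto
      moreover have "Re (1 / 2 + of_real Y + \<i> * of_real t - \<i> * of_real Y * \<zeta>) = 1 / 2 + Y + Y * Im \<zeta>" by simp
      ultimately show "- Re (1 / 2 + of_real Y + \<i> * of_real t - \<i> * of_real Y * \<zeta>) \<le> 0" using Y by linarith
    qed (use n in auto)
    also have "\<dots> \<le> 1 * (1 + norm \<zeta>)\<^sup>2" using n by (simp add: one_le_power)
    finally show "norm (npow (1 / 2 + of_real Y + \<i> * of_real t - \<i> * of_real Y * \<zeta>) n) \<le> 1 * (1 + norm \<zeta>)\<^sup>2" .
  qed simp
  note sh = integral_horizontal_shift[OF hol _ B bd]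
  show "integrable lborel (\<lambda>q. npow (Complex (1 / 2 + Y * (1 + B)) (t - Y * q)) n * kern (Complex q B))"
    using sh(2) unfolding G by simp
  have "(LINT q|lborel. G (Complex q B)) = (LINT q|lborel. G (Complex q 0))" by (rule sh(3)[symmetric]) auto
  also have "\<dots> = (LINT q|lborel. npow (Complex (1 / 2 + Y) t) n * (exp (\<i> * of_real (Y * ln (real n) * q)) * kern (of_real q)))"
  proof (rule Bochner_Integration.integral_cong[OF refl])
    fix q :: real
    have "npow (Complex (1 / 2 + Y) (t - Y * q)) n = npow (Complex (1 / 2 + Y) t) n * exp (\<i> * of_real (Y * ln (real n) * q))"
    proof -
      have e: "- Complex (1 / 2 + Y) (t - Y * q) * of_real (ln (real n)) = - Complex (1 / 2 + Y) t * of_real (ln (real n)) + \<i> * of_real (Y * ln (real n) * q)"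
        by (simp add: complex_eq_iff algebra_simps)
      show ?thesis using n unfolding npow_def e exp_add by simp
    qed
    moreover have "Complex q 0 = of_real q" by (simp add: complex_eq_iff)
    ultimately show "G (Complex q 0) = npow (Complex (1 / 2 + Y) t) n * (exp (\<i> * of_real (Y * ln (real n) * q)) * kern (of_real q))"
      unfolding G by (simp add: mult_ac)
  qed
  also have "\<dots> = npow (Complex (1 / 2 + Y) t) n * kern_hat (Y * ln (real n))"
    unfolding kern_hat_def by (rule integral_mult_right_zero)
  finally show "(LINT q|lborel. npow (Complex (1 / 2 + Y * (1 + B)) (t - Y * q)) n * kern (Complex q B))
       = npow (Complex (1 / 2 + Y) t) n * kern_hat (Y * ln (real n))" unfolding G .
qed

text \<open>\<open>B\<close> makes the upper line \<open>Re s = 2\<close>, where the series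
  converges absolutely and may be integrated termwise. Each term is then carried back to the lower
  line, where the series itself may diverge, and the compact Fourier support leaves finitely many
  terms.\<close>

lemma mangoldt_series_shift:
  assumes Y: "0 < Y" "Y \<le> 1"
  defines "B \<equiv> 3 / (2 * Y) - 1"
  shows "integrable lborel (\<lambda>q. (\<Sum>n. mangoldt n * npow (Complex 2 (t - Y * q)) n) * kern (Complex q B))"
    "(LINT q|lborel. (\<Sum>n. mangoldt n * npow (Complex 2 (t - Y * q)) n) * kern (Complex q B))
      = (\<Sum>n=1..nat \<lfloor>exp (2 / Y)\<rfloor>. mangoldt n * kern_hat (Y * ln (real n)) * npow (Complex (1 / 2 + Y) t) n)"
proof -
  have B: "B \<ge> 0" using Y by (simp add: B_def divide_simps)
  have YB: "1 / 2 + Y * (1 + B) = 2" using Y by (simp add: B_def field_simps)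
  define f where "f = (\<lambda>n q. mangoldt n * (npow (Complex 2 (t - Y * q)) n * kern (Complex q B)))"
  note sh = mangoldt_term_shift[OF Y(1) B, unfolded YB]
  have fi: "integrable lborel (f n)" for n
  proof (cases "n = 0")
    case False
    then show ?thesis unfolding f_def by (intro integrable_mult_right sh(1)) auto
  qed (simp add: f_def)
  have fv: "(LINT q|lborel. f n q) = mangoldt n * kern_hat (Y * ln (real n)) * npow (Complex (1 / 2 + Y) t) n" for n
  proof (cases "n = 0")
    case False
    then show ?thesis unfolding f_def integral_mult_right_zero by (subst sh(2)) (auto simp: mult_ac)
  qed (simp add: f_def)
  have np: "norm (npow (Complex 2 (t - Y * q)) n) = norm (npow 2 n)" for q n
    by (cases "n = 0") (auto simp: norm_npow npow_def[of _ 0] simp del: complex_norm)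
  have fn: "norm (f n q) = norm (mangoldt n * npow 2 n) * norm (kern (Complex q B))" for n q
    by (simp add: f_def norm_mult np mult.assoc)
  have sm: "summable (\<lambda>n. norm (mangoldt n * npow 2 n))" by (rule summable_norm_mangoldt_npow) simp
  have sf: "summable (\<lambda>n. norm (f n q))" for q unfolding fn by (intro summable_mult2 sm)
  have si: "summable (\<lambda>n. LINT q|lborel. norm (f n q))"
    unfolding fn integral_mult_right_zero by (intro summable_mult2 sm)
  have S: "(\<Sum>n. f n q) = (\<Sum>n. mangoldt n * npow (Complex 2 (t - Y * q)) n) * kern (Complex q B)" for q
  proof -
    have "summable (\<lambda>n. norm (mangoldt n * npow (Complex 2 (t - Y * q)) n))"
      by (rule summable_norm_mangoldt_npow) simp
    from suminf_mult2[OF summable_norm_cancel[OF this], of "kern (Complex q B)"]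
    show ?thesis by (simp add: f_def mult.assoc)
  qed
  show "integrable lborel (\<lambda>q. (\<Sum>n. mangoldt n * npow (Complex 2 (t - Y * q)) n) * kern (Complex q B))"
    using integrable_suminf[OF fi AE_I2[OF sf] si] unfolding S .
  have "(\<lambda>n. LINT q|lborel. f n q) sums (LINT q|lborel. (\<Sum>n. mangoldt n * npow (Complex 2 (t - Y * q)) n) * kern (Complex q B))"
    using sums_integral[OF fi AE_I2[OF sf] si] unfolding S .
  moreover have "(\<lambda>n. LINT q|lborel. f n q) sums (\<Sum>n=1..nat \<lfloor>exp (2 / Y)\<rfloor>. LINT q|lborel. f n q)"
  proof (rule sums_finite)
    fix n assume "n \<notin> {1..nat \<lfloor>exp (2 / Y)\<rfloor>}"
    then consider "n = 0" | "n > 0" "n > nat \<lfloor>exp (2 / Y)\<rfloor>" by fastforce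
    then show "(LINT q|lborel. f n q) = 0"
    proof cases
      case 2
      then have "exp (2 / Y) < real n" by linarith
      then have "2 / Y < ln (real n)" using 2 by (metis exp_gt_zero ln_exp ln_less_cancel_iff of_nat_0_less_iff)
      then have "2 \<le> Y * ln (real n)" using Y by (simp add: field_simps)
      then have "kern_hat (Y * ln (real n)) = 0" unfolding kern_hat_def by (rule kern_fourier_vanishes)
      then show ?thesis unfolding fv by simp
    qed (simp add: f_def)
  qed simp
  ultimately show "(LINT q|lborel. (\<Sum>n. mangoldt n * npow (Complex 2 (t - Y * q)) n) * kern (Complex q B))
      = (\<Sum>n=1..nat \<lfloor>exp (2 / Y)\<rfloor>. mangoldt n * kern_hat (Y * ln (real n)) * npow (Complex (1 / 2 + Y) t) n)"
    unfolding fv by (rule sums_unique2)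
qed

text \<open>This is the pole of zeta seen from \<open>Re s = 2\<close>. The loss
  \<open>exp (2 * B)\<close>, at most \<open>exp (3 / Y)\<close>, is repaid later by the decay in
  \<open>|t|\<close>, as \<open>t \<ge> T\<close> and
  \<open>exp (3 / Y) \<le> exp 3 * T\<close>.\<close>

lemma pole_integral_bound:
  assumes Y: "0 < Y" "Y \<le> 1" and B: "B \<ge> 0"
  shows "integrable lborel (\<lambda>q. 1 / Complex 1 (t - Y * q) * kern (Complex q B))"
    "norm (LINT q|lborel. 1 / Complex 1 (t - Y * q) * kern (Complex q B)) \<le> 2 * 20736 * exp (2 * B) / (1 + \<bar>t\<bar>) * kern_mass"
proof -
  define K where "K = 2 / (1 + \<bar>t\<bar>)"
  have K: "K \<ge> 0" by (simp add: K_def)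
  have bd: "norm (1 / Complex 1 (t - Y * q) * kern (Complex q B)) \<le> K * 20736 * exp (2 * B) / (1 + (Re (Complex q B))\<^sup>2)" for q
  proof (rule kern_strip_bound[OF _ _ K])
    have "norm (Complex 1 (t - Y * q)) * 2 \<ge> 1 + \<bar>t - Y * q\<bar>"
      using abs_Re_le_cmod[of "Complex 1 (t - Y * q)"] abs_Im_le_cmod[of "Complex 1 (t - Y * q)"] by simp
    moreover have "1 + \<bar>t\<bar> \<le> (1 + \<bar>t - Y * q\<bar>) * (1 + \<bar>q\<bar>)"
    proof -
      have "\<bar>Y * q\<bar> \<le> \<bar>q\<bar>" using Y by (simp add: abs_mult mult_left_le_one_le)
      then have "\<bar>t\<bar> \<le> \<bar>t - Y * q\<bar> + \<bar>q\<bar>" by linarith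
      moreover have "0 \<le> \<bar>t - Y * q\<bar> * \<bar>q\<bar>" by simp
      moreover have "(1 + \<bar>t - Y * q\<bar>) * (1 + \<bar>q\<bar>) = 1 + \<bar>t - Y * q\<bar> + \<bar>q\<bar> + \<bar>t - Y * q\<bar> * \<bar>q\<bar>" by (simp add: algebra_simps)
      ultimately show ?thesis by linarith
    qed
    ultimately have "1 + \<bar>t\<bar> \<le> norm (Complex 1 (t - Y * q)) * 2 * (1 + \<bar>q\<bar>)"
      by (meson order.trans mult_right_mono abs_ge_zero add_nonneg_nonneg zero_le_one)
    moreover have n0: "norm (Complex 1 (t - Y * q)) > 0" by (simp add: complex_eq_iff del: complex_norm)
    ultimately have "1 / norm (Complex 1 (t - Y * q)) \<le> K * (1 + \<bar>q\<bar>)"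
      unfolding K_def by (simp add: field_simps del: complex_norm)
    also have "\<dots> \<le> K * (1 + norm (Complex q B))\<^sup>2"
    proof (rule mult_left_mono[OF _ K])
      have "1 + \<bar>q\<bar> \<le> 1 + norm (Complex q B)" using abs_Re_le_cmod[of "Complex q B"] by simp
      also have "\<dots> \<le> (1 + norm (Complex q B))\<^sup>2" by (rule self_le_power) auto
      finally show "1 + \<bar>q\<bar> \<le> (1 + norm (Complex q B))\<^sup>2" .
    qed
    finally show "norm (1 / Complex 1 (t - Y * q)) \<le> K * (1 + norm (Complex q B))\<^sup>2"
      by (simp add: norm_divide del: complex_norm)
  qed (use B in auto)
  have cC: "continuous_on UNIV (\<lambda>q. Complex (c q) (d q))" if "continuous_on UNIV c" "continuous_on UNIV d" for c d :: "real \<Rightarrow> real"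
    unfolding Complex_eq by (intro continuous_intros that)
  show int: "integrable lborel (\<lambda>q. 1 / Complex 1 (t - Y * q) * kern (Complex q B))"
  proof (rule integrable_of_quadratic_decay)
    show "continuous_on UNIV (\<lambda>q. 1 / Complex 1 (t - Y * q) * kern (Complex q B))"
      by (intro continuous_intros cC continuous_on_compose2[OF holomorphic_on_imp_continuous_on[OF holomorphic_kern[of UNIV]]])
         (auto simp: complex_eq_iff)
    show "norm (1 / Complex 1 (t - Y * q) * kern (Complex q B)) \<le> (K * 20736 * exp (2 * B)) / (1 + q\<^sup>2)" for q
      using bd[of q] by simp
  qed
  have "norm (LINT q|lborel. 1 / Complex 1 (t - Y * q) * kern (Complex q B)) \<le> (LINT q|lborel. (K * 20736 * exp (2 * B)) * (1 / (1 + q\<^sup>2)))"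
  proof (rule Bochner_Integration.integral_norm_bound_integral[OF int])
    show "integrable lborel (\<lambda>q. (K * 20736 * exp (2 * B)) * (1 / (1 + q\<^sup>2)))"
      by (intro integrable_mult_right integrable_inverse_one_plus_sq)
  qed (use bd in auto)
  also have "\<dots> = (K * 20736 * exp (2 * B)) * kern_mass" unfolding kern_mass_def by (rule integral_mult_right_zero)
  finally show "norm (LINT q|lborel. 1 / Complex 1 (t - Y * q) * kern (Complex q B)) \<le> 2 * 20736 * exp (2 * B) / (1 + \<bar>t\<bar>) * kern_mass"
    by (simp add: K_def)
qed

lemma kern_real_integrable: "integrable lborel kern_real"
proof (rule integrable_of_quadratic_decay[where C = 20736])
  show "continuous_on UNIV kern_real" by (rule continuous_kern_real)
  fix q
  have "1 * kern_real q \<le> (1 + \<bar>q\<bar>)\<^sup>2 * kern_real q"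
    by (intro mult_right_mono kern_real_nonneg) (simp add: one_le_power)
  also have "\<dots> \<le> 20736 / (1 + q\<^sup>2)" by (rule kern_real_weight_le)
  finally show "norm (kern_real q) \<le> 20736 / (1 + q\<^sup>2)" using kern_real_nonneg[of q] by simp
qed

definition dirichlet_poly :: "real \<Rightarrow> real \<Rightarrow> complex" where
  "dirichlet_poly Y t = (\<Sum>n=1..nat \<lfloor>exp (2 / Y)\<rfloor>. mangoldt n * kern_hat (Y * ln (real n)) * npow (Complex (1 / 2 + Y) t) n)"

lemma continuous_Complex: "continuous_on S c \<Longrightarrow> continuous_on S d \<Longrightarrow> continuous_on S (\<lambda>q. Complex (c q) (d q))"
  for c d :: "real \<Rightarrow> real"
  unfolding Complex_eq by (intro continuous_intros)

lemma gamma_terms_bound: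
  assumes Y: "0 < Y" "Y \<le> 1"
  shows "norm (gamma_psi (Complex Y (t - Y * q)) / 2 + 1 / (1 / 2 + Complex Y (t - Y * q)))
    \<le> 19 * ln (4 + \<bar>t\<bar>) * (1 + \<bar>q\<bar>)\<^sup>2"
proof -
  define z where "z = Complex Y (t - Y * q)"
  define l where "l = ln (4 + \<bar>t\<bar>)"
  have "1 \<le> ln (4::real)"
  proof -
    have "exp (1::real) \<le> 4" using exp_le by simp
    then show ?thesis by (simp add: ln_ge_iff)
  qed
  also have "\<dots> \<le> l" unfolding l_def by (subst ln_le_cancel_iff) auto
  finally have l: "l \<ge> 1" .
  have q1: "(1 + \<bar>q\<bar>) \<le> (1 + \<bar>q\<bar>)\<^sup>2" "1 \<le> (1 + \<bar>q\<bar>)\<^sup>2" by (auto intro: self_le_power one_le_power)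
  have "\<bar>Y * q\<bar> \<le> \<bar>q\<bar>" using Y by (simp add: abs_mult mult_left_le_one_le)
  then have "norm z \<le> 1 + \<bar>t\<bar> + \<bar>q\<bar>" using cmod_le[of z] Y by (simp add: z_def)
  moreover have "0 \<le> \<bar>t\<bar> * \<bar>q\<bar>" by (intro mult_nonneg_nonneg) auto
  ultimately have "3 + norm z \<le> 4 + \<bar>t\<bar> + \<bar>q\<bar> + (3 * \<bar>q\<bar> + \<bar>t\<bar> * \<bar>q\<bar>)" by linarith
  also have "\<dots> = (4 + \<bar>t\<bar>) * (1 + \<bar>q\<bar>)" by (simp add: algebra_simps)
  finally have "ln (3 + norm z) \<le> ln ((4 + \<bar>t\<bar>) * (1 + \<bar>q\<bar>))"
    by (subst ln_le_cancel_iff) (auto intro: add_pos_nonneg)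
  also have "\<dots> = l + ln (1 + \<bar>q\<bar>)" unfolding l_def by (rule ln_mult_pos) auto
  also have "ln (1 + \<bar>q\<bar>) \<le> \<bar>q\<bar>" by (rule ln_add_one_self_le_self) auto
  also have "l + \<bar>q\<bar> \<le> l * (1 + \<bar>q\<bar>)"
    using mult_right_mono[OF l, of "\<bar>q\<bar>"] by (simp add: algebra_simps)
  also have "\<dots> \<le> l * (1 + \<bar>q\<bar>)\<^sup>2" using q1 l by (intro mult_left_mono) auto
  finally have "ln (3 + norm z) \<le> l * (1 + \<bar>q\<bar>)\<^sup>2" by simp
  then have 1: "norm (gamma_psi z / 2) \<le> 17 * (l * (1 + \<bar>q\<bar>)\<^sup>2)"
  proof -
    assume "ln (3 + norm z) \<le> l * (1 + \<bar>q\<bar>)\<^sup>2"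
    moreover have "norm (gamma_psi z) \<le> 33 * ln (3 + norm z)" using Y by (intro norm_gamma_psi_le) (simp add: z_def)
    moreover have "0 \<le> l * (1 + \<bar>q\<bar>)\<^sup>2" using l by simp
    moreover have "norm (gamma_psi z / 2) = norm (gamma_psi z) / 2" by (simp add: norm_divide)
    ultimately show ?thesis by linarith
  qed
  have "norm (1 / 2 + z) \<ge> 1 / 2" using complex_Re_le_cmod[of "1 / 2 + z"] Y by (simp add: z_def)
  then have "norm (1 / (1 / 2 + z)) \<le> 2"
    unfolding norm_divide by (simp add: divide_le_eq)
  also have "2 * 1 \<le> 2 * (l * (1 + \<bar>q\<bar>)\<^sup>2)" using mult_mono[of 1 l 1 "(1 + \<bar>q\<bar>)\<^sup>2"] l q1 by simp
  finally have 2: "norm (1 / (1 / 2 + z)) \<le> 2 * (l * (1 + \<bar>q\<bar>)\<^sup>2)" by simp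
  show ?thesis using norm_triangle_ineq[of "gamma_psi z / 2" "1 / (1 / 2 + z)"] 1 2
    unfolding z_def l_def by linarith
qed

section \<open>The averaged logarithmic derivative\<close>

context rh_xi
begin

lemma ldf_growth_quadratic:
  assumes Y: "Y > 0"
  obtains K where "K \<ge> 0" "\<And>z. Re z \<ge> Y \<Longrightarrow> norm (ldf z) \<le> K * (1 + norm (z - of_real Y))\<^sup>2"
proof -
  define K where "K = norm (ldf (of_real Y)) + (1 + 1 / Y) / Y * Re (ldf (of_real Y))"
  have R: "Re (ldf (of_real Y)) \<ge> 0" using Y by (intro Re_ldf_nonneg) auto
  have K0: "K \<ge> 0" unfolding K_def using R Y by (intro add_nonneg_nonneg mult_nonneg_nonneg) auto
  have "norm (ldf z) \<le> K * (1 + norm (z - of_real Y))\<^sup>2" if z: "Re z \<ge> Y" for z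
  proof -
    define d where "d = norm (z - of_real Y)"
    have d: "d \<ge> 0" by (simp add: d_def)
    have "1 \<le> (1 + d)\<^sup>2" using d by (simp add: one_le_power)
    have "d * (1 + d / Y) \<le> (1 + d) * ((1 + 1 / Y) * (1 + d))"
      using d Y by (intro mult_mono) (auto simp: field_simps)
    then have dd: "d * (1 + d / Y) / Y * Re (ldf (of_real Y)) \<le> (1 + 1 / Y) * (1 + d)\<^sup>2 / Y * Re (ldf (of_real Y))"
      using Y R by (intro mult_right_mono divide_right_mono) (auto simp: power2_eq_square mult_ac)
    have "norm (ldf z) \<le> norm (ldf (of_real Y)) + d * (1 + d / Y) / Y * Re (ldf (of_real Y))"
      unfolding d_def by (rule norm_ldf_growth[OF Y z])
    also have "\<dots> \<le> norm (ldf (of_real Y)) * (1 + d)\<^sup>2 + (1 + 1 / Y) * (1 + d)\<^sup>2 / Y * Re (ldf (of_real Y))"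
      using dd mult_left_mono[OF \<open>1 \<le> (1 + d)\<^sup>2\<close>, of "norm (ldf (of_real Y))"] by simp
    also have "\<dots> = K * (1 + d)\<^sup>2" by (simp add: K_def algebra_simps)
    finally show ?thesis by (simp add: d_def)
  qed
  with K0 that show ?thesis by blast
qed

text \<open>With \<open>s = 1 / 2 + z\<close> this is \<open>zeta'/zeta (s) + 1 / (s - 1)\<close>:
  the prime part of \<open>ldf\<close> with the pole of zeta removed. The summand
  \<open>1 / (1 / 2 + z)\<close> is there because \<open>xi\<close> contains
  \<open>Gamma (s / 2 + 1)\<close>, whereas \<open>gamma_psi\<close> belongs to
  \<open>Gamma (s / 2)\<close>.\<close>

definition hfun :: "complex \<Rightarrow> complex" where
  "hfun z = ldf z - (gamma_psi z / 2 + 1 / (1 / 2 + z))"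

text \<open>Logarithmic differentiation of the product formula for \<open>xi\<close>; the recurrence
  of Digamma splits off the term \<open>1 / s\<close>.\<close>

lemma hfun_right:
  assumes z: "Re z > 1"
  shows "hfun z = 1 / (z - 1 / 2) - (\<Sum>n. mangoldt n * npow (1 / 2 + z) n)"
proof -
  define s where "s = 1 / 2 + z"
  define c where "c = complex_of_real (ln pi)"
  define Z where "Z = (\<lambda>w. \<Sum>n. npow w n)"
  define L where "L = (\<Sum>n. mangoldt n * npow s n)"
  have s: "Re s > 3 / 2" using z by (simp add: s_def)
  have s1: "s - 1 \<noteq> 0" "s \<noteq> 0" using s by auto
  define P where "P = (\<lambda>w. (w - 1) * (exp (- (w / 2) * c) * (Gamma (w / 2 + 1) * Z w)))"
  have xiP: "xi w = P w" if "Re w > 1" for w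
    unfolding xi_eq_Dirichlet_series'[OF that] suminf_npow[OF that] P_def Z_def c_def by simp
  have d1: "((\<lambda>w. w - 1) has_field_derivative (s - 1) * (1 / (s - 1))) (at s)"
    using s1 by (auto intro!: derivative_eq_intros)
  have d2: "((\<lambda>w. exp (- (w / 2) * c)) has_field_derivative exp (- (s / 2) * c) * (- c / 2)) (at s)"
    by (auto intro!: derivative_eq_intros)
  have d3: "((\<lambda>w. Gamma (w / 2 + 1)) has_field_derivative Gamma (s / 2 + 1) * (Digamma (s / 2 + 1) / 2)) (at s)"
  proof -
    have "s / 2 + 1 \<notin> \<int>\<^sub>\<le>\<^sub>0" using s by (intro not_nonpos_Int_if_Re_pos) simp
    then have "(Gamma has_field_derivative Gamma (s / 2 + 1) * Digamma (s / 2 + 1)) (at (s / 2 + 1))"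
      by (rule has_field_derivative_Gamma)
    moreover have "((\<lambda>w. w / 2 + 1) has_field_derivative 1 / 2) (at s)" by (auto intro!: derivative_eq_intros)
    ultimately have "((\<lambda>w. Gamma (w / 2 + 1)) has_field_derivative Gamma (s / 2 + 1) * Digamma (s / 2 + 1) * (1 / 2)) (at s)"
      by (rule DERIV_chain2)
    then show ?thesis by simp
  qed
  have d4: "(Z has_field_derivative Z s * (- L)) (at s)"
  proof -
    have "(Z has_field_derivative - (\<Sum>n. of_real (ln (real n)) * npow s n)) (at s)"
      unfolding Z_def by (rule npow_series_has_derivative[OF s])
    then show ?thesis using mangoldt_dirichlet_product[of s] s by (simp add: Z_def L_def mult.commute)
  qed
  have "(P has_field_derivative P s * (1 / (s - 1) + (- c / 2 + (Digamma (s / 2 + 1) / 2 + - L)))) (at s)"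
    unfolding P_def by (intro DERIV_mult_log d1 d2 d3 d4)
  then have "(xi has_field_derivative xi s * (1 / (s - 1) + (- c / 2 + (Digamma (s / 2 + 1) / 2 + - L)))) (at s)"
  proof (rule has_field_derivative_transform_within_open[where S = "{w. Re w > 1}", THEN DERIV_cong])
    show "open {w. Re w > 1}" by (rule open_halfspace_Re_gt)
  qed (use s xiP in auto)
  then have "(xi has_field_derivative xi s * (1 / (s - 1) + (- c / 2 + (Digamma (s / 2 + 1) / 2 + - L)))) (at (1 / 2 + z))"
    by (simp only: s_def)
  moreover have "((\<lambda>w. 1 / 2 + w) has_field_derivative 1) (at z)" by (auto intro!: derivative_eq_intros)
  ultimately have "((\<lambda>w. xi (1 / 2 + w)) has_field_derivative xi s * (1 / (s - 1) + (- c / 2 + (Digamma (s / 2 + 1) / 2 + - L))) * 1) (at z)"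
    by (rule DERIV_chain2)
  then have "(xi_half has_field_derivative xi_half z * (1 / (s - 1) + (- c / 2 + (Digamma (s / 2 + 1) / 2 + - L)))) (at z)"
    unfolding xi_half_def s_def[symmetric] by (simp only: mult_1_right)
  then have "deriv xi_half z = xi_half z * (1 / (s - 1) + (- c / 2 + (Digamma (s / 2 + 1) / 2 + - L)))"
    by (rule DERIV_imp_deriv)
  moreover have "xi_half z \<noteq> 0" using z by (intro nonzero) auto
  ultimately have ldf: "ldf z = 1 / (s - 1) + (- c / 2 + (Digamma (s / 2 + 1) / 2 + - L))"
    by (simp add: ldf_def)
  have dp: "Digamma (s / 2 + 1) = Digamma (s / 2) + 1 / (s / 2)" using s1 by (intro Digamma_plus1) auto
  have zs: "1 / 4 + z / 2 = s / 2" by (simp add: s_def field_simps)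
  have "ldf z = 1 / (s - 1) + (gamma_psi z / 2 + 1 / s) - L"
    unfolding ldf gamma_psi_def c_def dp zs by (simp add: add_divide_distrib diff_divide_distrib)
  moreover have "s - 1 = z - 1 / 2" by (simp add: s_def)
  ultimately show ?thesis unfolding hfun_def L_def by (simp add: s_def)
qed

lemma holomorphic_hfun: "hfun holomorphic_on {z. Re z > 0}"
proof -
  have "1 / 2 + z \<noteq> 0" if "Re z > 0" for z :: complex using that by (auto simp: complex_eq_iff)
  then show ?thesis unfolding hfun_def
    by (intro holomorphic_intros holomorphic_ldf holomorphic_on_subset[OF holomorphic_gamma_psi]) auto
qed

lemma hfun_growth_quadratic:
  assumes Y: "Y > 0"
  obtains K where "K \<ge> 0" "\<And>z. Re z \<ge> Y \<Longrightarrow> norm (hfun z) \<le> K * (1 + norm (z - of_real Y))\<^sup>2"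
proof -
  obtain K where K: "K \<ge> 0" "\<And>z. Re z \<ge> Y \<Longrightarrow> norm (ldf z) \<le> K * (1 + norm (z - of_real Y))\<^sup>2"
    using ldf_growth_quadratic[OF Y] by metis
  have "norm (hfun z) \<le> (K + (17 * (2 + Y) + 2)) * (1 + norm (z - of_real Y))\<^sup>2" if z: "Re z \<ge> Y" for z
  proof -
    define d where "d = norm (z - of_real Y)"
    have d: "d \<ge> 0" by (simp add: d_def)
    have d1: "1 \<le> (1 + d)\<^sup>2" "1 + d \<le> (1 + d)\<^sup>2" using d by (auto simp: one_le_power intro: self_le_power)
    have "norm z \<le> Y + d" using norm_triangle_ineq[of "z - of_real Y" "of_real Y"] Y by (simp add: d_def)
    moreover have "(2 + Y) * (1 + d) = 2 + Y + 2 * d + Y * d" by (simp add: algebra_simps)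
    moreover have "0 \<le> Y * d" using Y d by (intro mult_nonneg_nonneg) auto
    ultimately have "2 + norm z \<le> (2 + Y) * (1 + d)" using d by linarith
    also have "\<dots> \<le> (2 + Y) * (1 + d)\<^sup>2" using d1 Y by (intro mult_left_mono) auto
    finally have "2 + norm z \<le> (2 + Y) * (1 + d)\<^sup>2" .
    moreover have "ln (3 + norm z) \<le> 2 + norm z" using ln_add_one_self_le_self[of "2 + norm z"] by (simp add: add_ac)
    moreover have "norm (gamma_psi z) \<le> 33 * ln (3 + norm z)" using z Y by (intro norm_gamma_psi_le) auto
    moreover have "0 \<le> (2 + Y) * (1 + d)\<^sup>2" using Y by simp
    ultimately have 1: "norm (gamma_psi z / 2) \<le> 17 * ((2 + Y) * (1 + d)\<^sup>2)" by (simp add: norm_divide)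
    have "norm (1 / 2 + z) \<ge> 1 / 2" using complex_Re_le_cmod[of "1 / 2 + z"] z Y by simp
    then have "norm (1 / (1 / 2 + z)) \<le> 2"
      unfolding norm_divide by (simp add: divide_le_eq)
    then have 2: "norm (1 / (1 / 2 + z)) \<le> 2 * (1 + d)\<^sup>2" using d1 by linarith
    have "norm (hfun z) \<le> norm (ldf z) + (norm (gamma_psi z / 2) + norm (1 / (1 / 2 + z)))"
      unfolding hfun_def by (intro order.trans[OF norm_triangle_ineq4] add_mono norm_triangle_ineq) auto
    also have "\<dots> \<le> K * (1 + d)\<^sup>2 + (17 * ((2 + Y) * (1 + d)\<^sup>2) + 2 * (1 + d)\<^sup>2)"
      using K(2)[OF z] 1 2 by (intro add_mono) (auto simp: d_def)
    finally show ?thesis by (simp add: d_def algebra_simps)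
  qed
  moreover have "K + (17 * (2 + Y) + 2) \<ge> 0" using K Y by simp
  ultimately show ?thesis using that by blast
qed

text \<open>\<open>hfun\<close> is holomorphic for \<open>Re z > 0\<close>, so the average moves
  from \<open>Re z = Y\<close> to \<open>Re z = 3 / 2\<close> with no residue. There it splits into
  the pole term, which is estimated, and the von Mangoldt series, which is carried back as the
  finite polynomial.\<close>

lemma hfun_smoothed:
  assumes Y: "0 < Y" "Y \<le> 1"
  shows "integrable lborel (\<lambda>q. hfun (Complex Y (t - Y * q)) * kern (of_real q))"
    "norm ((LINT q|lborel. hfun (Complex Y (t - Y * q)) * kern (of_real q)) + dirichlet_poly Y t)
      \<le> 2 * 20736 * exp (3 / Y) / (1 + \<bar>t\<bar>) * kern_mass"
proof -
  define B where "B = 3 / (2 * Y) - 1"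
  have B: "B \<ge> 0" using Y by (simp add: B_def divide_simps)
  have YB: "Y * (1 + B) = 3 / 2" using Y by (simp add: B_def field_simps)
  define w where "w = (\<lambda>\<zeta>. of_real Y + \<i> * of_real t - \<i> * of_real Y * \<zeta>)"
  define G where "G = (\<lambda>\<zeta>. hfun (w \<zeta>) * kern \<zeta>)"
  have w: "w (Complex q b) = Complex (Y * (1 + b)) (t - Y * q)" for q b
    by (simp add: w_def complex_eq_iff algebra_simps)
  have Rew: "Re (w \<zeta>) = Y * (1 + Im \<zeta>)" for \<zeta> by (simp add: w_def algebra_simps)
  have hol: "G holomorphic_on {\<zeta>. Im \<zeta> > - 1}"
    unfolding G_def
  proof (intro holomorphic_intros holomorphic_kern holomorphic_on_compose_gen[OF _ holomorphic_hfun, unfolded o_def])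
    show "w holomorphic_on {\<zeta>. Im \<zeta> > - 1}" unfolding w_def by (intro holomorphic_intros)
    show "w ` {\<zeta>. Im \<zeta> > - 1} \<subseteq> {z. Re z > 0}" using Y by (auto simp: Rew)
  qed
  obtain K where K: "K \<ge> 0" "\<And>z. Re z \<ge> Y \<Longrightarrow> norm (hfun z) \<le> K * (1 + norm (z - of_real Y))\<^sup>2"
    using hfun_growth_quadratic[OF Y(1)] by metis
  have bd: "norm (G \<zeta>) \<le> ((K * (2 + \<bar>t\<bar>)\<^sup>2) * 20736 * exp (2 * B)) / (1 + (Re \<zeta>)\<^sup>2)" if "0 \<le> Im \<zeta>" "Im \<zeta> \<le> B" for \<zeta>
    unfolding G_def
  proof (rule kern_strip_bound[OF that])
    have "w \<zeta> - of_real Y = \<i> * of_real t - \<i> * of_real Y * \<zeta>" by (simp add: w_def)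
    then have "norm (w \<zeta> - of_real Y) \<le> \<bar>t\<bar> + Y * norm \<zeta>"
      using norm_triangle_ineq4[of "\<i> * of_real t" "\<i> * of_real Y * \<zeta>"] Y by (simp add: norm_mult)
    also have "Y * norm \<zeta> \<le> norm \<zeta>" using Y by (simp add: mult_left_le_one_le)
    finally have "norm (w \<zeta> - of_real Y) \<le> \<bar>t\<bar> + norm \<zeta>" by simp
    moreover have "0 \<le> \<bar>t\<bar> * norm \<zeta>" by (intro mult_nonneg_nonneg) auto
    ultimately have "1 + norm (w \<zeta> - of_real Y) \<le> 1 + \<bar>t\<bar> + norm \<zeta> + (1 + norm \<zeta> + \<bar>t\<bar> * norm \<zeta>)"
      using norm_ge_zero[of \<zeta>] by linarith
    also have "\<dots> = (2 + \<bar>t\<bar>) * (1 + norm \<zeta>)" by (simp add: algebra_simps)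
    finally have "(1 + norm (w \<zeta> - of_real Y))\<^sup>2 \<le> ((2 + \<bar>t\<bar>) * (1 + norm \<zeta>))\<^sup>2" by (intro power_mono) auto
    then have "K * (1 + norm (w \<zeta> - of_real Y))\<^sup>2 \<le> K * ((2 + \<bar>t\<bar>) * (1 + norm \<zeta>))\<^sup>2"
      using K by (intro mult_left_mono) auto
    moreover have "norm (hfun (w \<zeta>)) \<le> K * (1 + norm (w \<zeta> - of_real Y))\<^sup>2"
      using Y that by (intro K(2)) (simp add: Rew)
    ultimately show "norm (hfun (w \<zeta>)) \<le> K * (2 + \<bar>t\<bar>)\<^sup>2 * (1 + norm \<zeta>)\<^sup>2"
      by (simp add: power_mult_distrib mult_ac)
  qed (use K in auto)
  note sh = integral_horizontal_shift[OF hol _ B bd]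
  have G0: "G (Complex q 0) = hfun (Complex Y (t - Y * q)) * kern (of_real q)" for q
    using w[of q 0] by (simp add: G_def Complex_eq)
  have GB: "G (Complex q B) = 1 / Complex 1 (t - Y * q) * kern (Complex q B) - (\<Sum>n. mangoldt n * npow (Complex 2 (t - Y * q)) n) * kern (Complex q B)" for q
  proof -
    have "Complex (3/2) (t - Y * q) - 1 / 2 = Complex 1 (t - Y * q)" "1 / 2 + Complex (3/2) (t - Y * q) = Complex 2 (t - Y * q)"
      by (auto simp: complex_eq_iff)
    then show ?thesis unfolding G_def w YB by (subst hfun_right) (auto simp: left_diff_distrib)
  qed
  show "integrable lborel (\<lambda>q. hfun (Complex Y (t - Y * q)) * kern (of_real q))"
    using sh(1) unfolding G0 by simp
  have "(LINT q|lborel. hfun (Complex Y (t - Y * q)) * kern (of_real q)) = (LINT q|lborel. G (Complex q B))"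
    using sh(3) unfolding G0 by simp
  also have "\<dots> = (LINT q|lborel. 1 / Complex 1 (t - Y * q) * kern (Complex q B)) - dirichlet_poly Y t"
    unfolding GB dirichlet_poly_def
    using mangoldt_series_shift[OF Y, of t] pole_integral_bound(1)[OF Y B, of t]
    by (subst Bochner_Integration.integral_diff) (auto simp: B_def)
  finally have "(LINT q|lborel. hfun (Complex Y (t - Y * q)) * kern (of_real q)) + dirichlet_poly Y t
      = (LINT q|lborel. 1 / Complex 1 (t - Y * q) * kern (Complex q B))" by simp
  also have "norm \<dots> \<le> 2 * 20736 * exp (2 * B) / (1 + \<bar>t\<bar>) * kern_mass" by (rule pole_integral_bound(2)[OF Y B])
  also have "\<dots> \<le> 2 * 20736 * exp (3 / Y) / (1 + \<bar>t\<bar>) * kern_mass"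
    by (intro mult_right_mono divide_right_mono kern_mass_pos) (auto simp: B_def)
  finally show "norm ((LINT q|lborel. hfun (Complex Y (t - Y * q)) * kern (of_real q)) + dirichlet_poly Y t)
      \<le> 2 * 20736 * exp (3 / Y) / (1 + \<bar>t\<bar>) * kern_mass" .
qed

end

section \<open>Moments of prime polynomials\<close>

text \<open>Chebyshev's device: the logarithm of \<open>fact N\<close> is the sum of
  \<open>mangoldt d * (N div d)\<close> and is at most \<open>N * ln N\<close>, while
  \<open>N / d \<le> 2 * (N div d)\<close> for \<open>d \<le> N\<close>.\<close>

lemma sum_mangoldt_over_le:
  assumes "N \<ge> 1"
  shows "(\<Sum>n=1..N. mangoldt n / real n) \<le> 2 * ln (real N)"
proof -
  have "(\<Sum>m=1..N. ln (real m)) = (\<Sum>m=1..N. \<Sum>d | d dvd m. mangoldt d)"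
    by (intro sum.cong) (auto simp: mangoldt_sum)
  also have "\<dots> = (\<Sum>m=1..N. \<Sum>d\<in>{1..N}. if d dvd m then mangoldt d else 0)"
  proof (rule sum.cong[OF refl])
    fix m assume "m \<in> {1..N}"
    then have "{d. d dvd m} = {d \<in> {1..N}. d dvd m}" by (auto dest: dvd_imp_le intro: Suc_leI dvd_pos_nat)
    then show "(\<Sum>d | d dvd m. mangoldt d) = (\<Sum>d\<in>{1..N}. if d dvd m then mangoldt d else (0::real))"
      using sum.inter_filter[of "{1..N}" "mangoldt :: nat \<Rightarrow> real" "\<lambda>d. d dvd m"] by simp
  qed
  also have "\<dots> = (\<Sum>d\<in>{1..N}. \<Sum>m=1..N. if d dvd m then mangoldt d else 0)"
    by (rule sum.swap)
  also have "\<dots> = (\<Sum>d\<in>{1..N}. mangoldt d * real (card {m \<in> {1..N}. d dvd m}))"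
    by (intro sum.cong refl) (simp add: sum.inter_filter[symmetric] mult.commute)
  also have "\<dots> = (\<Sum>d\<in>{1..N}. mangoldt d * real (N div d))"
  proof (intro sum.cong refl)
    fix d assume d: "d \<in> {1..N}"
    have "{m \<in> {1..N}. d dvd m} = (\<lambda>k. d * k) ` {1..N div d}"
      using d by (auto simp: image_iff less_eq_div_iff_mult_less_eq mult.commute elim!: dvdE)
    moreover have "inj_on (\<lambda>k. d * k) {1..N div d}" using d by (auto simp: inj_on_def)
    ultimately have "card {m \<in> {1..N}. d dvd m} = N div d" by (simp add: card_image)
    then show "mangoldt d * real (card {m \<in> {1..N}. d dvd m}) = mangoldt d * real (N div d)" by simp
  qed
  finally have eq: "(\<Sum>m=1..N. ln (real m)) = (\<Sum>d\<in>{1..N}. mangoldt d * real (N div d))" .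
  have "real N * (\<Sum>n=1..N. mangoldt n / real n) = (\<Sum>n=1..N. mangoldt n * (real N / real n))"
    by (simp add: sum_distrib_left mult_ac)
  also have "\<dots> \<le> (\<Sum>n=1..N. mangoldt n * (2 * real (N div n)))"
  proof (intro sum_mono mult_left_mono mangoldt_nonneg)
    fix n assume n: "n \<in> {1..N}"
    then have 1: "N div n \<ge> 1" by (simp add: Suc_le_eq div_greater_zero_iff)
    have "N < n * (N div n + 1)" using n
      by (metis One_nat_def Suc_le_eq add.commute atLeastAtMost_iff dividend_less_times_div mult.commute mult_Suc_right plus_1_eq_Suc)
    also have "\<dots> \<le> n * (2 * (N div n))" using 1 by (intro mult_left_mono) auto
    finally have "real N \<le> real n * (2 * real (N div n))"
      by (metis less_imp_le of_nat_le_iff of_nat_mult of_nat_numeral)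
    then show "real N / real n \<le> 2 * real (N div n)" using n by (simp add: divide_le_eq mult.commute)
  qed
  also have "\<dots> = 2 * (\<Sum>m=1..N. ln (real m))" unfolding eq sum_distrib_left by (simp add: mult_ac)
  also have "(\<Sum>m=1..N. ln (real m)) \<le> (\<Sum>m=1..N. ln (real N))"
    by (intro sum_mono) auto
  finally show ?thesis using assms by simp
qed

text \<open>For each prime the exponents \<open>k \<ge> 2\<close> form a geometric series of ratio
  \<open>p^(-1/2) \<le> 3 / 4\<close>, hence sum to at most \<open>4 / p\<close>;
  \<open>sum_mangoldt_over_le\<close> then gives \<open>4 * 2\<close>.\<close>

lemma sum_mangoldt_nonprime_le:
  assumes "N \<ge> 1"
  shows "(\<Sum>n | n \<in> {1..N} \<and> \<not> prime n. mangoldt n / sqrt (real n)) \<le> 8 * ln (real N)"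
proof -
  define P where "P = {p. prime p \<and> p \<le> N}"
  have finP: "finite P" unfolding P_def by (rule finite_subset[of _ "{..N}"]) auto
  define A where "A = P \<times> {2..N}"
  define f where "f = (\<lambda>n. mangoldt n / sqrt (real n))"
  have "(\<Sum>n | n \<in> {1..N} \<and> \<not> prime n. f n) = (\<Sum>n | n \<in> {1..N} \<and> \<not> prime n \<and> primepow n. f n)"
    by (intro sum.mono_neutral_right) (auto simp: f_def mangoldt_def)
  also have "\<dots> \<le> (\<Sum>n\<in>(\<lambda>(p,k). p ^ k) ` A. f n)"
  proof (rule sum_mono2)
    show "{n. n \<in> {1..N} \<and> \<not> prime n \<and> primepow n} \<subseteq> (\<lambda>(p,k). p ^ k) ` A"
    proof
      fix n assume "n \<in> {n. n \<in> {1..N} \<and> \<not> prime n \<and> primepow n}"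
      then have n: "n \<le> N" "n \<ge> 1" "\<not> prime n" "primepow n" by auto
      then obtain p k where pk: "prime p" "k > 0" "n = p ^ k" by (auto simp: primepow_def)
      have "k \<noteq> 1" using pk n by auto
      then have "k \<ge> 2" using pk by simp
      moreover have "p \<le> p ^ k" using pk prime_gt_0_nat by (intro self_le_power) (auto simp: Suc_le_eq)
      moreover have "k < p ^ k" using pk prime_gt_1_nat by (intro power_gt_expt) auto
      ultimately have "(p, k) \<in> A" using pk n unfolding A_def P_def by auto
      then show "n \<in> (\<lambda>(p,k). p ^ k) ` A" using pk by force
    qed
  qed (auto simp: A_def finP f_def mangoldt_nonneg)
  also have "\<dots> \<le> (\<Sum>x\<in>A. f ((\<lambda>(p,k). p ^ k) x))"
    by (rule sum_image_le[unfolded o_def]) (auto simp: A_def finP f_def mangoldt_nonneg)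
  also have "\<dots> = (\<Sum>p\<in>P. \<Sum>k=2..N. f (p ^ k))"
    unfolding A_def by (simp add: sum.cartesian_product case_prod_unfold)
  also have "\<dots> \<le> (\<Sum>p\<in>P. 4 * (mangoldt p / real p))"
  proof (rule sum_mono)
    fix p assume "p \<in> P"
    then have p: "prime p" by (simp add: P_def)
    define r where "r = 1 / sqrt (real p)"
    have p2: "p \<ge> 2" using p prime_ge_2_nat by blast
    have r0: "r > 0" using p2 by (simp add: r_def)
    have r1: "r \<le> 3 / 4"
    proof -
      have "4 / 3 \<le> sqrt 2" by (rule real_le_rsqrt) (simp add: power2_eq_square)
      also have "\<dots> \<le> sqrt (real p)" using p2 by simp
      finally show ?thesis unfolding r_def by (simp add: divide_simps)
    qed
    have "(\<Sum>k=2..N. f (p ^ k)) = ln (real p) * (\<Sum>k=2..N. r ^ k)"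
      unfolding sum_distrib_left using p
      by (intro sum.cong) (auto simp: f_def r_def real_sqrt_power power_divide)
    also have "(\<Sum>k=2..N. r ^ k) \<le> 4 * r\<^sup>2"
    proof -
      have "(\<Sum>k=2..N. r ^ k) \<le> (\<Sum>k=2..N+2. r ^ k)" using r0 by (intro sum_mono2) auto
      also have "\<dots> = r\<^sup>2 * (\<Sum>k=0..N. r ^ k)"
        unfolding sum_distrib_left power_add[symmetric]
        by (rule sum.reindex_bij_witness[of _ "\<lambda>k. k + 2" "\<lambda>k. k - 2"]) (auto simp: Suc_diff_Suc numeral_2_eq_2 simp flip: power_add power_Suc)
      also have "\<dots> \<le> r\<^sup>2 * 4"
      proof (rule mult_left_mono)
        have "(\<Sum>k=0..N. r ^ k) = (1 - r ^ Suc N) / (1 - r)"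
          using r1 sum_gp0[of r N] by (simp add: atLeast0AtMost)
        also have "\<dots> \<le> 1 / (1 - r)" using r0 r1 by (intro divide_right_mono) auto
        also have "\<dots> \<le> 4" using r1 by (simp add: divide_simps)
        finally show "(\<Sum>k=0..N. r ^ k) \<le> 4" .
      qed simp
      finally show ?thesis by (simp add: mult.commute)
    qed
    also have "r\<^sup>2 = 1 / real p" by (simp add: r_def power_divide)
    finally show "(\<Sum>k=2..N. f (p ^ k)) \<le> 4 * (mangoldt p / real p)"
      using p p2 by (simp add: mult_left_mono mult.commute)
  qed
  also have "\<dots> \<le> (\<Sum>p=1..N. 4 * (mangoldt p / real p))"
    by (rule sum_mono2) (auto simp: P_def mangoldt_nonneg dest: prime_gt_0_nat intro: Suc_leI)
  also have "\<dots> \<le> 4 * (2 * ln (real N))"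
    unfolding sum_distrib_left[symmetric] using sum_mangoldt_over_le[OF assms] by simp
  finally show ?thesis by (simp add: f_def)
qed

lemma sum_log_sq_over_primes_le:
  assumes "N \<ge> 1"
  shows "(\<Sum>p | prime p \<and> p \<le> N. (ln (real p))\<^sup>2 / real p) \<le> 2 * (ln (real N))\<^sup>2"
proof -
  have "(\<Sum>p | prime p \<and> p \<le> N. (ln (real p))\<^sup>2 / real p) \<le> (\<Sum>p | prime p \<and> p \<le> N. ln (real N) * (mangoldt p / real p))"
  proof (rule sum_mono)
    fix p assume p: "p \<in> {p. prime p \<and> p \<le> N}"
    then have "p \<ge> 1" using prime_gt_0_nat by (auto intro: Suc_leI)
    then have "ln (real p) * ln (real p) \<le> ln (real N) * ln (real p)" using p assms
      by (intro mult_right_mono) auto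
    then show "(ln (real p))\<^sup>2 / real p \<le> ln (real N) * (mangoldt p / real p)"
      using p by (simp add: power2_eq_square divide_right_mono)
  qed
  also have "\<dots> \<le> (\<Sum>p=1..N. ln (real N) * (mangoldt p / real p))"
    using assms
    by (intro sum_mono2) (auto simp: mangoldt_nonneg dest: prime_gt_0_nat intro: Suc_leI)
  also have "\<dots> \<le> ln (real N) * (2 * ln (real N))"
    unfolding sum_distrib_left[symmetric] using sum_mangoldt_over_le[OF assms] assms
    by (intro mult_left_mono) auto
  finally show ?thesis by (simp add: power2_eq_square)
qed

section \<open>High moments of prime polynomials\<close>

lemma norm_integral_cis_le:
  fixes d a b :: real
  assumes "d \<noteq> 0" "a \<le> b"
  shows "norm (integral {a..b} (\<lambda>t. cis (d * t))) \<le> 2 / \<bar>d\<bar>"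
proof -
  define F where "F = (\<lambda>t. cis (d * t) / (\<i> * of_real d))"
  have "((\<lambda>t. cis (d * t)) has_integral (F b - F a)) {a..b}"
  proof (rule fundamental_theorem_of_calculus[OF assms(2)])
    fix t assume "t \<in> {a..b}"
    show "(F has_vector_derivative cis (d * t)) (at t within {a..b})"
      unfolding F_def cis_conv_exp using assms(1)
      by (auto intro!: derivative_eq_intros has_vector_derivative_real_field simp: field_simps)
  qed
  then have "integral {a..b} (\<lambda>t. cis (d * t)) = F b - F a" by (rule integral_unique)
  moreover have "norm (F t) = 1 / \<bar>d\<bar>" for t by (simp add: F_def norm_divide norm_mult)
  ultimately show ?thesis using norm_triangle_ineq4[of "F b" "F a"] by simp
qed

text \<open>Spacing for the off-diagonal terms: with \<open>M = N ^ k\<close> every oscillating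
  integral is at most \<open>2 * N ^ k\<close>.\<close>

lemma abs_ln_diff_nat_ge:
  fixes m n M :: nat
  assumes "m \<noteq> n" "m \<ge> 1" "n \<ge> 1" "m \<le> M" "n \<le> M"
  shows "1 / real M \<le> \<bar>ln (real m) - ln (real n)\<bar>"
proof -
  have *: "1 / real M \<le> ln (real m) - ln (real n)" if "n < m" "n \<ge> 1" "m \<le> M" for m n
  proof -
    have "ln (real n / real m) \<le> real n / real m - 1"
      using that by (intro ln_le_minus_one) auto
    then have "1 - real n / real m \<le> ln (real m) - ln (real n)"
      using that by (simp add: ln_div)
    moreover have "1 / real m \<le> 1 - real n / real m" using that by (simp add: field_simps)
    moreover have "1 / real M \<le> 1 / real m" using that by (intro divide_left_mono) auto
    ultimately show ?thesis by linarith
  qed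
  show ?thesis using *[of m n] *[of n m] assms by (cases "m < n") auto
qed

text \<open>Tuples of primes with the same product are permutations of each other, which gives the
  factor \<^term>\<open>fact k\<close> in the diagonal contribution.\<close>
lemma prime_polynomial_moment:
  fixes P :: "nat set" and a :: "nat \<Rightarrow> complex" and T :: real and N k :: nat
  assumes P: "\<And>p. p \<in> P \<Longrightarrow> prime p \<and> p \<le> N" and N: "N \<ge> 1"
    and T: "real N ^ (2 * k) \<le> T"
  shows "integral {T..2 * T} (\<lambda>t. norm (\<Sum>p\<in>P. a p * cis (- t * ln (real p))) ^ (2 * k))
           \<le> 3 * T * fact k * (\<Sum>p\<in>P. (norm (a p))\<^sup>2) ^ k"
proof -
  have T0: "T > 0" using T N by (smt (verit) of_nat_1 of_nat_le_iff one_le_power)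
  have finP: "finite P" using P by (intro finite_subset[of P "{..N}"]) auto
  \<comment> \<open>Index tuples of length \<open>k\<close>, encoded as extensional functions so
    that the power expands by \<open>prod_sum_PiE\<close>.\<close>
  define X where "X = PiE {..<k} (\<lambda>_. P)"
  have finX: "finite X" unfolding X_def using finP by (intro finite_PiE) auto
  define A where "A = (\<lambda>g. \<Prod>i<k. a (g i))"
  define m where "m = (\<lambda>g. \<Prod>i<k. g i :: nat)"
  have gP: "g i \<in> P" if "g \<in> X" "i < k" for g i using that by (auto simp: X_def)
  have m1: "m g \<ge> 1" if "g \<in> X" for g
    unfolding m_def using gP[OF that] P
    by (metis (no_types, lifting) Suc_leI bot_nat_0.not_eq_extremum lessThan_iff not_prime_0 One_nat_def prod_pos)
  have mN: "m g \<le> N ^ k" if "g \<in> X" for g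
  proof -
    have "m g \<le> (\<Prod>i<k. N)" unfolding m_def using gP[OF that] P by (intro prod_mono) auto
    then show ?thesis by simp
  qed
  have same: "image_mset g (mset_set {..<k}) = image_mset h (mset_set {..<k})"
    if "g \<in> X" "h \<in> X" "m g = m h" for g h
  proof -
    have *: "prime_factorization (m g) = image_mset g (mset_set {..<k})" if "g \<in> X" for g
      unfolding m_def prod_unfold_prod_mset
      using gP[OF that] P by (intro prime_factorization_prod_mset_primes) auto
    show ?thesis using *[OF that(1)] *[OF that(2)] that(3) by simp
  qed
  have expand: "(\<Sum>p\<in>P. a p * cis (- t * ln (real p))) ^ k = (\<Sum>g\<in>X. A g * cis (- t * ln (real (m g))))" for t
  proof -
    have "(\<Sum>p\<in>P. a p * cis (- t * ln (real p))) ^ k = (\<Prod>i<k. \<Sum>p\<in>P. a p * cis (- t * ln (real p)))"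
      by simp
    also have "\<dots> = (\<Sum>g\<in>X. \<Prod>i<k. a (g i) * cis (- t * ln (real (g i))))"
      unfolding X_def using finP by (intro prod_sum_PiE) auto
    also have "\<dots> = (\<Sum>g\<in>X. A g * cis (- t * ln (real (m g))))"
    proof (intro sum.cong refl)
      fix g assume g: "g \<in> X"
      have "(\<Prod>i<j. cis (- t * ln (real (g i)))) = cis (- t * ln (\<Prod>i<j. real (g i)))" if "j \<le> k" for j
        using that
      proof (induction j)
        case (Suc j)
        have pos: "real (g i) > 0" if "i \<le> j" for i
          using gP[OF g, of i] P Suc.prems that prime_gt_0_nat by auto
        have "ln ((\<Prod>i<j. real (g i)) * real (g j)) = ln (\<Prod>i<j. real (g i)) + ln (real (g j))"
          using pos by (intro ln_mult_pos prod_pos) auto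
        then show ?case using Suc by (simp add: cis_mult algebra_simps)
      qed simp
      then show "(\<Prod>i<k. a (g i) * cis (- t * ln (real (g i)))) = A g * cis (- t * ln (real (m g)))"
        by (simp add: prod.distrib A_def m_def)
    qed
    finally show ?thesis .
  qed
  define I where "I = (\<lambda>g h. integral {T..2 * T} (\<lambda>t. cis ((ln (real (m h)) - ln (real (m g))) * t)))"
  have sq: "complex_of_real (norm (\<Sum>p\<in>P. a p * cis (- t * ln (real p))) ^ (2 * k))
     = (\<Sum>g\<in>X. \<Sum>h\<in>X. A g * cnj (A h) * cis ((ln (real (m h)) - ln (real (m g))) * t))" for t
  proof -
    have "complex_of_real (norm (\<Sum>p\<in>P. a p * cis (- t * ln (real p))) ^ (2 * k))
       = complex_of_real ((norm ((\<Sum>p\<in>P. a p * cis (- t * ln (real p))) ^ k))\<^sup>2)"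
      by (simp add: norm_power power_mult mult.commute)
    also have "\<dots> = (\<Sum>g\<in>X. A g * cis (- t * ln (real (m g)))) * cnj (\<Sum>h\<in>X. A h * cis (- t * ln (real (m h))))"
      unfolding expand by (simp only: complex_norm_square)
    also have "\<dots> = (\<Sum>g\<in>X. \<Sum>h\<in>X. (A g * cis (- t * ln (real (m g)))) * cnj (A h * cis (- t * ln (real (m h)))))"
      by (simp add: sum_product)
    also have "\<dots> = (\<Sum>g\<in>X. \<Sum>h\<in>X. A g * cnj (A h) * cis ((ln (real (m h)) - ln (real (m g))) * t))"
    proof (intro sum.cong refl)
      fix g h
      have "cis (- t * ln (real (m g))) * cis (t * ln (real (m h))) = cis ((ln (real (m h)) - ln (real (m g))) * t)"
        by (simp add: cis_mult algebra_simps)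
      then show "A g * cis (- t * ln (real (m g))) * cnj (A h * cis (- t * ln (real (m h)))) =
        A g * cnj (A h) * cis ((ln (real (m h)) - ln (real (m g))) * t)"
        by (simp add: cis_cnj mult_ac)
    qed
    finally show ?thesis .
  qed
  have cont: "(\<lambda>t. cis ((ln (real (m h)) - ln (real (m g))) * t)) integrable_on {T..2 * T}" for g h
    by (intro integrable_continuous_real continuous_intros)
  have "complex_of_real (integral {T..2 * T} (\<lambda>t. norm (\<Sum>p\<in>P. a p * cis (- t * ln (real p))) ^ (2 * k)))
     = integral {T..2 * T} (\<lambda>t. complex_of_real (norm (\<Sum>p\<in>P. a p * cis (- t * ln (real p))) ^ (2 * k)))"
  proof -
    have "(\<lambda>t. norm (\<Sum>p\<in>P. a p * cis (- t * ln (real p))) ^ (2 * k)) integrable_on {T..2 * T}"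
      by (intro integrable_continuous_real continuous_intros)
    from integral_linear[OF this, of complex_of_real] show ?thesis
      by (simp add: o_def bounded_linear_of_real)
  qed
  also have "\<dots> = (\<Sum>g\<in>X. \<Sum>h\<in>X. A g * cnj (A h) * I g h)"
    unfolding sq I_def
    using cont by (simp add: integral_sum finX integrable_sum integrable_on_mult_right)
  finally have "integral {T..2 * T} (\<lambda>t. norm (\<Sum>p\<in>P. a p * cis (- t * ln (real p))) ^ (2 * k))
     = Re (\<Sum>g\<in>X. \<Sum>h\<in>X. A g * cnj (A h) * I g h)" by (metis Re_complex_of_real)
  also have "\<dots> \<le> norm (\<Sum>g\<in>X. \<Sum>h\<in>X. A g * cnj (A h) * I g h)" by (rule complex_Re_le_cmod)
  also have "\<dots> \<le> (\<Sum>g\<in>X. \<Sum>h\<in>X. norm (A g) * norm (A h) * norm (I g h))"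
    by (intro sum_norm_le order.trans[OF norm_sum] sum_mono) (simp add: norm_mult)
  \<comment> \<open>Diagonal pairs carry the interval length \<open>T\<close>, all others at most
    \<open>2 * N ^ k\<close>. The second summand is granted to every pair so that its double sum is
    a square.\<close>
  also have "\<dots> \<le> (\<Sum>g\<in>X. \<Sum>h\<in>X. (if m h = m g then T * (norm (A g))\<^sup>2 else 0) + 2 * real N ^ k * (norm (A g) * norm (A h)))"
  proof (intro sum_mono)
    fix g h assume gh: "g \<in> X" "h \<in> X"
    show "norm (A g) * norm (A h) * norm (I g h) \<le>
       (if m h = m g then T * (norm (A g))\<^sup>2 else 0) + 2 * real N ^ k * (norm (A g) * norm (A h))"
    proof (cases "m h = m g")
      case True
      have "image_mset g (mset_set {..<k}) = image_mset h (mset_set {..<k})"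
        using same[OF gh True[symmetric]] .
      then have "image_mset (\<lambda>i. norm (a i)) (image_mset g (mset_set {..<k})) = image_mset (\<lambda>i. norm (a i)) (image_mset h (mset_set {..<k}))"
        by simp
      then have "norm (A g) = norm (A h)"
        unfolding A_def prod_norm[symmetric] unfolding prod_unfold_prod_mset by (simp add: multiset.map_comp o_def)
      moreover have "norm (I g h) = T" using True T0 by (simp add: I_def)
      ultimately show ?thesis using True T0 by (simp add: power2_eq_square)
    next
      case False
      have d: "1 / real (N ^ k) \<le> \<bar>ln (real (m h)) - ln (real (m g))\<bar>"
        using False gh m1 mN by (intro abs_ln_diff_nat_ge) auto
      have Nk: "real N ^ k > 0" using N by simp
      have dpos: "\<bar>ln (real (m h)) - ln (real (m g))\<bar> > 0"
        using Nk by (intro less_le_trans[OF _ d]) simp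
      have "norm (I g h) \<le> 2 / \<bar>ln (real (m h)) - ln (real (m g))\<bar>"
        unfolding I_def using dpos T0 by (intro norm_integral_cis_le) auto
      also have "\<dots> \<le> 2 / (1 / real (N ^ k))"
        using d Nk dpos by (intro divide_left_mono mult_pos_pos) auto
      finally have "norm (I g h) \<le> 2 * real N ^ k" by simp
      then have "norm (A g) * norm (A h) * norm (I g h) \<le> norm (A g) * norm (A h) * (2 * real N ^ k)"
        by (intro mult_left_mono) auto
      then show ?thesis using False by (simp add: mult_ac)
    qed
  qed
  also have "\<dots> = (\<Sum>g\<in>X. T * (norm (A g))\<^sup>2 * real (card {h \<in> X. m h = m g})) + 2 * real N ^ k * (\<Sum>g\<in>X. norm (A g))\<^sup>2"
    by (simp add: sum.distrib sum_product power2_eq_square sum_distrib_left sum.inter_filter[symmetric] finX mult_ac)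
  also have "\<dots> \<le> (\<Sum>g\<in>X. T * (norm (A g))\<^sup>2 * fact k) + 2 * real N ^ k * (\<Sum>g\<in>X. norm (A g))\<^sup>2"
  proof (intro add_right_mono sum_mono mult_left_mono)
    fix g assume g: "g \<in> X"
    have "{h \<in> X. m h = m g} \<subseteq> (\<lambda>\<pi>. restrict (g \<circ> \<pi>) {..<k}) ` {\<pi>. \<pi> permutes {..<k}}"
    proof
      fix h assume "h \<in> {h \<in> X. m h = m g}"
      then have h: "h \<in> X" "m h = m g" by auto
      have "image_mset h (mset_set {..<k}) = image_mset g (mset_set {..<k})"
        using same[OF h(1) g h(2)] .
      then obtain \<pi> where \<pi>: "\<pi> permutes {..<k}" "\<forall>x\<in>{..<k}. h x = g (\<pi> x)"
        using image_mset_eq_implies_permutes[of "{..<k}" h g] by auto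
      have "h = restrict (g \<circ> \<pi>) {..<k}"
        using h(1) \<pi> unfolding X_def by (auto simp: PiE_def extensional_def restrict_def fun_eq_iff)
      then show "h \<in> (\<lambda>\<pi>. restrict (g \<circ> \<pi>) {..<k}) ` {\<pi>. \<pi> permutes {..<k}}" using \<pi> by blast
    qed
    then have "card {h \<in> X. m h = m g} \<le> card {\<pi>. \<pi> permutes {..<k}}"
      by (rule surj_card_le[OF finite_permutations[OF finite_lessThan]])
    also have "\<dots> = fact k" by (simp add: card_permutations)
    finally show "real (card {h \<in> X. m h = m g}) \<le> fact k" by (metis of_nat_fact of_nat_le_iff)
  qed (use T0 in auto)
  also have "(\<Sum>g\<in>X. T * (norm (A g))\<^sup>2 * fact k) = T * fact k * (\<Sum>p\<in>P. (norm (a p))\<^sup>2) ^ k"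
  proof -
    have "(\<Sum>p\<in>P. (norm (a p))\<^sup>2) ^ k = (\<Prod>i<k. \<Sum>p\<in>P. (norm (a p))\<^sup>2)" by simp
    also have "\<dots> = (\<Sum>g\<in>X. \<Prod>i<k. (norm (a (g i)))\<^sup>2)"
      unfolding X_def using finP by (intro prod_sum_PiE) auto
    also have "\<dots> = (\<Sum>g\<in>X. (norm (A g))\<^sup>2)"
      by (simp add: A_def prod_norm[symmetric] prod_power_distrib)
    finally show ?thesis by (simp add: sum_distrib_left mult_ac)
  qed
  \<comment> \<open>By Cauchy-Schwarz the off-diagonal part costs a further \<open>N ^ k\<close>,
    and \<open>N ^ (2 * k) \<le> T\<close> makes it at most twice the diagonal bound; hence the
    constant 3.\<close>
  also have "2 * real N ^ k * (\<Sum>g\<in>X. norm (A g))\<^sup>2 \<le> 2 * T * fact k * (\<Sum>p\<in>P. (norm (a p))\<^sup>2) ^ k"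
  proof -
    have "(\<Sum>g\<in>X. norm (A g)) = (\<Sum>g\<in>X. \<Prod>i<k. norm (a (g i)))"
      by (simp add: A_def prod_norm)
    also have "\<dots> = (\<Prod>i<k. \<Sum>p\<in>P. norm (a p))"
      unfolding X_def using finP by (intro prod_sum_PiE[symmetric]) auto
    finally have "(\<Sum>g\<in>X. norm (A g))\<^sup>2 = ((\<Sum>p\<in>P. norm (a p))\<^sup>2) ^ k"
      by (simp add: power_mult[symmetric] mult.commute)
    also have "\<dots> \<le> (real N * (\<Sum>p\<in>P. (norm (a p))\<^sup>2)) ^ k"
    proof (rule power_mono)
      have "(\<Sum>p\<in>P. norm (a p))\<^sup>2 \<le> (\<Sum>p\<in>P. (norm (a p))\<^sup>2) * (\<Sum>p\<in>P. 1\<^sup>2)"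
        using Cauchy_Schwarz_ineq_sum[of "\<lambda>p. norm (a p)" "\<lambda>_. 1" P] by simp
      moreover have "card P \<le> N" using P prime_gt_0_nat
        by (intro order.trans[OF card_mono[of "{1..N}" P]]) (auto intro!: Suc_leI)
      then have "(\<Sum>p\<in>P. (norm (a p))\<^sup>2) * real (card P) \<le> (\<Sum>p\<in>P. (norm (a p))\<^sup>2) * real N"
        by (intro mult_left_mono sum_nonneg) auto
      ultimately show "(\<Sum>p\<in>P. norm (a p))\<^sup>2 \<le> real N * (\<Sum>p\<in>P. (norm (a p))\<^sup>2)"
        by (simp add: mult.commute)
    qed auto
    finally have "2 * real N ^ k * (\<Sum>g\<in>X. norm (A g))\<^sup>2 \<le> 2 * real N ^ k * (real N * (\<Sum>p\<in>P. (norm (a p))\<^sup>2)) ^ k"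
      by (intro mult_left_mono) auto
    also have "\<dots> = 2 * real N ^ (2 * k) * (\<Sum>p\<in>P. (norm (a p))\<^sup>2) ^ k"
      by (simp add: power_mult_distrib mult_ac flip: power_add mult_2)
    also have "\<dots> \<le> 2 * (T * fact k) * (\<Sum>p\<in>P. (norm (a p))\<^sup>2) ^ k"
    proof (intro mult_right_mono mult_left_mono)
      have "T * 1 \<le> T * fact k" using T0 by (intro mult_left_mono) auto
      then show "real N ^ (2 * k) \<le> T * fact k" using T by simp
    qed (auto intro!: zero_le_power sum_nonneg)
    finally show ?thesis by (simp add: mult_ac)
  qed
  finally show ?thesis by (simp add: algebra_simps)
qed

section \<open>The tail bound\<close>

definition kern_total :: real where "kern_total = (LINT q|lborel. kern_real q)"

lemma integrable_indicator_Icc: "integrable lborel (\<lambda>q. c * indicator {-1..1::real} q :: real)"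
  by (intro integrable_mult_right integrable_real_indicator) auto

lemma integral_indicator_Icc: "(LINT q|lborel. c * indicator {-1..1::real} q) = 2 * (c::real)"
  by simp

lemma kern_total_ge: "kern_total \<ge> 1 / 8"
proof -
  have "(LINT q|lborel. 1 / 16 * indicator {-1..1::real} q) \<le> kern_total"
    unfolding kern_total_def
  proof (rule integral_mono[OF integrable_indicator_Icc kern_real_integrable])
    show "1 / 16 * indicator {-1..1} q \<le> kern_real q" for q
      using kern_real_ge[of q] kern_real_nonneg[of q] by (auto simp: indicator_def abs_le_iff)
  qed
  then show ?thesis unfolding integral_indicator_Icc by simp
qed

lemma norm_kern_hat_le: "norm (kern_hat l) \<le> kern_total"
proof -
  have "norm (kern_hat l) \<le> (LINT q|lborel. norm (exp (\<i> * of_real (l * q)) * kern (of_real q)))"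
    unfolding kern_hat_def by (rule integral_norm_bound)
  also have "\<dots> = kern_total"
    unfolding kern_total_def using kern_real_nonneg by (simp add: norm_mult kern_of_real)
  finally show ?thesis .
qed

lemma ln_le_mult_ln:
  assumes T: "T \<ge> 2" and x: "0 < x" "x \<le> T ^ m" shows "ln x \<le> real m * ln T"
proof -
  have "ln x \<le> ln (T ^ m)" using assms by (subst ln_le_cancel_iff) auto
  also have "\<dots> = real m * ln T" using T by (intro ln_realpow)
  finally show ?thesis .
qed

lemma ln_ge_half: "T \<ge> 2 \<Longrightarrow> ln T \<ge> 1 / 2" for T :: real
proof -
  assume T: "T \<ge> 2"
  have "1 / 2 \<le> ln (2::real)" using ln2_ge_two_thirds by simp
  also have "\<dots> \<le> ln T" using T by simp
  finally show ?thesis .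
qed

section \<open>A deterministic bound for the pairing\<close>

context rh_xi
begin

definition smoothed_ldf :: "real \<Rightarrow> real \<Rightarrow> complex" where
  "smoothed_ldf Y t = (LINT q|lborel. ldf (Complex Y (t - Y * q)) * of_real (kern_real q))"

lemma integrable_smoothed_ldf:
  assumes Y: "0 < Y" "Y \<le> 1"
  shows "integrable lborel (\<lambda>q. ldf (Complex Y (t - Y * q)) * of_real (kern_real q))"
proof -
  obtain K where K: "K \<ge> 0" "\<And>z. Re z \<ge> Y \<Longrightarrow> norm (ldf z) \<le> K * (1 + norm (z - of_real Y))\<^sup>2"
    using ldf_growth_quadratic[OF Y(1)] by metis
  show ?thesis
  proof (rule integrable_mult_kern_real[where C = "K * (1 + \<bar>t\<bar>)\<^sup>2"])
    show "continuous_on UNIV (\<lambda>q. ldf (Complex Y (t - Y * q)))"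
      by (rule continuous_on_compose2[OF holomorphic_on_imp_continuous_on[OF holomorphic_ldf]])
         (use Y in \<open>auto intro!: continuous_Complex continuous_intros\<close>)
    fix q
    have e: "Complex Y (t - Y * q) - of_real Y = \<i> * of_real (t - Y * q)" by (simp add: complex_eq_iff)
    have "\<bar>Y * q\<bar> \<le> \<bar>q\<bar>" using Y by (simp add: abs_mult mult_left_le_one_le)
    then have "1 + \<bar>t - Y * q\<bar> \<le> 1 + \<bar>t\<bar> + \<bar>q\<bar>" by linarith
    also have "\<dots> \<le> 1 + \<bar>t\<bar> + \<bar>q\<bar> + \<bar>t\<bar> * \<bar>q\<bar>" by simp
    also have "\<dots> = (1 + \<bar>t\<bar>) * (1 + \<bar>q\<bar>)" by (simp add: algebra_simps)
    finally have "(1 + \<bar>t - Y * q\<bar>)\<^sup>2 \<le> ((1 + \<bar>t\<bar>) * (1 + \<bar>q\<bar>))\<^sup>2" by (intro power_mono) auto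
    then have "K * (1 + \<bar>t - Y * q\<bar>)\<^sup>2 \<le> K * ((1 + \<bar>t\<bar>) * (1 + \<bar>q\<bar>))\<^sup>2" using K by (intro mult_left_mono) auto
    moreover have "norm (ldf (Complex Y (t - Y * q))) \<le> K * (1 + \<bar>t - Y * q\<bar>)\<^sup>2"
      using K(2)[of "Complex Y (t - Y * q)"] unfolding e norm_mult norm_ii norm_of_real by simp
    ultimately show "norm (ldf (Complex Y (t - Y * q))) \<le> K * (1 + \<bar>t\<bar>)\<^sup>2 * (1 + \<bar>q\<bar>)\<^sup>2"
      by (simp add: power_mult_distrib mult_ac)
  qed
qed

text \<open>Kernel and \<open>Re ldf\<close> are nonnegative, so the average may be cut to
  \<open>|q| \<le> 1\<close>; there Harnack gives \<open>1 / 4\<close>, the kernel gives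
  \<open>1 / 16\<close>, and the window has length 2.\<close>

lemma Re_ldf_le_smoothed:
  assumes Y: "0 < Y" "Y \<le> 1"
  shows "Re (ldf (Complex Y t)) \<le> 32 * norm (smoothed_ldf Y t)"
proof -
  define R where "R = Re (ldf (Complex Y t))"
  have R: "R \<ge> 0" unfolding R_def using Y by (intro Re_ldf_nonneg) auto
  note int = integrable_smoothed_ldf[OF Y, of t]
  have "2 * (R / 64) = (LINT q|lborel. R / 64 * indicator {-1..1::real} q)" by (rule integral_indicator_Icc[symmetric])
  also have "\<dots> \<le> (LINT q|lborel. Re (ldf (Complex Y (t - Y * q)) * of_real (kern_real q)))"
  proof (rule integral_mono[OF integrable_indicator_Icc integrable_Re[OF int]])
    fix q :: real
    have n: "Re (ldf (Complex Y (t - Y * q))) \<ge> 0" using Y by (intro Re_ldf_nonneg) auto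
    show "R / 64 * indicator {-1..1} q \<le> Re (ldf (Complex Y (t - Y * q)) * of_real (kern_real q))"
    proof (cases "q \<in> {-1..1}")
      case True
      then have q: "\<bar>q\<bar> \<le> 1" by auto
      have "R / 64 = (R / 4) * (1 / 16)" by simp
      also have "\<dots> \<le> Re (ldf (Complex Y (t - Y * q))) * kern_real q"
        using Re_ldf_Harnack[OF Y(1) q, of t] kern_real_ge[OF q] n by (intro mult_mono) (auto simp: R_def)
      finally show ?thesis using True by simp
    qed (use n kern_real_nonneg in \<open>auto simp: indicator_def\<close>)
  qed
  also have "\<dots> = Re (smoothed_ldf Y t)" unfolding smoothed_ldf_def by (rule integral_Re[OF int])
  also have "\<dots> \<le> norm (smoothed_ldf Y t)" by (rule complex_Re_le_cmod)
  finally show ?thesis by (simp add: R_def)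
qed

text \<open>\<open>ldf_compare\<close> is averaged against the kernel. Its right side is a value of
  \<open>Re ldf\<close> on the line \<open>Y\<close>, itself bounded by the same average, so the
  estimate closes. The 8 is from \<open>kern_total \<ge> 1 / 8\<close>, the 192 is
  \<open>6 * 32\<close>, and the 2 is from \<open>a \<le> 2 * Y\<close>.\<close>

lemma ldf_le_smoothed:
  assumes Y: "0 < Y" "Y \<le> 1" and a: "0 < a" "a \<le> 2 * Y"
  shows "a * norm (ldf (Complex a t)) \<le> 8 * (2 + 192 * 20736 * kern_mass) * (Y * norm (smoothed_ldf Y t))"
proof -
  define E where "E = smoothed_ldf Y t"
  define R where "R = Re (ldf (Complex Y t))"
  define za where "za = ldf (Complex a t)"
  have R: "R \<ge> 0" unfolding R_def using Y by (intro Re_ldf_nonneg) auto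
  note int = integrable_smoothed_ldf[OF Y, of t]
  have ki: "integrable lborel (\<lambda>q. complex_of_real (kern_real q))" by (intro integrable_of_real kern_real_integrable)
  have kt: "(LINT q|lborel. complex_of_real (kern_real q)) = of_real kern_total"
    unfolding kern_total_def by (rule integral_complex_of_real)
  have di: "integrable lborel (\<lambda>q. za * of_real (kern_real q) - ldf (Complex Y (t - Y * q)) * of_real (kern_real q))"
    by (intro Bochner_Integration.integrable_diff integrable_mult_right ki int)
  have "norm (of_real a * (za * of_real kern_total - E)) =
     norm (LINT q|lborel. of_real a * (za * of_real (kern_real q) - ldf (Complex Y (t - Y * q)) * of_real (kern_real q)))"
    unfolding integral_mult_right_zero
    by (subst Bochner_Integration.integral_diff[OF integrable_mult_right[OF ki] int])
       (simp only: integral_mult_right_zero kt E_def smoothed_ldf_def)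
  also have "\<dots> \<le> (LINT q|lborel. (6 * Y * R * 20736) * (1 / (1 + q\<^sup>2)))"
  proof (rule Bochner_Integration.integral_norm_bound_integral)
    show "integrable lborel (\<lambda>q. of_real a * (za * of_real (kern_real q) - ldf (Complex Y (t - Y * q)) * of_real (kern_real q)))"
      by (intro integrable_mult_right di)
    show "integrable lborel (\<lambda>q::real. (6 * Y * R * 20736) * (1 / (1 + q\<^sup>2)))"
      by (intro integrable_mult_right integrable_inverse_one_plus_sq)
    fix q :: real
    have "norm (of_real a * (za * of_real (kern_real q) - ldf (Complex Y (t - Y * q)) * of_real (kern_real q)))
       = (a * norm (za - ldf (Complex Y (t - Y * q)))) * kern_real q"
      using a kern_real_nonneg[of q] by (simp add: norm_mult flip: left_diff_distrib)
    also have "\<dots> \<le> (6 * Y * (1 + \<bar>q\<bar>)\<^sup>2 * R) * kern_real q"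
      unfolding za_def R_def by (intro mult_right_mono ldf_compare kern_real_nonneg a Y)
    also have "\<dots> = (6 * Y * R) * ((1 + \<bar>q\<bar>)\<^sup>2 * kern_real q)" by simp
    also have "\<dots> \<le> (6 * Y * R) * (20736 / (1 + q\<^sup>2))"
      using Y R by (intro mult_left_mono kern_real_weight_le) auto
    finally show "norm (of_real a * (za * of_real (kern_real q) - ldf (Complex Y (t - Y * q)) * of_real (kern_real q)))
       \<le> (6 * Y * R * 20736) * (1 / (1 + q\<^sup>2))" by simp
  qed
  also have "\<dots> = 6 * Y * R * 20736 * kern_mass" unfolding kern_mass_def by (rule integral_mult_right_zero)
  also have "\<dots> \<le> 6 * Y * (32 * norm E) * 20736 * kern_mass"
    using Re_ldf_le_smoothed[OF Y, of t] kern_mass_pos Y unfolding R_def E_def by (intro mult_right_mono mult_left_mono) auto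
  finally have 1: "norm (of_real a * (za * of_real kern_total - E)) \<le> 192 * 20736 * kern_mass * (Y * norm E)"
    by (simp add: mult_ac)
  have "1 / 8 * (a * norm za) \<le> kern_total * (a * norm za)"
    using kern_total_ge a by (intro mult_right_mono) auto
  also have "\<dots> = norm (of_real a * (za * of_real kern_total - E) + of_real a * E)"
    using a kern_total_ge by (simp add: algebra_simps norm_mult)
  also have "\<dots> \<le> 192 * 20736 * kern_mass * (Y * norm E) + a * norm E"
    using a by (intro order.trans[OF norm_triangle_ineq] add_mono 1) (simp add: norm_mult)
  also have "a * norm E \<le> 2 * Y * norm E" using a by (intro mult_right_mono) auto
  finally show ?thesis unfolding za_def E_def by (simp add: algebra_simps)
qed

lemma smoothed_ldf_bound:
  assumes Y: "0 < Y" "Y \<le> 1"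
  shows "norm (smoothed_ldf Y t) \<le> norm (dirichlet_poly Y t) + 2 * 20736 * kern_mass * (exp (3 / Y) / (1 + \<bar>t\<bar>))
     + 19 * 20736 * kern_mass * ln (4 + \<bar>t\<bar>)"
proof -
  define g where "g = (\<lambda>q. gamma_psi (Complex Y (t - Y * q)) / 2 + 1 / (1 / 2 + Complex Y (t - Y * q)))"
  have eq: "ldf (Complex Y (t - Y * q)) * of_real (kern_real q) = hfun (Complex Y (t - Y * q)) * kern (of_real q) + g q * of_real (kern_real q)" for q
    by (simp add: hfun_def g_def kern_of_real algebra_simps)
  have l0: "ln (4 + \<bar>t\<bar>) \<ge> 0" by simp
  have gb: "norm (g q) \<le> 19 * ln (4 + \<bar>t\<bar>) * (1 + \<bar>q\<bar>)\<^sup>2" for q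
    unfolding g_def by (rule gamma_terms_bound[OF Y])
  have gi: "integrable lborel (\<lambda>q. g q * of_real (kern_real q))"
  proof -
    have "(\<lambda>q. ldf (Complex Y (t - Y * q)) * of_real (kern_real q) - hfun (Complex Y (t - Y * q)) * kern (of_real q)) = (\<lambda>q. g q * of_real (kern_real q))"
      by (simp add: eq)
    moreover have "integrable lborel (\<lambda>q. ldf (Complex Y (t - Y * q)) * of_real (kern_real q) - hfun (Complex Y (t - Y * q)) * kern (of_real q))"
      by (intro Bochner_Integration.integrable_diff integrable_smoothed_ldf hfun_smoothed(1) Y)
    ultimately show ?thesis by simp
  qed
  have "smoothed_ldf Y t = (LINT q|lborel. hfun (Complex Y (t - Y * q)) * kern (of_real q)) + (LINT q|lborel. g q * of_real (kern_real q))"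
    unfolding smoothed_ldf_def eq by (rule Bochner_Integration.integral_add[OF hfun_smoothed(1)[OF Y] gi])
  then have "smoothed_ldf Y t = ((LINT q|lborel. hfun (Complex Y (t - Y * q)) * kern (of_real q)) + dirichlet_poly Y t)
      + (LINT q|lborel. g q * of_real (kern_real q)) - dirichlet_poly Y t" by simp
  also have "norm \<dots> \<le> (norm ((LINT q|lborel. hfun (Complex Y (t - Y * q)) * kern (of_real q)) + dirichlet_poly Y t)
      + norm (LINT q|lborel. g q * of_real (kern_real q))) + norm (dirichlet_poly Y t)"
    by (intro order.trans[OF norm_triangle_ineq4] add_mono norm_triangle_ineq) auto
  also have "norm (LINT q|lborel. g q * of_real (kern_real q)) \<le> (LINT q|lborel. (19 * ln (4 + \<bar>t\<bar>) * 20736) * (1 / (1 + q\<^sup>2)))"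
  proof (rule Bochner_Integration.integral_norm_bound_integral[OF gi])
    show "integrable lborel (\<lambda>q::real. (19 * ln (4 + \<bar>t\<bar>) * 20736) * (1 / (1 + q\<^sup>2)))"
      by (intro integrable_mult_right integrable_inverse_one_plus_sq)
    fix q :: real
    have "norm (g q * of_real (kern_real q)) \<le> (19 * ln (4 + \<bar>t\<bar>) * (1 + \<bar>q\<bar>)\<^sup>2) * kern_real q"
      using mult_right_mono[OF gb[of q] kern_real_nonneg[of q]] kern_real_nonneg[of q] by (simp add: norm_mult)
    also have "\<dots> = 19 * ln (4 + \<bar>t\<bar>) * ((1 + \<bar>q\<bar>)\<^sup>2 * kern_real q)" by simp
    also have "\<dots> \<le> 19 * ln (4 + \<bar>t\<bar>) * (20736 / (1 + q\<^sup>2))"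
      using l0 by (intro mult_left_mono kern_real_weight_le) auto
    finally show "norm (g q * of_real (kern_real q)) \<le> (19 * ln (4 + \<bar>t\<bar>) * 20736) * (1 / (1 + q\<^sup>2))" by simp
  qed
  also have "\<dots> = 19 * ln (4 + \<bar>t\<bar>) * 20736 * kern_mass" unfolding kern_mass_def by (rule integral_mult_right_zero)
  finally show ?thesis using hfun_smoothed(2)[OF Y, of t] by (simp add: mult_ac)
qed

text \<open>The condition \<open>exp (3 / Y) \<le> exp 3 * T\<close> admits both
  \<open>Y = 1\<close> and any \<open>Y \<ge> 3 / ln T\<close>. It makes the pole term bounded,
  while the archimedean terms on the line \<open>Y\<close> cost \<open>Y * ln T\<close>.\<close>

lemma zeta_pairing_bound:
  "\<exists>C\<ge>1. \<forall>T\<ge>2. \<forall>t\<in>{T..2 * T}. \<forall>Y. 0 < Y \<and> Y \<le> 1 \<and> 1 / ln T \<le> 2 * Y \<and> exp (3 / Y) \<le> exp 3 * T \<longrightarrow>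
     \<bar>zeta_pairing J T t\<bar> \<le> C * (Y * norm (dirichlet_poly Y t) + Y * ln T + 1)"
proof -
  define m where "m = kern_mass"
  have m: "m \<ge> 0" unfolding m_def by (rule kern_mass_pos)
  define A where "A = 8 * (2 + 192 * 20736 * m)"
  have A: "A \<ge> 1" using m by (simp add: A_def)
  define B where "B = 2 * 20736 * m * exp 3"
  define D where "D = 19 * 20736 * m * 3"
  have BD: "B \<ge> 0" "D \<ge> 0" using m by (auto simp: B_def D_def)
  define C where "C = A * (1 + B + D) + 66"
  have "\<bar>zeta_pairing J T t\<bar> \<le> C * (Y * norm (dirichlet_poly Y t) + Y * ln T + 1)"
    if T: "T \<ge> 2" and t: "t \<in> {T..2 * T}" and Y: "0 < Y" "Y \<le> 1" "1 / ln T \<le> 2 * Y" "exp (3 / Y) \<le> exp 3 * T" for T t Y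
  proof -
    define L where "L = ln T"
    have L: "L \<ge> 1 / 2" unfolding L_def by (rule ln_ge_half[OF T])
    define a where "a = 1 / L"
    have a: "0 < a" "a \<le> 2" "a \<le> 2 * Y" using L Y(3) by (auto simp: a_def L_def divide_simps)
    define d where "d = norm (dirichlet_poly Y t)"
    have d: "d \<ge> 0" by (simp add: d_def)
    have tp: "t > 0" "\<bar>t\<bar> = t" using T t by auto
    have T2: "4 \<le> T\<^sup>2" "T\<^sup>2 * T = T ^ 3" using power_mono[of 2 T 2] T by (auto simp: power2_eq_square power3_eq_cube)
    have T3: "4 * T \<le> T ^ 3" using mult_right_mono[OF T2(1), of T] T T2(2) by simp
    have T4: "T ^ 3 * T = T ^ 4" by (simp add: power_numeral_reduce)
    have T3b: "2 * T ^ 3 \<le> T ^ 4" using mult_left_mono[OF T, of "T ^ 3"] T T4 by simp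
    have l1: "ln (4 + \<bar>t\<bar>) \<le> 3 * L"
      using ln_le_mult_ln[OF T, of "4 + \<bar>t\<bar>" 3] T3 T t tp unfolding L_def by simp
    have l2: "ln (3 + norm (Complex a t)) \<le> 4 * L"
    proof -
      have "norm (Complex a t) \<le> 2 + 2 * T" using cmod_le[of "Complex a t"] a t tp by simp
      then have "3 + norm (Complex a t) \<le> T ^ 4" using T3 T3b T by linarith
      then show ?thesis using ln_le_mult_ln[OF T, of "3 + norm (Complex a t)" 4] unfolding L_def
        by (simp add: add_pos_nonneg)
    qed
    have e: "exp (3 / Y) / (1 + \<bar>t\<bar>) \<le> exp 3"
    proof -
      have "exp 3 * T \<le> exp 3 * (1 + \<bar>t\<bar>)" using t tp by (intro mult_left_mono) auto
      then have "exp (3 / Y) \<le> exp 3 * (1 + \<bar>t\<bar>)" using Y(4) by linarith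
      then show ?thesis using tp by (simp add: divide_le_eq)
    qed
    have "norm (smoothed_ldf Y t) \<le> d + 2 * 20736 * m * (exp (3 / Y) / (1 + \<bar>t\<bar>)) + 19 * 20736 * m * ln (4 + \<bar>t\<bar>)"
      unfolding d_def m_def by (rule smoothed_ldf_bound[OF Y(1,2)])
    also have "\<dots> \<le> d + 2 * 20736 * m * exp 3 + 19 * 20736 * m * (3 * L)"
      using e l1 m by (intro add_mono mult_left_mono) auto
    also have "\<dots> = d + B + D * L" by (simp add: B_def D_def)
    finally have sm: "norm (smoothed_ldf Y t) \<le> d + B + D * L" .
    have "\<bar>zeta_pairing J T t\<bar> = a * \<bar>Im (ldf (Complex a t) - gamma_psi (Complex a t) / 2)\<bar>"
      using zeta_pairing_eq[of T t] T a unfolding a_def L_def by (simp add: abs_mult)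
    also have "\<dots> \<le> a * (norm (ldf (Complex a t)) + norm (gamma_psi (Complex a t) / 2))"
      using a by (intro mult_left_mono order.trans[OF abs_Im_le_cmod] norm_triangle_ineq4) auto
    also have "\<dots> = a * norm (ldf (Complex a t)) + a * norm (gamma_psi (Complex a t) / 2)" by (simp add: distrib_left)
    also have "a * norm (ldf (Complex a t)) \<le> A * (Y * norm (smoothed_ldf Y t))"
      unfolding A_def m_def by (rule ldf_le_smoothed[OF Y(1,2) a(1,3)])
    also have "\<dots> \<le> A * (Y * (d + B + D * L))" using sm A Y by (intro mult_left_mono) auto
    \<comment> \<open>At \<open>a = 1 / L\<close> the archimedean term is of size \<open>L\<close>,
      so multiplication by \<open>a\<close> makes it bounded.\<close>
    also have "a * norm (gamma_psi (Complex a t) / 2) \<le> a * (66 * L)"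
    proof (rule mult_left_mono)
      have "norm (gamma_psi (Complex a t)) \<le> 33 * ln (3 + norm (Complex a t))"
        using a by (intro norm_gamma_psi_le) auto
      then show "norm (gamma_psi (Complex a t) / 2) \<le> 66 * L" using l2 by (simp add: norm_divide)
    qed (use a in auto)
    also have "a * (66 * L) = 66" using L by (simp add: a_def)
    finally have "\<bar>zeta_pairing J T t\<bar> \<le> A * (Y * (d + B + D * L)) + 66" by simp
    also have "Y * (d + B + D * L) \<le> (1 + B + D) * (Y * d + Y * L + 1)"
    proof -
      have p: "0 \<le> Y * d" "0 \<le> Y * L" "Y * B \<le> B" using Y d L BD by (auto simp: mult_left_le_one_le)
      have q: "0 \<le> (B + D) * (Y * d)" "0 \<le> (1 + B) * (Y * L)" "0 \<le> 1 + D" using p BD by auto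
      have "(1 + B + D) * (Y * d + Y * L + 1) = Y * d + (B + D) * (Y * d) + (1 + B) * (Y * L) + D * (Y * L) + B + (1 + D)"
        by (simp add: algebra_simps)
      moreover have "Y * (d + B + D * L) = Y * d + Y * B + D * (Y * L)" by (simp add: algebra_simps)
      ultimately show ?thesis using p q by linarith
    qed
    then have "A * (Y * (d + B + D * L)) + 66 \<le> A * ((1 + B + D) * (Y * d + Y * L + 1)) + 66 * (Y * d + Y * L + 1)"
      using A Y d L by (intro add_mono mult_left_mono) auto
    also have "\<dots> = C * (Y * d + Y * L + 1)" by (simp add: C_def algebra_simps)
    finally show ?thesis by (simp add: d_def L_def)
  qed
  moreover have "C \<ge> 1" using A BD by (simp add: C_def add_increasing)
  ultimately show ?thesis by blast
qed

end


section \<open>From prime powers to primes, and Markov's inequality\<close>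

lemma npow_polar:
  assumes "n > 0"
  shows "npow (Complex \<sigma> t) n = of_real (real n powr - \<sigma>) * cis (- t * ln (real n))"
proof -
  have "- Complex \<sigma> t * of_real (ln (real n)) = of_real (- \<sigma> * ln (real n)) + \<i> * of_real (- t * ln (real n))"
    by (simp add: complex_eq_iff)
  then show ?thesis using assms
    by (simp only: npow_def exp_add exp_of_real cis_conv_exp powr_def) simp
qed

definition prime_coeff :: "real \<Rightarrow> nat \<Rightarrow> complex" where
  "prime_coeff Y p = of_real (ln (real p) * real p powr - (1 / 2 + Y)) * kern_hat (Y * ln (real p))"

definition prime_poly :: "real \<Rightarrow> real \<Rightarrow> complex" where
  "prime_poly Y t = (\<Sum>p | prime p \<and> p \<le> nat \<lfloor>exp (2 / Y)\<rfloor>. prime_coeff Y p * cis (- t * ln (real p)))"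

lemma powr_half_bound: "n > 0 \<Longrightarrow> Y \<ge> 0 \<Longrightarrow> real n powr - (1 / 2 + Y) \<le> 1 / sqrt (real n)"
proof -
  assume n: "n > 0" and Y: "Y \<ge> 0"
  have "real n powr - (1 / 2 + Y) \<le> real n powr - (1 / 2)" using n Y by (intro powr_mono) auto
  also have "\<dots> = 1 / sqrt (real n)" by (simp add: powr_minus_divide powr_half_sqrt)
  finally show ?thesis .
qed

context
  fixes Y :: real and N :: nat
  assumes Y: "0 < Y"
  defines "N \<equiv> nat \<lfloor>exp (2 / Y)\<rfloor>"
begin

lemma poly_length: "N \<ge> 1" "ln (real N) \<le> 2 / Y" "real N \<le> exp (2 / Y)"
proof -
  have "exp (2 / Y) \<ge> 1" using Y by simp
  then have "\<lfloor>exp (2 / Y)\<rfloor> \<ge> 1" by simp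
  then show N: "N \<ge> 1" by (simp add: N_def nat_le_eq_zle[of 1, simplified] le_nat_iff)
  show NE: "real N \<le> exp (2 / Y)" unfolding N_def by (simp add: of_nat_nat)
  have "ln (real N) \<le> ln (exp (2 / Y))" using N NE by (subst ln_le_cancel_iff) auto
  then show "ln (real N) \<le> 2 / Y" by simp
qed

text \<open>Higher prime powers cost \<open>O(ln N) = O(1 / Y)\<close>, bounded after the factor
  \<open>Y\<close> in the pairing bound. They are split off because the moment estimate counts
  factorizations into primes.\<close>

lemma dirichlet_poly_minus_prime_poly: "norm (dirichlet_poly Y t - prime_poly Y t) \<le> 16 * kern_total / Y"
proof -
  let ?f = "\<lambda>n. mangoldt n * kern_hat (Y * ln (real n)) * npow (Complex (1 / 2 + Y) t) n"
  have U: "{1..N} = {p. prime p \<and> p \<le> N} \<union> {n. n \<in> {1..N} \<and> \<not> prime n}"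
    by (auto dest: prime_gt_0_nat intro: Suc_leI)
  have "dirichlet_poly Y t = (\<Sum>n=1..N. ?f n)" unfolding dirichlet_poly_def N_def ..
  also have "\<dots> = (\<Sum>n\<in>{p. prime p \<and> p \<le> N} \<union> {n. n \<in> {1..N} \<and> \<not> prime n}. ?f n)"
    by (rule sum.cong[OF U refl])
  also have "\<dots> = (\<Sum>n | prime n \<and> n \<le> N. ?f n) + (\<Sum>n | n \<in> {1..N} \<and> \<not> prime n. ?f n)"
    by (rule sum.union_disjoint) auto
  also have "(\<Sum>n | prime n \<and> n \<le> N. ?f n) = prime_poly Y t"
    unfolding prime_poly_def N_def
    by (intro sum.cong refl) (auto simp: prime_coeff_def npow_polar prime_gt_0_nat mult_ac)
  finally have "norm (dirichlet_poly Y t - prime_poly Y t) = norm (\<Sum>n | n \<in> {1..N} \<and> \<not> prime n. ?f n)" by simp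
  also have "\<dots> \<le> (\<Sum>n | n \<in> {1..N} \<and> \<not> prime n. kern_total * (mangoldt n / sqrt (real n)))"
  proof (rule sum_norm_le)
    fix n assume "n \<in> {n. n \<in> {1..N} \<and> \<not> prime n}"
    then have n: "n > 0" by auto
    have "norm (?f n) = mangoldt n * norm (kern_hat (Y * ln (real n))) * real n powr - (1 / 2 + Y)"
      using n by (simp add: norm_mult npow_polar)
    also have "\<dots> \<le> mangoldt n * kern_total * (1 / sqrt (real n))"
      using n Y kern_total_ge by (intro mult_mono powr_half_bound norm_kern_hat_le mangoldt_nonneg mult_nonneg_nonneg) auto
    finally show "norm (?f n) \<le> kern_total * (mangoldt n / sqrt (real n))" by (simp add: mult_ac)
  qed
  also have "\<dots> = kern_total * (\<Sum>n | n \<in> {1..N} \<and> \<not> prime n. mangoldt n / sqrt (real n))"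
    by (rule sum_distrib_left[symmetric])
  also have "\<dots> \<le> kern_total * (8 * (2 / Y))"
    using sum_mangoldt_nonprime_le[OF poly_length(1)] poly_length(2) kern_total_ge
    by (intro mult_left_mono) auto
  finally show ?thesis by (simp add: mult_ac)
qed

text \<open>The variance of the prime polynomial: \<open>2 * (ln N)^2\<close> with
  \<open>ln N \<le> 2 / Y\<close>.\<close>

lemma prime_coeff_square_sum: "(\<Sum>p | prime p \<and> p \<le> N. (norm (prime_coeff Y p))\<^sup>2) \<le> 8 * kern_total\<^sup>2 / Y\<^sup>2"
proof -
  have "(\<Sum>p | prime p \<and> p \<le> N. (norm (prime_coeff Y p))\<^sup>2) \<le> (\<Sum>p | prime p \<and> p \<le> N. kern_total\<^sup>2 * ((ln (real p))\<^sup>2 / real p))"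
  proof (rule sum_mono)
    fix p assume "p \<in> {p. prime p \<and> p \<le> N}"
    then have p: "p > 0" by (auto dest: prime_gt_0_nat)
    then have l: "ln (real p) \<ge> 0" by simp
    have "norm (prime_coeff Y p) = ln (real p) * real p powr - (1 / 2 + Y) * norm (kern_hat (Y * ln (real p)))"
      using l by (simp add: prime_coeff_def norm_mult)
    also have "\<dots> \<le> ln (real p) * (1 / sqrt (real p)) * kern_total"
      using p l Y kern_total_ge by (intro mult_mono powr_half_bound norm_kern_hat_le mult_nonneg_nonneg) auto
    finally have "(norm (prime_coeff Y p))\<^sup>2 \<le> (ln (real p) * (1 / sqrt (real p)) * kern_total)\<^sup>2"
      by (intro power_mono) auto
    also have "\<dots> = kern_total\<^sup>2 * ((ln (real p))\<^sup>2 / real p)"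
      by (simp add: power_mult_distrib power_divide)
    finally show "(norm (prime_coeff Y p))\<^sup>2 \<le> kern_total\<^sup>2 * ((ln (real p))\<^sup>2 / real p)" .
  qed
  also have "\<dots> = kern_total\<^sup>2 * (\<Sum>p | prime p \<and> p \<le> N. (ln (real p))\<^sup>2 / real p)" by (rule sum_distrib_left[symmetric])
  also have "\<dots> \<le> kern_total\<^sup>2 * (2 * (2 / Y)\<^sup>2)"
  proof (rule mult_left_mono)
    have "(ln (real N))\<^sup>2 \<le> (2 / Y)\<^sup>2" using poly_length by (intro power_mono) auto
    then show "(\<Sum>p | prime p \<and> p \<le> N. (ln (real p))\<^sup>2 / real p) \<le> 2 * (2 / Y)\<^sup>2"
      using sum_log_sq_over_primes_le[OF poly_length(1)] by linarith
  qed auto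
  finally show ?thesis by (simp add: power_divide mult.commute)
qed

text \<open>Markov's inequality for the power \<open>2 * k\<close>; as
  \<open>N \<le> exp (2 / Y)\<close>, the hypothesis on \<open>T\<close> provides
  \<open>N ^ (2 * k) \<le> T\<close>.\<close>

lemma prime_poly_tail:
  assumes T: "exp (4 * real k / Y) \<le> T" and l: "l > 0"
  shows "measure lborel {t \<in> {T..2 * T}. l \<le> norm (prime_poly Y t)}
     \<le> 3 * T * fact k * (8 * kern_total\<^sup>2 / Y\<^sup>2) ^ k / l ^ (2 * k)"
proof -
  define u where "u = (\<lambda>t. indicator {T..2 * T} t *\<^sub>R norm (prime_poly Y t) ^ (2 * k))"
  have T0: "T > 0" using T by (meson exp_gt_zero less_le_trans)
  have cont: "continuous_on A (\<lambda>t. norm (prime_poly Y t) ^ (2 * k))" for A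
    unfolding prime_poly_def by (intro continuous_intros)
  have si: "set_integrable lborel {T..2 * T} (\<lambda>t. norm (prime_poly Y t) ^ (2 * k))"
    by (rule borel_integrable_atLeastAtMost') (rule cont)
  have ui: "integrable lborel u" using si unfolding set_integrable_def u_def .
  have NT: "real N ^ (2 * k) \<le> T"
  proof -
    have "real N ^ (2 * k) \<le> exp (2 / Y) ^ (2 * k)" using poly_length by (intro power_mono) auto
    also have "\<dots> = exp (4 * real k / Y)" by (simp flip: exp_of_nat_mult)
    finally show ?thesis using T by simp
  qed
  have "(LINT t|lborel. u t) = integral {T..2 * T} (\<lambda>t. norm (prime_poly Y t) ^ (2 * k))"
    using set_borel_integral_eq_integral(2)[OF si] unfolding set_lebesgue_integral_def u_def .
  also have "\<dots> \<le> 3 * T * fact k * (\<Sum>p | prime p \<and> p \<le> N. (norm (prime_coeff Y p))\<^sup>2) ^ k"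
    unfolding prime_poly_def N_def[symmetric] by (rule prime_polynomial_moment[OF _ poly_length(1) NT]) auto
  also have "\<dots> \<le> 3 * T * fact k * (8 * kern_total\<^sup>2 / Y\<^sup>2) ^ k"
    using T0 by (intro mult_left_mono power_mono prime_coeff_square_sum sum_nonneg) auto
  finally have U: "(LINT t|lborel. u t) \<le> 3 * T * fact k * (8 * kern_total\<^sup>2 / Y\<^sup>2) ^ k" .
  have "measure lborel {t \<in> {T..2 * T}. l \<le> norm (prime_poly Y t)} \<le> measure lborel {t \<in> {T..2 * T}. l ^ (2 * k) \<le> u t}"
  proof (rule measure_mono_fmeasurable)
    show "{t \<in> {T..2 * T}. l \<le> norm (prime_poly Y t)} \<subseteq> {t \<in> {T..2 * T}. l ^ (2 * k) \<le> u t}"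
      using l by (auto simp: u_def intro!: power_mono)
    have m: "(\<lambda>t. norm (prime_poly Y t)) \<in> borel_measurable borel"
      unfolding prime_poly_def by (intro borel_measurable_continuous_onI continuous_intros)
    then show "{t \<in> {T..2 * T}. l \<le> norm (prime_poly Y t)} \<in> sets lborel" by measurable
    have "u \<in> borel_measurable borel" using borel_measurable_integrable[OF ui] by simp
    then have "{t \<in> {T..2 * T}. l ^ (2 * k) \<le> u t} \<in> sets borel" by measurable
    then show "{t \<in> {T..2 * T}. l ^ (2 * k) \<le> u t} \<in> fmeasurable lborel"
      by (intro fmeasurableI2[OF fmeasurable_cbox[of T "2 * T"]]) auto
  qed
  also have "\<dots> \<le> (LINT t|lborel. u t) / l ^ (2 * k)"
  proof -
    have "measure lborel {t \<in> {T..2 * T}. l ^ (2 * k) \<le> u t} * l ^ (2 * k) = (LINT t|lborel. l ^ (2 * k) * indicator {t \<in> {T..2 * T}. l ^ (2 * k) \<le> u t} t)"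
      by (simp add: mult.commute)
    also have "\<dots> \<le> (LINT t|lborel. u t)"
    proof (rule integral_mono[OF _ ui])
      have "u \<in> borel_measurable borel" using borel_measurable_integrable[OF ui] by simp
      then have "{t \<in> {T..2 * T}. l ^ (2 * k) \<le> u t} \<in> sets borel" by measurable
      then have "{t \<in> {T..2 * T}. l ^ (2 * k) \<le> u t} \<in> fmeasurable lborel"
        by (intro fmeasurableI2[OF fmeasurable_cbox[of T "2 * T"]]) auto
      then show "integrable lborel (\<lambda>t. l ^ (2 * k) * indicator {t \<in> {T..2 * T}. l ^ (2 * k) \<le> u t} t)"
        by (intro integrable_mult_right integrable_real_indicator) (auto simp: fmeasurable_def)
      show "l ^ (2 * k) * indicator {t \<in> {T..2 * T}. l ^ (2 * k) \<le> u t} t \<le> u t" for t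
        by (auto simp: indicator_def u_def)
    qed
    finally show ?thesis using l by (simp add: pos_le_divide_eq)
  qed
  also have "\<dots> \<le> 3 * T * fact k * (8 * kern_total\<^sup>2 / Y\<^sup>2) ^ k / l ^ (2 * k)"
    using U l by (intro divide_right_mono) auto
  finally show ?thesis .
qed

end


section \<open>Choice of parameters\<close>

text \<open>\<open>M \<le> sqrt x\<close> bounds the base by \<open>x powr (- 1 / 2)\<close>, and
  \<open>c * x \<ge> 8\<close> means that rounding \<open>c * x / 4\<close> down loses at most half;
  hence \<open>c / 16\<close>.\<close>

lemma tail_numerics:
  fixes c x M :: real
  assumes c: "c > 0" and cx: "c * x \<ge> 8" and x: "x \<ge> 1" and M: "M \<ge> 0" "M\<^sup>2 \<le> x"
  shows "(M / x) ^ nat \<lfloor>c * x / 4\<rfloor> \<le> exp (- (c / 16) * x * ln x)"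
proof -
  define k where "k = nat \<lfloor>c * x / 4\<rfloor>"
  have k: "real k \<ge> c * x / 8" using cx unfolding k_def by linarith
  have "M \<le> sqrt x" using M by (intro real_le_rsqrt)
  then have "M / x \<le> sqrt x / x" using x by (intro divide_right_mono) auto
  also have "\<dots> = x powr - (1 / 2)" using x by (simp add: powr_minus_divide powr_half_sqrt field_simps real_sqrt_mult[symmetric])
  also have "\<dots> = exp (- (ln x / 2))" using x by (simp add: powr_def)
  finally have "(M / x) ^ k \<le> exp (- (ln x / 2)) ^ k" using M x by (intro power_mono) auto
  also have "\<dots> = exp (- (real k * (ln x / 2)))" by (simp flip: exp_of_nat_mult)
  also have "\<dots> \<le> exp (- (c * x / 8 * (ln x / 2)))"
  proof -
    have "c * x / 8 * (ln x / 2) \<le> real k * (ln x / 2)" using k x by (intro mult_right_mono) auto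
    then show ?thesis by (simp only: exp_le_cancel_iff neg_le_iff_le)
  qed
  also have "- (c * x / 8 * (ln x / 2)) = - (c / 16) * x * ln x" by simp
  finally show ?thesis by (simp add: k_def)
qed

theorem theorem2p6:
  assumes "Riemann_hypothesis"
  shows "\<exists>C>0. \<exists>K>0. \<forall>x\<ge>2. \<forall>T\<ge>2.
           \<P>(t in uniform_measure lborel {T..2 * T}. \<bar>zeta_pairing J T t\<bar> \<ge> x)
             \<le> K * exp (- C * x * ln x)"
proof -
  obtain A where "rh_xi A" using rh_xi_exists[OF assms] by blast
  then interpret rh_xi A .
  obtain C1 where C1: "C1 \<ge> 1" and bound: "\<And>T t Y. T \<ge> 2 \<Longrightarrow> t \<in> {T..2 * T} \<Longrightarrow> 0 < Y \<Longrightarrow> Y \<le> 1 \<Longrightarrow> 1 / ln T \<le> 2 * Y \<Longrightarrow>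
      exp (3 / Y) \<le> exp 3 * T \<Longrightarrow> \<bar>zeta_pairing J T t\<bar> \<le> C1 * (Y * norm (dirichlet_poly Y t) + Y * ln T + 1)"
    using zeta_pairing_bound by blast
  define \<kappa> where "\<kappa> = kern_total"
  have \<kappa>: "\<kappa> \<ge> 1 / 8" unfolding \<kappa>_def by (rule kern_total_ge)
  \<comment> \<open>Makes the archimedean contribution \<open>C1 * Y * L\<close> equal to
    \<open>x / 8\<close>.\<close>
  define c where "c = 1 / (8 * C1)"
  have c: "c > 0" "c \<le> 1 / 8" "C1 * c = 1 / 8" using C1 by (auto simp: c_def field_simps)
  \<comment> \<open>\<open>8 * \<kappa>^2\<close> from the variance times \<open>(2 * C1)^2\<close>
    from the squared threshold \<open>l\<close>; the powers of \<open>Y\<close> cancel.\<close>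
  define M where "M = 32 * \<kappa>\<^sup>2 * C1\<^sup>2"
  have M: "M \<ge> 0" by (simp add: M_def)
  define Dm where "Dm = (\<Sum>n=1..nat \<lfloor>exp (2::real)\<rfloor>. mangoldt n * \<kappa>)"
  have Dm: "Dm \<ge> 0" unfolding Dm_def using \<kappa> by (intro sum_nonneg mult_nonneg_nonneg mangoldt_nonneg) auto
  have Dm_bound: "norm (dirichlet_poly 1 t) \<le> Dm" for t
    unfolding dirichlet_poly_def Dm_def div_by_1
  proof (rule sum_norm_le)
    fix n assume "n \<in> {1..nat \<lfloor>exp (2::real)\<rfloor>}"
    then have n: "n > 0" by auto
    have "norm (mangoldt n * kern_hat (1 * ln (real n)) * npow (Complex (1 / 2 + 1) t) n)
        = mangoldt n * norm (kern_hat (ln (real n))) * real n powr - (1 / 2 + 1)"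
      using n by (simp add: norm_mult npow_polar)
    also have "\<dots> \<le> mangoldt n * \<kappa> * 1"
    proof (intro mult_mono mult_nonneg_nonneg mangoldt_nonneg)
      show "norm (kern_hat (ln (real n))) \<le> \<kappa>" unfolding \<kappa>_def by (rule norm_kern_hat_le)
      have "real n powr - (1 / 2 + 1) \<le> real n powr 0" using n by (intro powr_mono) auto
      then show "real n powr - (1 / 2 + 1) \<le> 1" using n by simp
    qed (use \<kappa> in auto)
    finally show "norm (mangoldt n * kern_hat (1 * ln (real n)) * npow (Complex (1 / 2 + 1) t) n) \<le> mangoldt n * \<kappa>" by simp
  qed
  \<comment> \<open>One threshold for each purpose: \<open>64 * C1\<close> gives
    \<open>c * x \<ge> 8\<close> and \<open>C1 \<le> x / 64\<close>, the next keeps the prime powers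
    below \<open>x / 8\<close>, \<open>M^2\<close> is for \<open>tail_numerics\<close>, and
    \<open>8 * C1 * Dm\<close> is for the case \<open>Y = 1\<close>.\<close>
  define x0 where "x0 = 64 * C1 + 128 * C1 * \<kappa> + M\<^sup>2 + 8 * C1 * Dm + 2"
  define C where "C = c / 16"
  \<comment> \<open>The exponential makes the bound at least 1 for \<open>x < x0\<close>, enough for
    a probability; 3 is the constant of the moment estimate.\<close>
  define K where "K = 3 + exp (C * (x0 * ln x0))"
  have C: "C > 0" using c by (simp add: C_def)
  have K: "K > 0" by (simp add: K_def add_pos_pos)
  have "\<P>(t in uniform_measure lborel {T..2 * T}. \<bar>zeta_pairing J T t\<bar> \<ge> x) \<le> K * exp (- C * x * ln x)"
    if x: "x \<ge> 2" and T: "T \<ge> 2" for x T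
  proof (cases "x < x0")
    case True
    have "emeasure lborel {T..2 * T} = ennreal T" using T by simp
    then interpret U: prob_space "uniform_measure lborel {T..2 * T}"
      using T by (intro prob_space_uniform_measure) auto
    have "x * ln x \<le> x0 * ln x0" using True x by (intro mult_mono) auto
    then have "C * (x * ln x) \<le> C * (x0 * ln x0)" using C by (intro mult_left_mono) auto
    then have "1 \<le> exp (C * (x0 * ln x0)) * exp (- C * x * ln x)" by (simp flip: exp_add)
    also have "\<dots> \<le> K * exp (- C * x * ln x)" by (intro mult_right_mono) (auto simp: K_def)
    finally show ?thesis using U.prob_le_1 by (rule order.trans[rotated])
  next
    case False
    then have x0: "x \<ge> x0" by simp
    have xs: "x \<ge> 64 * C1" "x \<ge> 128 * C1 * \<kappa>" "x \<ge> M\<^sup>2" "x \<ge> 8 * C1 * Dm"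
    proof -
      have p: "0 \<le> C1 * \<kappa>" "0 \<le> M\<^sup>2" "0 \<le> C1 * Dm" using C1 \<kappa> Dm by auto
      then show "x \<ge> 64 * C1" "x \<ge> 128 * C1 * \<kappa>" "x \<ge> M\<^sup>2" "x \<ge> 8 * C1 * Dm"
        using x0 C1 unfolding x0_def by linarith+
    qed
    have cx: "c * x \<ge> 8"
    proof -
      have "c * (64 * C1) \<le> c * x" using xs(1) c by (intro mult_left_mono) auto
      moreover have "c * (64 * C1) = 8" using C1 by (simp add: c_def)
      ultimately show ?thesis by linarith
    qed
    define L where "L = ln T"
    have L: "L \<ge> 1 / 2" unfolding L_def by (rule ln_ge_half[OF T])
    define S where "S = {t. \<bar>zeta_pairing J T t\<bar> \<ge> x}"
    show ?thesis
    proof (cases "S \<in> sets borel")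
      \<comment> \<open>A set outside the sigma-algebra has \<open>measure\<close> 0 by
        convention.\<close>
      case False
      then have "\<P>(t in uniform_measure lborel {T..2 * T}. \<bar>zeta_pairing J T t\<bar> \<ge> x) = 0"
        using measure_notin_sets[of S "uniform_measure lborel {T..2 * T}"] by (simp add: S_def)
      then show ?thesis using K by simp
    next
      case True
      have "\<P>(t in uniform_measure lborel {T..2 * T}. \<bar>zeta_pairing J T t\<bar> \<ge> x) = measure (uniform_measure lborel {T..2 * T}) S"
        by (simp add: S_def)
      also have "\<dots> = measure lborel ({T..2 * T} \<inter> S) / measure lborel {T..2 * T}"
        using T True by (intro measure_uniform_measure) auto
      finally have P: "\<P>(t in uniform_measure lborel {T..2 * T}. \<bar>zeta_pairing J T t\<bar> \<ge> x) = measure lborel ({T..2 * T} \<inter> S) / T"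
        using T by simp
      show ?thesis
      proof (cases "c * x \<le> L")
        \<comment> \<open>Here \<open>L < c * x\<close>, and at \<open>Y = 1\<close> the
          deterministic bound already stays below \<open>x\<close>: its parts are at most
          \<open>x / 8\<close>, \<open>x / 8\<close> and \<open>x / 64\<close>.\<close>
        case False
        have "{T..2 * T} \<inter> S = {}"
        proof -
          have "\<bar>zeta_pairing J T t\<bar> < x" if "t \<in> {T..2 * T}" for t
          proof -
            have "1 / ln T \<le> 2 * 1" using L unfolding L_def by (simp add: divide_simps)
            then have "\<bar>zeta_pairing J T t\<bar> \<le> C1 * (1 * norm (dirichlet_poly 1 t) + 1 * ln T + 1)"
              using T that by (intro bound) auto
            also have "\<dots> \<le> C1 * (Dm + c * x + 1)"
              using False Dm_bound[of t] C1 unfolding L_def by (intro mult_left_mono add_mono) auto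
            also have "\<dots> = C1 * Dm + C1 * c * x + C1" by (simp add: algebra_simps)
            also have "\<dots> < x" unfolding c(3) using xs x by linarith
            finally show ?thesis .
          qed
          then show ?thesis by (fastforce simp: S_def)
        qed
        then show ?thesis unfolding P using K by simp
      next
        case True
        define Y where "Y = c * x / L"
        have Y: "0 < Y" "Y \<le> 1" using cx L True by (auto simp: Y_def divide_le_eq)
        have YL: "Y * L = c * x" using L by (simp add: Y_def)
        \<comment> \<open>Rounded so that \<open>4 * k \<le> c * x\<close>, which yields
          \<open>exp (4 * k / Y) \<le> T\<close> because \<open>Y * L = c * x\<close>.\<close>
        define k where "k = nat \<lfloor>c * x / 4\<rfloor>"
        define l where "l = x / (2 * C1 * Y)"
        have l: "l > 0" using x C1 Y by (simp add: l_def)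
        have k4: "4 * real k \<le> c * x" using cx unfolding k_def by linarith
        have kx: "real k \<le> x"
        proof -
          have "c * x \<le> 1 / 8 * x" using c x by (intro mult_right_mono) auto
          then show ?thesis using k4 x by linarith
        qed
        have y1: "1 / ln T \<le> 2 * Y"
          using cx L unfolding Y_def L_def[symmetric] by (intro order.trans[OF divide_right_mono[of 1 "2 * (c * x)"]]) auto
        have "exp (3 / Y) \<le> exp L"
        proof -
          have "3 / Y = 3 * L / (c * x)" using L by (simp add: Y_def)
          also have "\<dots> \<le> L" using cx L by (simp add: divide_le_eq mult.commute mult_left_mono)
          finally show ?thesis by simp
        qed
        also have "exp L = T" using T by (simp add: L_def)
        finally have y2: "exp (3 / Y) \<le> exp 3 * T" using T by (smt (verit) mult_le_cancel_right1 one_le_exp_iff)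
        have sub: "{T..2 * T} \<inter> S \<subseteq> {t \<in> {T..2 * T}. l \<le> norm (prime_poly Y t)}"
        proof
          fix t assume t: "t \<in> {T..2 * T} \<inter> S"
          have "x \<le> C1 * (Y * norm (dirichlet_poly Y t) + Y * ln T + 1)"
            using bound[OF T _ Y y1 y2, of t] t by (auto simp: S_def)
          also have "norm (dirichlet_poly Y t) \<le> norm (prime_poly Y t) + 16 * \<kappa> / Y"
            using dirichlet_poly_minus_prime_poly[OF Y(1), of t] norm_triangle_sub[of "dirichlet_poly Y t" "prime_poly Y t"]
            by (simp add: \<kappa>_def)
          finally have "x \<le> C1 * (Y * (norm (prime_poly Y t) + 16 * \<kappa> / Y) + Y * ln T + 1)"
            using C1 Y by (simp add: mult_left_mono)
          also have "\<dots> = C1 * Y * norm (prime_poly Y t) + 16 * (C1 * \<kappa>) + C1 * c * x + C1"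
            using Y YL by (simp add: algebra_simps L_def)
          \<comment> \<open>The prime powers take at most \<open>x / 8\<close>, the archimedean term
            \<open>x / 8\<close> and the constant at most \<open>x / 64\<close>.\<close>
          finally have "x / 2 \<le> C1 * Y * norm (prime_poly Y t)"
            unfolding c(3) using xs x by linarith
          then have "l \<le> norm (prime_poly Y t)"
            using C1 Y by (simp add: l_def divide_le_eq mult_ac)
          then show "t \<in> {t \<in> {T..2 * T}. l \<le> norm (prime_poly Y t)}" using t by auto
        qed
        have kT: "exp (4 * real k / Y) \<le> T"
        proof -
          have "4 * real k / Y \<le> c * x / Y" using k4 Y by (intro divide_right_mono) auto
          also have "\<dots> = L" using c x L by (simp add: Y_def)
          finally have "exp (4 * real k / Y) \<le> exp L" by simp
          then show ?thesis using T by (simp add: L_def)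
        qed
        have "measure lborel ({T..2 * T} \<inter> S) \<le> measure lborel {t \<in> {T..2 * T}. l \<le> norm (prime_poly Y t)}"
        proof (rule measure_mono_fmeasurable[OF sub])
          show "{T..2 * T} \<inter> S \<in> sets lborel" using \<open>S \<in> sets borel\<close> by simp
          have "(\<lambda>t. norm (prime_poly Y t)) \<in> borel_measurable borel"
            unfolding prime_poly_def by (intro borel_measurable_continuous_onI continuous_intros)
          then have "{t \<in> {T..2 * T}. l \<le> norm (prime_poly Y t)} \<in> sets borel" by measurable
          then show "{t \<in> {T..2 * T}. l \<le> norm (prime_poly Y t)} \<in> fmeasurable lborel"
            by (intro fmeasurableI2[OF fmeasurable_cbox[of T "2 * T"]]) auto
        qed
        also have "\<dots> \<le> 3 * T * fact k * (8 * \<kappa>\<^sup>2 / Y\<^sup>2) ^ k / l ^ (2 * k)"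
          unfolding \<kappa>_def by (rule prime_poly_tail[OF Y(1) kT l])
        also have "\<dots> = 3 * T * (fact k * (8 * \<kappa>\<^sup>2 / Y\<^sup>2 / l\<^sup>2) ^ k)"
          by (simp add: power_divide power_mult power_mult_distrib)
        \<comment> \<open>The factorial costs one factor \<open>x\<close> per step, so the
          \<open>1 / x^2\<close> from Markov's inequality leaves \<open>M / x\<close>.\<close>
        also have "\<dots> \<le> 3 * T * (x ^ k * (8 * \<kappa>\<^sup>2 / Y\<^sup>2 / l\<^sup>2) ^ k)"
        proof (intro mult_left_mono mult_right_mono)
          have "fact k \<le> real (k ^ k)" by (rule fact_le_power)
          also have "\<dots> \<le> x ^ k" using kx by (simp add: power_mono)
          finally show "fact k \<le> x ^ k" .
        qed (use T in auto)
        also have "x ^ k * (8 * \<kappa>\<^sup>2 / Y\<^sup>2 / l\<^sup>2) ^ k = (M / x) ^ k"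
        proof -
          have "x * (8 * \<kappa>\<^sup>2 / Y\<^sup>2 / l\<^sup>2) = M / x"
            using x Y C1 by (simp add: l_def M_def power_divide power_mult_distrib field_simps power2_eq_square)
          then show ?thesis by (simp flip: power_mult_distrib)
        qed
        also have "3 * T * (M / x) ^ k \<le> 3 * T * exp (- (c / 16) * x * ln x)"
          unfolding k_def using c cx x M xs(3) T by (intro mult_left_mono tail_numerics) auto
        finally have "measure lborel ({T..2 * T} \<inter> S) / T \<le> 3 * exp (- C * x * ln x)"
          using T by (simp add: C_def divide_le_eq mult_ac)
        also have "\<dots> \<le> K * exp (- C * x * ln x)" by (intro mult_right_mono) (auto simp: K_def)
        finally show ?thesis unfolding P .
      qed
    qed
  qed
  then show ?thesis using C K by blast
qed

end
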